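(* There exist absolute positive constants $c_1$ and $c_2$ such that the following holds for all positive integers $n$ and $\alpha$. (1) If $\alpha < 2\log n$, then $f(n,\alpha) \ge c_1 n^{\frac{\alpha}{2\alpha-1}}$. (2) If $\alpha = a\log n$ for some real $a \ge 2$, then $f(n,\alpha) \ge c_2 \sqrt{\frac{n}{a\log a}}$. Here $f(n,\alpha)$ is the minimum of $\sigma(G)$ over all graphs $G$ on $n$ vertices with independence number $\alpha(G) \le \alpha$.
   Context: Graphs are finite and simple, and $\log$ denotes the natural logarithm. $\alpha(G)$ is the independence number of $G$. A subdivision of a graph $H$ is any graph formed by replacing edges of $H$ by internally vertex-disjoint paths (a path may be a single edge). $\sigma(G)$ denotes the largest integer $p$ such that $G$ contains (as a subgraph) a subdivision of the complete graph $K_p$ of order $p$. *)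

theory Defs
  imports Complex_Main "Graph_Theory.Graph_Theory"
begin

text \<open>
  A finite simple graph is a \<^term>\<open>pair_graph\<close> of the AFP entry Graph-Theory: a finite,
  symmetric, loop-free set of pairs on a finite vertex set.
\<close>

definition independent_set :: "'a pair_pre_digraph \<Rightarrow> 'a set \<Rightarrow> bool" where
  "independent_set G S \<longleftrightarrow> S \<subseteq> pverts G \<and> (\<forall>u\<in>S. \<forall>v\<in>S. (u, v) \<notin> parcs G)"

definition independence_number :: "'a pair_pre_digraph \<Rightarrow> nat" where
  "independence_number G = Max {card S | S. independent_set G S}"

text \<open>
  A library subdivision keeps the branch vertices of \<open>K\<close>, so taking \<open>K\<close> and \<open>H\<close> over the
  vertex type of \<open>G\<close> is no restriction.
\<close>
definition contains_clique_subdivision :: "'a pair_pre_digraph \<Rightarrow> nat \<Rightarrow> bool" where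
  "contains_clique_subdivision G p \<longleftrightarrow>
    (\<exists>K H. complete_digraph p (with_proj K) \<and> subdivision_pair K H
      \<and> subgraph (with_proj H) (with_proj G))"

definition clique_subdivision_number :: "'a pair_pre_digraph \<Rightarrow> nat" where
  "clique_subdivision_number G = Max {p. contains_clique_subdivision G p}"

text \<open>
  Vertices are natural numbers; every finite graph is isomorphic to such a graph.
\<close>
definition admissible_graphs :: "nat \<Rightarrow> nat \<Rightarrow> nat pair_pre_digraph set" where
  "admissible_graphs n \<alpha> =
    {G. pair_graph G \<and> card (pverts G) = n \<and> independence_number G \<le> \<alpha>}"

definition min_clique_subdivision_number :: "nat \<Rightarrow> nat \<Rightarrow> nat" where
  "min_clique_subdivision_number n \<alpha> =
    Min (clique_subdivision_number ` admissible_graphs n \<alpha>)"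

text \<open>The maxima and the minimum above range over finite nonempty sets.\<close>

lemma finite_card_independent:
  assumes "pair_graph G"
  shows "finite {card S | S. independent_set G S}" "{card S | S. independent_set G S} \<noteq> {}"
proof -
  interpret pair_graph G by fact
  have "{card S | S. independent_set G S} \<subseteq> card ` Pow (pverts G)"
    by (auto simp: independent_set_def)
  then show "finite {card S | S. independent_set G S}"
    using pair_finite_verts finite_subset by blast
  have "independent_set G {}" by (simp add: independent_set_def)
  then show "{card S | S. independent_set G S} \<noteq> {}" by blast
qed

lemma subdivision_pair_verts_mono:
  "subdivision_pair K H \<Longrightarrow> pverts K \<subseteq> pverts H"
  by (induct rule: subdivision_pair_induct) auto

lemma contains_clique_subdivision_le:
  assumes "pair_graph G" "contains_clique_subdivision G p"
  shows "p \<le> card (pverts G)"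
proof -
  interpret pair_graph G by fact
  obtain K H where K: "complete_digraph p (with_proj K)" and KH: "subdivision_pair K H"
    and HG: "subgraph (with_proj H) (with_proj G)"
    using assms(2) unfolding contains_clique_subdivision_def by blast
  have "card (pverts K) = p" using K by (simp add: complete_digraph_pair_def)
  moreover have "pverts K \<subseteq> pverts G"
    using subdivision_pair_verts_mono[OF KH] HG by (auto simp: subgraph_def)
  ultimately show ?thesis using card_mono[OF pair_finite_verts] by metis
qed

lemma complete_contains_clique_subdivision:
  assumes "complete_digraph p (with_proj K)" "subgraph (with_proj K) (with_proj G)"
  shows "contains_clique_subdivision G p"
proof -
  interpret pair_graph K using assms(1) by (rule pair_graphI_complete)
  have "subdivision_pair K K" by (intro subdivision_pair_base) unfold_locales
  then show ?thesis using assms unfolding contains_clique_subdivision_def by blast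
qed

lemma finite_clique_subdivision_orders:
  assumes "pair_graph G"
  shows "finite {p. contains_clique_subdivision G p}" "{p. contains_clique_subdivision G p} \<noteq> {}"
proof -
  interpret pair_graph G by fact
  have "{p. contains_clique_subdivision G p} \<subseteq> {..card (pverts G)}"
    using contains_clique_subdivision_le assms by auto
  then show "finite {p. contains_clique_subdivision G p}"
    using finite_subset by blast
  let ?K = "\<lparr>pverts = {}, parcs = {}\<rparr> :: 'a pair_pre_digraph"
  have "complete_digraph 0 (with_proj ?K)" by (simp add: complete_digraph_pair_def)
  moreover have "subgraph (with_proj ?K) (with_proj G)"
    using pair_wf_digraph_axioms
    by (simp add: subgraph_def compatible_def wf_digraph_wp_iff pair_wf_digraph_def)
  ultimately show "{p. contains_clique_subdivision G p} \<noteq> {}"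
    using complete_contains_clique_subdivision by blast
qed

lemma finite_sigma_admissible: "finite (clique_subdivision_number ` admissible_graphs n \<alpha>)"
proof -
  have "clique_subdivision_number G \<le> n" if "G \<in> admissible_graphs n \<alpha>" for G
  proof -
    have G: "pair_graph G" "card (pverts G) = n"
      using that by (auto simp: admissible_graphs_def)
    have "contains_clique_subdivision G (clique_subdivision_number G)"
      unfolding clique_subdivision_number_def using Max_in[OF finite_clique_subdivision_orders[OF G(1)]] by simp
    then show ?thesis using contains_clique_subdivision_le G by blast
  qed
  then have "clique_subdivision_number ` admissible_graphs n \<alpha> \<subseteq> {..n}" by auto
  then show ?thesis using finite_subset by blast
qed

lemma admissible_graphs_nonempty:
  assumes "\<alpha> \<ge> 1"
  shows "admissible_graphs n \<alpha> \<noteq> {}"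
proof -
  let ?G = "\<lparr>pverts = {..<n}, parcs = {(u, v). (u, v) \<in> {..<n} \<times> {..<n} \<and> u \<noteq> v}\<rparr>"
  have "complete_digraph n (with_proj ?G)" by (simp add: complete_digraph_pair_def)
  then have G: "pair_graph ?G" by (rule pair_graphI_complete)
  have "card S \<le> \<alpha>" if "independent_set ?G S" for S
  proof -
    have fin: "finite S" using that finite_subset by (auto simp: independent_set_def)
    have "\<forall>u\<in>S. \<forall>v\<in>S. u = v"
    proof (intro ballI)
      fix u v assume "u \<in> S" "v \<in> S"
      then have "u < n" "v < n" "(u, v) \<notin> parcs ?G"
        using that unfolding independent_set_def by auto
      then show "u = v" by simp
    qed
    then have "card S \<le> 1" using card_le_Suc0_iff_eq[OF fin] by simp
    then show ?thesis using assms by simp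
  qed
  then have "independence_number ?G \<le> \<alpha>"
    unfolding independence_number_def using finite_card_independent[OF G] by auto
  then have "?G \<in> admissible_graphs n \<alpha>" using G by (simp add: admissible_graphs_def)
  then show ?thesis by blast
qed

end

theory Submission
  imports Defs
begin

text \<open>
  Let \<open>L = ln n\<close> and let \<open>G\<close> be a graph on \<open>n\<close> vertices without independent sets of more than \<open>\<alpha>\<close>
  vertices. Both bounds come from one scheme: find a set \<open>X\<close> of \<open>s\<close> branch vertices with few
  nonadjacent pairs, and join every nonadjacent pair by a short path outside \<open>X\<close>, all paths disjoint.
  Adjacent pairs cost nothing, so the scheme works as soon as the number of nonadjacent pairs times
  the length of a path is small compared with the room that is available for the paths.

  \<^bold>\<open>Branch vertices.\<close> If some vertex of \<open>W\<close> has more than \<open>q |W|\<close> non-neighbours in \<open>W\<close>, then these span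
  a graph of smaller independence number, and passing to them costs a factor \<open>q\<close>. Hence \<open>W\<close> contains a
  set \<open>Y\<close> of size at least \<open>q ^ (\<alpha>(W) - 1) |W|\<close> in which every vertex misses at most \<open>q |Y|\<close> others
  (\<open>near_clique_subset\<close>), and \<open>s\<close> suitable vertices of \<open>Y\<close> have at most \<open>q s\<^sup>2\<close> nonadjacent pairs
  (\<open>few_nonadjacent_pairs\<close>). For \<open>W\<close> of size about \<open>n\<close> and \<open>\<alpha>(W) \<le> \<alpha>\<close> the choice
  \<open>q = n powr (- 1 / (2 \<alpha> - 1))\<close> balances the two sides: \<open>s = n powr (\<alpha> / (2 \<alpha> - 1))\<close> and \<open>q s\<^sup>2 = n\<close>.

  \<^bold>\<open>Paths.\<close> Put \<open>a = max (\<alpha> / L) e\<close> and \<open>\<tau> = 1 / ln a\<close>, and replace the vertex set by a subset \<open>U\<close> that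
  maximises \<open>|U| / \<alpha>(U) powr (1 + \<tau>)\<close>. The vertices outside the closed neighbourhood of \<open>A \<subseteq> U\<close> have
  independence number at most \<open>\<alpha>(U) - \<alpha>(A)\<close>, so by maximality that neighbourhood has at least
  \<open>|U| \<alpha>(A) / \<alpha>(U)\<close> vertices, which exceeds \<open>|A|\<close> by a factor (\<open>expansion\<close>). Therefore two vertices of
  large degree are joined by a short path even after many vertices have been deleted, and the paths can
  be chosen one after another (\<open>greedy_routes\<close>, \<open>topological_clique_on\<close>). The exponent has
  to exceed 1 for this factor to exist. It exceeds 1 only by \<open>\<tau>\<close> because, with \<open>t = \<alpha>(U) / \<alpha>\<close>, the set
  \<open>U\<close> may shrink to the part \<open>t powr (1 + \<tau>)\<close> of all vertices: the smaller independence number makes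
  up for the factor \<open>t\<close>, and \<open>t powr \<tau>\<close> has to stay bounded below.

  \<^bold>\<open>Degrees.\<close> Compare the degrees in \<open>U\<close> with \<open>|U| / \<theta>\<close>, where \<open>\<theta>\<close> is a large constant times
  \<open>a ln a \<sqdot> \<alpha>(U) / \<alpha>\<close>. If half of \<open>U\<close> has at least this degree and \<open>\<alpha> \<le> e L\<close>, then \<open>\<theta>\<close> is bounded and the
  scheme applies to these vertices (\<open>clique_in_high_degrees\<close>). If half of \<open>U\<close> has at least this degree
  and \<open>\<alpha> > e L\<close>, then \<open>U\<close> spans a graph of average degree of order \<open>n / (a ln a)\<close>, and a graph of average
  degree \<open>d\<close> contains a subdivision of a clique of order \<open>c sqrt d\<close> (\<open>dense_topological_clique\<close>).

  Otherwise there are many vertices \<open>R\<close> whose degree is about \<open>|U| / \<kappa>\<close> with \<open>\<kappa> \<ge> \<theta>\<close>. An argument of Erdos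
  and Szemeredi now gives a large set of very small independence number
  (\<open>erdos_szemeredi_subset\<close>): a maximum independent set \<open>I\<close> of \<open>R\<close> meets most neighbourhoods in few
  vertices, many vertices have the same trace \<open>T\<close> on \<open>I\<close>, and an independent set among them can replace
  \<open>T\<close> in \<open>I\<close>, so that it is at most as large as \<open>T\<close>. With so small an independence number, \<open>q\<close> can be chosen
  tiny, and this pays for the long paths (\<open>clique_in_low_degrees\<close>). The number of traces is a small
  power of \<open>n\<close> exactly when \<open>\<kappa>\<close> is at least of order \<open>a ln a\<close>; this is where the factor \<open>ln a\<close> in the
  second bound comes from.

  \<^bold>\<open>Average degree.\<close> The theorem on average degree is proved through linkages. A highly connected dense
  subgraph is found by Mader's argument. In it, the branch vertices are chosen freely, each receives its
  own neighbours as terminals, and these terminals have to be linked in pairs. That this is possible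
  (\<open>massed_linked\<close>) is the theorem of Bollobas and Thomason that a graph of connectivity linear in \<open>k\<close> is
  \<open>k\<close>-linked, in the form and with the proof of Thomas and Wollan: in a smallest counterexample every edge
  away from the terminals lies in many triangles, so that the neighbourhood of a vertex of small degree is a dense graph on few
  vertices, linked for trivial reasons, and Menger's theorem leads the terminals there.

  Sets of vertices take the place of paths throughout: a route from \<open>x\<close> to \<open>y\<close> is a set in which \<open>y\<close> can be
  reached from \<open>x\<close>. Such sets survive contractions and unions without any surgery on paths, and they are
  turned into paths only at the very end (\<open>reach_chain\<close>).
\<close>

section \<open>Reaching a vertex inside a vertex set\<close>

definition reach :: "'a rel \<Rightarrow> 'a set \<Rightarrow> 'a rel" where
  "reach E C = (E \<inter> C \<times> C)\<^sup>*"

abbreviation ends :: "'a \<times> 'a \<Rightarrow> 'a set" where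
  "ends p \<equiv> {fst p, snd p}"

lemma reach_refl [simp]: "(x, x) \<in> reach E C"
  by (simp add: reach_def)

lemma reach_trans: "(x, y) \<in> reach E C \<Longrightarrow> (y, z) \<in> reach E C \<Longrightarrow> (x, z) \<in> reach E C"
  by (auto simp: reach_def)

lemma reach_mono: "(x, y) \<in> reach E C \<Longrightarrow> E \<inter> C \<times> C \<subseteq> F \<Longrightarrow> C \<subseteq> D \<Longrightarrow> (x, y) \<in> reach F D"
  unfolding reach_def using rtrancl_mono[of "E \<inter> C \<times> C" "F \<inter> D \<times> D"] by blast

lemma reach_edge: "(x, y) \<in> E \<Longrightarrow> x \<in> C \<Longrightarrow> y \<in> C \<Longrightarrow> (x, y) \<in> reach E C"
  by (auto simp: reach_def)

lemma reach_step:
  "(x, y) \<in> reach E C \<Longrightarrow> (y, z) \<in> E \<Longrightarrow> y \<in> C \<Longrightarrow> z \<in> C \<Longrightarrow> (x, z) \<in> reach E C"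
  using reach_edge reach_trans by metis

lemma reach_sym: "sym E \<Longrightarrow> (x, y) \<in> reach E C \<Longrightarrow> (y, x) \<in> reach E C"
proof -
  assume "sym E" "(x, y) \<in> reach E C"
  moreover have "sym (E \<inter> C \<times> C)" using \<open>sym E\<close> by (auto simp: sym_def)
  ultimately show ?thesis using sym_rtrancl by (metis reach_def symD)
qed

lemma reach_in: "(x, y) \<in> reach E C \<Longrightarrow> x = y \<or> x \<in> C \<and> y \<in> C"
  unfolding reach_def by (metis Int_iff SigmaD1 SigmaD2 converse_rtranclE rtranclE)

lemma reach_induct [consumes 1, case_names base step]:
  assumes "(x, y) \<in> reach E C" "P x"
    "\<And>y z. (x, y) \<in> reach E C \<Longrightarrow> (y, z) \<in> E \<Longrightarrow> y \<in> C \<Longrightarrow> z \<in> C \<Longrightarrow> P y \<Longrightarrow> P z"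
  shows "P y"
  using assms(1) unfolding reach_def
  by (induction rule: rtrancl_induct) (use assms(2,3) in \<open>auto simp: reach_def\<close>)

text \<open>
  Cut the walk at its last visit to \<open>S\<close>; what remains avoids \<open>S\<close>
  except for its first vertex.
\<close>

lemma reach_last_exit:
  assumes "(x, y) \<in> reach E C" "x \<in> C"
  shows "(x, y) \<in> reach E (C - S) \<and> x \<notin> S \<and> y \<notin> S
    \<or> (\<exists>b\<in>C \<inter> S. (b, y) \<in> reach E (insert b (C - S)))"
  using assms(1)
proof (induction rule: reach_induct)
  case base
  then show ?case using assms(2) by (cases "x \<in> S") (auto intro!: bexI[of _ x])
next
  case (step y z)
  show ?case
  proof (cases "z \<in> S")
    case True
    then show ?thesis using step by (auto intro!: bexI[of _ z])
  next
    case False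
    from step.IH show ?thesis
    proof
      assume "(x, y) \<in> reach E (C - S) \<and> x \<notin> S \<and> y \<notin> S"
      then show ?thesis using step False by (auto intro: reach_step)
    next
      assume "\<exists>b\<in>C \<inter> S. (b, y) \<in> reach E (insert b (C - S))"
      then obtain b where b: "b \<in> C \<inter> S" "(b, y) \<in> reach E (insert b (C - S))" by blast
      then have "y \<in> insert b (C - S)" using reach_in[OF b(2)] by auto
      then have "(b, z) \<in> reach E (insert b (C - S))" using b step False by (auto intro: reach_step)
      then show ?thesis using b by blast
    qed
  qed
qed

lemma reach_first_entry:
  assumes "sym E" "(x, y) \<in> reach E C" "y \<in> C"
  shows "(x, y) \<in> reach E (C - S) \<and> x \<notin> S \<and> y \<notin> S
    \<or> (\<exists>a\<in>C \<inter> S. (x, a) \<in> reach E (insert a (C - S)))"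
  using reach_last_exit[OF reach_sym[OF assms(1,2)] assms(3), of S] reach_sym[OF assms(1)] by metis

lemma reach_remove_edge:
  assumes "(p, q) \<in> reach E C" and F_def: "F = E - {(x, y), (y, x)}"
  shows "(p, q) \<in> reach F C \<or> (\<exists>u v. (u, v) \<in> {(x, y), (y, x)} \<and> u \<in> C \<and> v \<in> C
    \<and> (p, u) \<in> reach F C \<and> (v, q) \<in> reach F C)"
  using assms(1)
proof (induction rule: reach_induct)
  case base
  then show ?case by simp
next
  case (step q r)
  show ?case
  proof (cases "(q, r) \<in> F")
    case True
    then show ?thesis using step reach_step[of _ q F C r] by blast
  next
    case False
    then have "(q, r) = (x, y) \<or> (q, r) = (y, x)" using step F_def by auto
    then show ?thesis using step reach_refl[of _ F C] by blast
  qed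
qed

text \<open>
  The set \<open>D\<close> is the part of \<open>C\<close> that is reached from
  \<open>x\<close> before \<open>Z\<close> is met. A route may contain vertices that cannot be
  reached at all, or only beyond \<open>Z\<close>; two routes on different sides of
  \<open>Z\<close> are disjoint only after such vertices have been removed.
\<close>

lemma reach_spine:
  assumes "sym E" "(x, z) \<in> reach E C" "x \<in> C" "z \<in> C" "z \<in> Z"
  obtains a D where "a \<in> C \<inter> Z" "D \<subseteq> C - Z" "\<And>v. v \<in> D \<Longrightarrow> x \<in> D \<and> (x, v) \<in> reach E D"
    "(x, a) \<in> reach E (insert a D)" "x \<in> insert a D"
proof (cases "x \<in> Z")
  case True
  then show ?thesis using that[of x "{}"] assms by auto
next
  case False
  define D where "D = {v \<in> C - Z. (x, v) \<in> reach E (C - Z)}"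
  have xD: "x \<in> D" using False assms by (auto simp: D_def)
  have DD: "(x, v) \<in> reach E D" if "v \<in> D" for v
  proof -
    have "(x, v) \<in> reach E (C - Z)" using that by (simp add: D_def)
    then have "(x, v) \<in> reach E D \<and> v \<in> D"
    proof (induction rule: reach_induct)
      case base then show ?case using xD by simp
    next
      case (step v w)
      then have "w \<in> D" unfolding D_def by (auto intro: reach_step)
      then show ?case using step by (auto intro: reach_step)
    qed
    then show ?thesis by simp
  qed
  have "z \<in> D \<or> (\<exists>v\<in>D. \<exists>a\<in>C \<inter> Z. (v, a) \<in> E)"
    using assms(2)
  proof (induction rule: reach_induct)
    case base then show ?case using xD by simp
  next
    case (step v w)
    then have "w \<in> D" if "v \<in> D" "w \<notin> Z" using that unfolding D_def by (auto intro: reach_step)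
    then show ?case using step by auto
  qed
  then obtain v a where va: "v \<in> D" "a \<in> C \<inter> Z" "(v, a) \<in> E"
    using assms(5) by (auto simp: D_def)
  have "(x, v) \<in> reach E (insert a D)" using DD[OF va(1)] by (rule reach_mono) auto
  then have "(x, a) \<in> reach E (insert a D)" using va by (auto intro: reach_step)
  then show ?thesis using that[of a D] va xD DD by (auto simp: D_def)
qed

section \<open>Menger's theorem\<close>

definition separates :: "'a set \<Rightarrow> 'a rel \<Rightarrow> 'a set \<Rightarrow> 'a set \<Rightarrow> 'a set \<Rightarrow> bool" where
  "separates V E S X Z \<longleftrightarrow> (\<forall>x\<in>X - S. \<forall>z\<in>Z - S. (x, z) \<notin> reach E (V - S))"

lemma separates_sym: "sym E \<Longrightarrow> separates V E S X Z \<Longrightarrow> separates V E S Z X"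
  unfolding separates_def using reach_sym by metis

definition disjoint_routes where
  "disjoint_routes V E X Z T C f \<longleftrightarrow> T \<subseteq> X \<and> inj_on f T \<and> f ` T \<subseteq> Z \<and>
    (\<forall>x\<in>T. C x \<subseteq> V \<and> x \<in> C x \<and> f x \<in> C x \<and> (x, f x) \<in> reach E (C x)) \<and>
    (\<forall>x\<in>T. \<forall>y\<in>T. x \<noteq> y \<longrightarrow> C x \<inter> C y = {})"

lemma disjoint_routesD:
  assumes "disjoint_routes V E X Z T C f"
  shows "T \<subseteq> X" "inj_on f T" "f ` T \<subseteq> Z"
    "t \<in> T \<Longrightarrow> C t \<subseteq> V" "t \<in> T \<Longrightarrow> t \<in> C t" "t \<in> T \<Longrightarrow> f t \<in> C t"
    "t \<in> T \<Longrightarrow> (t, f t) \<in> reach E (C t)"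
    "s \<in> T \<Longrightarrow> t \<in> T \<Longrightarrow> s \<noteq> t \<Longrightarrow> C s \<inter> C t = {}"
  using assms by (simp_all add: disjoint_routes_def)

lemma disjoint_routes_spines:
  assumes "sym E" "disjoint_routes V E X Z T C f"
  obtains D g where "inj_on g T" "g ` T \<subseteq> Z"
    "\<And>x. x \<in> T \<Longrightarrow> D x \<subseteq> C x - Z" "\<And>x. x \<in> T \<Longrightarrow> g x \<in> C x"
    "\<And>x v. x \<in> T \<Longrightarrow> v \<in> D x \<Longrightarrow> x \<in> D x \<and> (x, v) \<in> reach E (D x)"
    "\<And>x. x \<in> T \<Longrightarrow> (x, g x) \<in> reach E (insert (g x) (D x))"
    "\<And>x. x \<in> T \<Longrightarrow> x \<in> insert (g x) (D x)"
proof -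
  define Q where "Q x a D \<longleftrightarrow> a \<in> C x \<inter> Z \<and> D \<subseteq> C x - Z \<and> (\<forall>v\<in>D. x \<in> D \<and> (x, v) \<in> reach E D)
    \<and> (x, a) \<in> reach E (insert a D) \<and> x \<in> insert a D" for x a D
  have "\<exists>a D. Q x a D" if "x \<in> T" for x
  proof -
    have "(x, f x) \<in> reach E (C x)" "x \<in> C x" "f x \<in> C x" "f x \<in> Z"
      using assms(2) that by (auto simp: disjoint_routes_def)
    from reach_spine[OF assms(1) this] show ?thesis unfolding Q_def by metis
  qed
  then obtain g D where gD: "\<And>x. x \<in> T \<Longrightarrow> Q x (g x) (D x)" by metis
  have "inj_on g T"
  proof (rule inj_onI)
    fix x y assume "x \<in> T" "y \<in> T" "g x = g y"
    then have "g x \<in> C x \<inter> C y" using gD[of x] gD[of y] unfolding Q_def by auto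
    then show "x = y" using assms(2) \<open>x \<in> T\<close> \<open>y \<in> T\<close> unfolding disjoint_routes_def by blast
  qed
  then show ?thesis using that[of g D] gD unfolding Q_def by blast
qed

text \<open>
  Induction step for the deletion of an edge \<open>x y\<close>, where \<open>S\<close>
  separates \<open>X\<close> from \<open>Z\<close> without the edge and \<open>x\<close> is
  its end on the side of \<open>X\<close>. A walk from \<open>X\<close> to \<open>Z\<close>
  meets \<open>S\<close> or \<open>x\<close>. Up to the first such vertex it does not use the
  edge: it would have to enter \<open>x\<close> from \<open>y\<close>, but \<open>y\<close> is
  on the side of \<open>Z\<close>.
\<close>

lemma menger_step_separator:
  assumes "sym E" "x \<notin> S" "y \<notin> S" and F_def: "F = E - {(x, y), (y, x)}"
    and S: "separates V F S X Z" and T: "separates V F T X (insert x S)"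
    and yz: "(y, z0) \<in> reach F (V - S)" "z0 \<in> Z - S"
  shows "separates V E T X Z"
  unfolding separates_def
proof (intro ballI notI)
  fix p q assume p: "p \<in> X - T" and q: "q \<in> Z - T" and pq: "(p, q) \<in> reach E (V - T)"
  have symF: "sym F" using assms(1) by (auto simp: F_def sym_def)
  let ?S = "insert x S"
  have noF: "(u, v) \<in> reach F W" if "(u, v) \<in> reach E W" "x \<notin> W" for u v W
    using that(1) by (rule reach_mono) (use that(2) in \<open>auto simp: F_def\<close>)
  show False
  proof (cases "p \<in> ?S")
    case True
    then show False using T p unfolding separates_def by force
  next
    case pS: False
    have avoid: "q \<in> S" if "(p, q) \<in> reach E (V - T - ?S)"
      using noF[OF that] S p q pS unfolding separates_def
      by (metis Diff_iff Diff_mono Diff_subset inf_le1 insert_iff reach_mono subset_insertI)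
    have "\<exists>a\<in>(V - T) \<inter> ?S. (p, a) \<in> reach E (insert a (V - T - ?S))"
    proof (cases "p = q")
      case True
      then show ?thesis using avoid pS by auto
    next
      case False
      then have "q \<in> V - T" using reach_in[OF pq] by auto
      from reach_first_entry[OF assms(1) pq this, of ?S] avoid show ?thesis by auto
    qed
    then obtain a where a: "a \<in> (V - T) \<inter> ?S" "(p, a) \<in> reach E (insert a (V - T - ?S))" by blast
    then have aV: "a \<in> V - T" by simp
    have "(p, a) \<in> reach F (insert a (V - T - ?S))"
    proof (cases "a = x")
      case False
      then show ?thesis using noF[OF a(2)] by auto
    next
      case True
      have "(p, y) \<notin> reach F (insert a (V - T - ?S))"
      proof
        assume "(p, y) \<in> reach F (insert a (V - T - ?S))"
        then have "(p, y) \<in> reach F (V - S)" by (rule reach_mono) (use aV True assms(2) in auto)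
        then have "(p, z0) \<in> reach F (V - S)" using yz reach_trans by metis
        then show False using S p pS yz unfolding separates_def by auto
      qed
      then show ?thesis using reach_remove_edge[OF a(2) F_def] True by auto
    qed
    then have "(p, a) \<in> reach F (V - T)" by (rule reach_mono) (use aV in auto)
    then show False using T p a unfolding separates_def by auto
  qed
qed

text \<open>
  By induction on the number of edges. If deleting the edge \<open>x y\<close> leaves a
  separator \<open>S\<close> with fewer than \<open>k\<close> vertices, then \<open>S \<union>
  {x}\<close> and \<open>S \<union> {y}\<close> have exactly \<open>k\<close> vertices and
  cannot be separated from \<open>X\<close> and from \<open>Z\<close>, respectively, by fewer
  than \<open>k\<close>. The two families of routes that result are joined at \<open>S\<close>
  and along the edge; they do not meet elsewhere because \<open>S\<close> separates.
\<close>

theorem menger: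
  assumes "finite V" "sym E" "irrefl E" "X \<subseteq> V" "Z \<subseteq> V"
    and "\<And>S. S \<subseteq> V \<Longrightarrow> separates V E S X Z \<Longrightarrow> k \<le> card S"
  shows "\<exists>T C f. card T = k \<and> disjoint_routes V E X Z T C f"
  using assms
proof (induction "card (E \<inter> V \<times> V)" arbitrary: E X Z rule: less_induct)
  case less
  note symE = less.prems(2)
  show ?case
  proof (cases "E \<inter> V \<times> V = {}")
    case True
    then have "reach E W = Id" if "W \<subseteq> V" for W
    proof -
      have "E \<inter> W \<times> W = {}" using True that by auto
      then show ?thesis by (simp add: reach_def)
    qed
    then have "separates V E (X \<inter> Z) X Z" by (auto simp: separates_def)
    then have "k \<le> card (X \<inter> Z)" using less.prems by (metis Int_subset_iff inf_le1 order_trans)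
    then obtain T where T: "T \<subseteq> X \<inter> Z" "card T = k" by (meson obtain_subset_with_card_n)
    then have "disjoint_routes V E X Z T (\<lambda>x. {x}) (\<lambda>x. x)"
      using less.prems(4) by (auto simp: disjoint_routes_def)
    then show ?thesis using T by blast
  next
    case False
    then obtain u v where uv: "(u, v) \<in> E" "u \<in> V" "v \<in> V" by auto
    define F where "F = E - {(u, v), (v, u)}"
    have symF: "sym F" and irF: "irrefl F" using symE less.prems(3) by (auto simp: F_def sym_def irrefl_def)
    have "F \<inter> V \<times> V \<subset> E \<inter> V \<times> V" using uv by (auto simp: F_def)
    then have smaller: "card (F \<inter> V \<times> V) < card (E \<inter> V \<times> V)"
      using less.prems(1) by (intro psubset_card_mono) auto
    show ?thesis
    proof (cases "\<forall>S. S \<subseteq> V \<longrightarrow> separates V F S X Z \<longrightarrow> k \<le> card S")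
      case True
      then obtain T C f where *: "card T = k" "disjoint_routes V F X Z T C f"
        using less.hyps[OF smaller less.prems(1) symF irF less.prems(4,5)] by blast
      have "disjoint_routes V E X Z T C f"
        using *(2) unfolding disjoint_routes_def by (auto intro: reach_mono simp: F_def)
      then show ?thesis using * by blast
    next
      case False
      then obtain S where S: "S \<subseteq> V" "separates V F S X Z" "card S < k" by auto
      then have "\<not> separates V E S X Z" using less.prems(6)[of S] by auto
      then obtain x0 z0 where xz: "x0 \<in> X - S" "z0 \<in> Z - S" "(x0, z0) \<in> reach E (V - S)"
        unfolding separates_def by auto
      have "(x0, z0) \<notin> reach F (V - S)" using S xz unfolding separates_def by auto
      then obtain x y where xy: "{(x, y), (y, x)} = {(u, v), (v, u)}" "x \<in> V - S" "y \<in> V - S"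
        "(x0, x) \<in> reach F (V - S)" "(y, z0) \<in> reach F (V - S)"
        using reach_remove_edge[OF xz(3) F_def] by (elim disjE) blast+
      have xyE: "(x, y) \<in> E" using xy(1) uv symE by (auto simp: sym_def doubleton_eq_iff)
      have F2: "F = E - {(x, y), (y, x)}" and F3: "F = E - {(y, x), (x, y)}"
        using xy(1) F_def by auto
      have nxy: "x \<noteq> y" using xyE less.prems(3) by (auto simp: irrefl_def)
      have far: False if "w \<in> V" "x1 \<in> X - S" "z1 \<in> Z - S" "(x1, w) \<in> reach F (V - S)" "(z1, w) \<in> reach F (V - S)" for w x1 z1
        using that S(2) reach_trans[OF that(4) reach_sym[OF symF that(5)]] unfolding separates_def by blast
      have sepx: "separates V F T X (insert x S) \<Longrightarrow> separates V E T X Z" for T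
        using menger_step_separator[OF symE _ _ F2 S(2) _ xy(5) xz(2)] xy by blast
      have sepy: "separates V F T Z (insert y S) \<Longrightarrow> separates V E T Z X" for T
        using menger_step_separator[OF symE _ _ F3 separates_sym[OF symF S(2)] _ reach_sym[OF symF xy(4)] xz(1)] xy by blast
      have "separates V E (insert x S) X Z" unfolding separates_def
      proof (intro ballI notI)
        fix p q assume pq: "p \<in> X - insert x S" "q \<in> Z - insert x S" "(p, q) \<in> reach E (V - insert x S)"
        have "(p, q) \<in> reach F (V - S)" using pq(3) by (rule reach_mono) (auto simp: F2)
        then show False using S(2) pq unfolding separates_def by auto
      qed
      then have "k \<le> card (insert x S)" using less.prems(6) S xy by (metis DiffD1 insert_subset)
      moreover have finS: "finite S" using S less.prems(1) finite_subset by auto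
      ultimately have cS: "card S + 1 = k" using S(3) xy by (simp add: card_insert_if)
      have "\<exists>T C f. card T = k \<and> disjoint_routes V F X (insert x S) T C f"
      proof (rule less.hyps[OF smaller less.prems(1) symF irF less.prems(4)])
        show "insert x S \<subseteq> V" using S xy by blast
        show "\<And>T. T \<subseteq> V \<Longrightarrow> separates V F T X (insert x S) \<Longrightarrow> k \<le> card T"
          using sepx less.prems(6) by blast
      qed
      then obtain T C f where T: "card T = k" "disjoint_routes V F X (insert x S) T C f" by blast
      have "\<exists>T C f. card T = k \<and> disjoint_routes V F Z (insert y S) T C f"
      proof (rule less.hyps[OF smaller less.prems(1) symF irF less.prems(5)])
        show "insert y S \<subseteq> V" using S xy by blast
        show "\<And>T. T \<subseteq> V \<Longrightarrow> separates V F T Z (insert y S) \<Longrightarrow> k \<le> card T"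
          using separates_sym[OF symE sepy] less.prems(6) by blast
      qed
      then obtain T' C' f' where T': "card T' = k" "disjoint_routes V F Z (insert y S) T' C' f'" by blast
      obtain D g where g: "inj_on g T" "g ` T \<subseteq> insert x S"
        and D: "\<And>t. t \<in> T \<Longrightarrow> D t \<subseteq> C t - insert x S" and gC: "\<And>t. t \<in> T \<Longrightarrow> g t \<in> C t"
        and Dr: "\<And>t v. t \<in> T \<Longrightarrow> v \<in> D t \<Longrightarrow> t \<in> D t \<and> (t, v) \<in> reach F (D t)"
        and gr: "\<And>t. t \<in> T \<Longrightarrow> (t, g t) \<in> reach F (insert (g t) (D t))"
        and tin: "\<And>t. t \<in> T \<Longrightarrow> t \<in> insert (g t) (D t)"
        by (rule disjoint_routes_spines[OF symF T(2)]) (rule that)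
      obtain D' g' where g': "inj_on g' T'" "g' ` T' \<subseteq> insert y S"
        and D': "\<And>t. t \<in> T' \<Longrightarrow> D' t \<subseteq> C' t - insert y S" and gC': "\<And>t. t \<in> T' \<Longrightarrow> g' t \<in> C' t"
        and Dr': "\<And>t v. t \<in> T' \<Longrightarrow> v \<in> D' t \<Longrightarrow> t \<in> D' t \<and> (t, v) \<in> reach F (D' t)"
        and gr': "\<And>t. t \<in> T' \<Longrightarrow> (t, g' t) \<in> reach F (insert (g' t) (D' t))"
        and tin': "\<And>t. t \<in> T' \<Longrightarrow> t \<in> insert (g' t) (D' t)"
        by (rule disjoint_routes_spines[OF symF T'(2)]) (rule that)
      note TV = disjoint_routesD(1)[OF T(2)] disjoint_routesD(1)[OF T'(2)]
        disjoint_routesD(4)[OF T(2)] disjoint_routesD(4)[OF T'(2)]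
      note dis = disjoint_routesD(8)[OF T(2)] and dis' = disjoint_routesD(8)[OF T'(2)]
      have cx: "card (insert x S) = k" "card (insert y S) = k" using cS xy finS by auto
      have gT: "g ` T = insert x S"
        using g T(1) cx finS by (metis card_image card_subset_eq finite_insert)
      have gT': "g' ` T' = insert y S"
        using g' T'(1) cx finS by (metis card_image card_subset_eq finite_insert)
      have Dreach: "(t, v) \<in> reach F (V - S) \<and> t \<in> X - S" if "t \<in> T" "v \<in> D t" for t v
      proof
        have DV: "D t \<subseteq> V - S" using D[OF that(1)] TV(3)[OF that(1)] by blast
        show "(t, v) \<in> reach F (V - S)" using Dr[OF that] DV by (auto intro: reach_mono)
        show "t \<in> X - S" using Dr[OF that] DV TV(1) that(1) by blast
      qed
      have Dreach': "(t, v) \<in> reach F (V - S) \<and> t \<in> Z - S" if "t \<in> T'" "v \<in> D' t" for t v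
      proof
        have DV: "D' t \<subseteq> V - S" using D'[OF that(1)] TV(4)[OF that(1)] by blast
        show "(t, v) \<in> reach F (V - S)" using Dr'[OF that] DV by (auto intro: reach_mono)
        show "t \<in> Z - S" using Dr'[OF that] DV TV(2) that(1) by blast
      qed
      (* A route that ends in x is continued across the edge at y; all others are continued where
         they end. *)
      define \<sigma> where "\<sigma> w = (if w = x then y else w)" for w
      have sig: "\<sigma> w \<in> insert y S" if "w \<in> insert x S" for w using that by (auto simp: \<sigma>_def)
      define m where "m t = inv_into T' g' (\<sigma> (g t))" for t
      have m: "m t \<in> T'" "g' (m t) = \<sigma> (g t)" if "t \<in> T" for t
      proof -
        have "\<sigma> (g t) \<in> g' ` T'" using gT' sig gT that by auto
        then show "m t \<in> T'" "g' (m t) = \<sigma> (g t)" unfolding m_def by (auto intro: inv_into_into f_inv_into_f)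
      qed
      have inj\<sigma>: "inj_on \<sigma> (insert x S)" using xy by (auto simp: inj_on_def \<sigma>_def)
      have injm: "inj_on m T"
      proof (rule inj_onI)
        fix s t assume st: "s \<in> T" "t \<in> T" "m s = m t"
        then have "\<sigma> (g s) = \<sigma> (g t)" using m by metis
        moreover have "g s \<in> insert x S" "g t \<in> insert x S" using gT st by blast+
        ultimately have "g s = g t" by (rule inj_onD[OF inj\<sigma>])
        then show "s = t" using inj_onD[OF g(1)] st by blast
      qed
      define B where "B t = insert (g t) (D t) \<union> insert (g' (m t)) (D' (m t))" for t
      have y_D: "y \<notin> D t" if "t \<in> T" for t
        using far[OF _ _ xz(2) _ reach_sym[OF symF xy(5)]] Dreach[OF that] xy(3) by blast
      have x_D': "x \<notin> D' t" if "t \<in> T'" for t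
        using far[OF _ xz(1) _ xy(4)] Dreach'[OF that] xy(2) by blast
      have DD': "D t \<inter> D' t' = {}" if tt: "t \<in> T" "t' \<in> T'" for t t'
      proof -
        have False if "w \<in> D t" "w \<in> D' t'" for w
          using far[of w t t'] Dreach[OF tt(1) that(1)] Dreach'[OF tt(2) that(2)]
            D[OF tt(1)] TV(3)[OF tt(1)] that(1) by blast
        then show ?thesis by blast
      qed
      have BC: "insert (g t) (D t) \<subseteq> C t" if "t \<in> T" for t using D[OF that] gC[OF that] by blast
      have BC': "insert (g' t) (D' t) \<subseteq> C' t" if "t \<in> T'" for t using D'[OF that] gC'[OF that] by blast
      have "disjoint_routes V E X Z T B m" unfolding disjoint_routes_def
      proof (intro conjI ballI impI)
        show "T \<subseteq> X" "inj_on m T" "m ` T \<subseteq> Z" using TV injm m by auto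
      next
        fix t assume t: "t \<in> T"
        note m = m[OF t]
        show "B t \<subseteq> V" unfolding B_def
          using D[OF t] gC[OF t] D'[OF m(1)] gC'[OF m(1)] TV(3)[OF t] TV(4)[OF m(1)] by blast
        show "t \<in> B t" "m t \<in> B t" unfolding B_def using tin[OF t] tin'[OF m(1)] by auto
        have "(t, g t) \<in> reach E (B t)" using gr[OF t] by (rule reach_mono) (auto simp: B_def F_def)
        moreover have "(g t, g' (m t)) \<in> reach E (B t)"
        proof (cases "g t = x")
          case True
          then show ?thesis using xyE m by (auto intro!: reach_edge simp: \<sigma>_def B_def)
        next
          case False
          then show ?thesis using m by (auto simp: \<sigma>_def)
        qed
        moreover have "(m t, g' (m t)) \<in> reach E (B t)" using gr'[OF m(1)] by (rule reach_mono) (auto simp: B_def F_def)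
        ultimately show "(t, m t) \<in> reach E (B t)" using reach_trans reach_sym[OF symE] by metis
      next
        fix s t assume st: "s \<in> T" "t \<in> T" "s \<noteq> t"
        have mm: "m s \<noteq> m t" using st injm by (auto dest: inj_onD)
        have gg: "g s \<noteq> g t" using st inj_onD[OF g(1)] by blast
        have c1: "insert (g s) (D s) \<inter> insert (g t) (D t) = {}"
          using dis[OF st] BC[OF st(1)] BC[OF st(2)] by blast
        have c2: "insert (g' (m s)) (D' (m s)) \<inter> insert (g' (m t)) (D' (m t)) = {}"
          using dis'[OF m(1)[OF st(1)] m(1)[OF st(2)] mm] BC'[OF m(1)[OF st(1)]] BC'[OF m(1)[OF st(2)]]
          by blast
        have cross: "insert (g s) (D s) \<inter> insert (g' (m t)) (D' (m t)) = {}"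
          if st: "s \<in> T" "t \<in> T" "g s \<noteq> g t" for s t
        proof -
          have "g s \<in> insert x S" "g t \<in> insert x S" using gT st by auto
          then have "g s \<noteq> \<sigma> (g t)" "\<sigma> (g t) \<notin> D s" "g s \<notin> D' (m t)"
            using st(3) D[OF st(1)] D'[OF m(1)[OF st(2)]] y_D[OF st(1)] x_D'[OF m(1)[OF st(2)]] xy(2,3) nxy
            by (auto simp: \<sigma>_def)
          then show ?thesis using DD'[OF st(1) m(1)[OF st(2)]] m(2)[OF st(2)] by auto
        qed
        show "B s \<inter> B t = {}" 
          using c1 c2 cross[OF st(1,2) gg] cross[OF st(2,1) gg[symmetric]]
          unfolding B_def Int_Un_distrib Int_Un_distrib2 by (metis Int_commute sup_bot.right_neutral)
      qed
      then show ?thesis using T by blast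
    qed
  qed
qed

section \<open>Linked terminals\<close>

definition pairing :: "('a \<times> 'a) set \<Rightarrow> 'a set \<Rightarrow> bool" where
  "pairing P X \<longleftrightarrow> (\<forall>p\<in>P. ends p \<subseteq> X \<and> fst p \<noteq> snd p) \<and>
    (\<forall>p\<in>P. \<forall>q\<in>P. p \<noteq> q \<longrightarrow> ends p \<inter> ends q = {})"

text \<open>
  The sets are required to avoid the terminals that the pairing leaves out. Without this, a
  linkage could not be inserted into a larger one.
\<close>

definition linkage :: "'a set \<Rightarrow> 'a rel \<Rightarrow> 'a set \<Rightarrow> ('a \<times> 'a) set \<Rightarrow> ('a \<times> 'a \<Rightarrow> 'a set) \<Rightarrow> bool" where
  "linkage V E X P C \<longleftrightarrow>
    (\<forall>p\<in>P. C p \<subseteq> V \<and> C p \<inter> X = ends p \<and> p \<in> reach E (C p)) \<and>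
    (\<forall>p\<in>P. \<forall>q\<in>P. p \<noteq> q \<longrightarrow> C p \<inter> C q = {})"

definition linked :: "'a set \<Rightarrow> 'a rel \<Rightarrow> 'a set \<Rightarrow> bool" where
  "linked V E X \<longleftrightarrow> (\<forall>P. pairing P X \<longrightarrow> (\<exists>C. linkage V E X P C))"

definition separation :: "'a set \<Rightarrow> 'a rel \<Rightarrow> 'a set \<Rightarrow> 'a set \<Rightarrow> bool" where
  "separation V E A B \<longleftrightarrow> A \<union> B = V \<and> (\<forall>x\<in>A - B. \<forall>y\<in>B - A. (x, y) \<notin> E)"

lemma linkageD:
  assumes "linkage V E X P C"
  shows "p \<in> P \<Longrightarrow> C p \<subseteq> V" "p \<in> P \<Longrightarrow> C p \<inter> X = ends p" "p \<in> P \<Longrightarrow> p \<in> reach E (C p)"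
    "p \<in> P \<Longrightarrow> q \<in> P \<Longrightarrow> p \<noteq> q \<Longrightarrow> C p \<inter> C q = {}"
  using assms unfolding linkage_def by simp_all

lemma linkageI:
  assumes "\<And>p. p \<in> P \<Longrightarrow> C p \<subseteq> V" "\<And>p. p \<in> P \<Longrightarrow> C p \<inter> X = ends p"
    "\<And>p. p \<in> P \<Longrightarrow> p \<in> reach E (C p)"
    "\<And>p q. p \<in> P \<Longrightarrow> q \<in> P \<Longrightarrow> p \<noteq> q \<Longrightarrow> C p \<inter> C q = {}"
  shows "linkage V E X P C"
  unfolding linkage_def using assms by simp

lemma linkedD: "linked V E X \<Longrightarrow> pairing P X \<Longrightarrow> \<exists>C. linkage V E X P C"
  unfolding linked_def by simp

lemma linkedI: "(\<And>P. pairing P X \<Longrightarrow> \<exists>C. linkage V E X P C) \<Longrightarrow> linked V E X"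
  unfolding linked_def by simp

lemma linked_terminals_mono:
  assumes "linked V E Z" "T \<subseteq> Z"
  shows "linked V E T"
proof (rule linkedI)
  fix P assume P: "pairing P T"
  then have "pairing P Z" using assms(2) unfolding pairing_def by blast
  then obtain C where "linkage V E Z P C" using linkedD[OF assms(1)] by blast
  note C = linkageD[OF this]
  have "C p \<inter> T = ends p" if "p \<in> P" for p
  proof -
    have "ends p \<subseteq> T" using P that by (simp add: pairing_def)
    then show ?thesis using C(2)[OF that] assms(2) by blast
  qed
  then show "\<exists>C. linkage (V) E T P C" using C by (intro exI[of _ C] linkageI) simp_all
qed

lemma linked_mono:
  assumes "linked V E X" "V \<subseteq> W" "E \<inter> V \<times> V \<subseteq> F"
  shows "linked W F X"
proof (rule linkedI)
  fix P assume P: "pairing P X"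
  obtain C where "linkage V E X P C" using linkedD[OF assms(1) P] by blast
  note C = linkageD[OF this]
  have "p \<in> reach F (C p)" if "p \<in> P" for p
  proof -
    have "E \<inter> C p \<times> C p \<subseteq> F" using C(1)[OF that] assms(3) by blast
    then show ?thesis using reach_mono[of "fst p" "snd p" E "C p" F "C p"] C(3)[OF that] by simp
  qed
  moreover have "C p \<subseteq> W" if "p \<in> P" for p using C(1)[OF that] assms(2) by blast
  ultimately show "\<exists>C. linkage (W) F X P C" using C by (intro exI[of _ C] linkageI) simp_all
qed

text \<open>
  A walk that uses several edges inside \<open>Z\<close> can jump from its first to its last
  vertex in \<open>Z\<close>. One added edge per route is therefore enough.
\<close>

lemma clique_shortcut:
  assumes "sym F" "irrefl F" "F \<subseteq> E \<union> Z \<times> Z" "(s, t) \<in> reach F C" "s \<in> C" "t \<in> C"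
  shows "(s, t) \<in> reach E (C - Z) \<and> s \<notin> Z \<and> t \<notin> Z \<or>
    (\<exists>a\<in>C \<inter> Z. \<exists>b\<in>C \<inter> Z. (s, a) \<in> reach E (insert a (C - Z)) \<and> (b, t) \<in> reach E (insert b (C - Z)))"
proof -
  have drop: "(u, v) \<in> reach E W" if "(u, v) \<in> reach F W" "W \<inter> Z \<subseteq> {a}" for u v W a
    using that(1) by (rule reach_mono) (use assms(2,3) that(2) in \<open>auto simp: irrefl_def, blast\<close>)
  show ?thesis
  proof (cases "(s, t) \<in> reach F (C - Z) \<and> s \<notin> Z \<and> t \<notin> Z")
    case True
    then show ?thesis using drop[of s t "C - Z"] by auto
  next
    case False
    obtain a where a: "a \<in> C \<inter> Z" "(s, a) \<in> reach F (insert a (C - Z))"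
      using reach_first_entry[OF assms(1,4,6), of Z] False by blast
    obtain b where b: "b \<in> C \<inter> Z" "(b, t) \<in> reach F (insert b (C - Z))"
      using reach_last_exit[OF assms(4,5), of Z] False by blast
    have "(s, a) \<in> reach E (insert a (C - Z))" "(b, t) \<in> reach E (insert b (C - Z))"
      using drop[OF a(2), of a] drop[OF b(2), of b] by auto
    then show ?thesis using a b by blast
  qed
qed

text \<open>
  If the vertices of \<open>A \<inter> B\<close> can be linked through \<open>B\<close>, then
  for linkages in \<open>A\<close> they may be regarded as a clique: the jumps of the routes
  across \<open>A \<inter> B\<close> form a pairing of \<open>A \<inter> B\<close>, which is
  linked on the other side.
\<close>

lemma linked_replace_clique:
  assumes "sym F" "irrefl F" "F \<subseteq> E \<union> (A \<inter> B) \<times> (A \<inter> B)" "X \<subseteq> A"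
    and linB: "linked B E (A \<inter> B)" and linA: "linked A F X"
  shows "linked (A \<union> B) E X"
proof (rule linkedI)
  fix P assume P: "pairing P X"
  let ?Z = "A \<inter> B"
  obtain C where "linkage A F X P C" using linkedD[OF linA P] by blast
  note C = linkageD[OF this]
  (* A good route stays away from the overlap; the others enter it in a p and leave it for good
     in b p. *)
  define good where "good p \<longleftrightarrow> p \<in> reach E (C p - ?Z) \<and> fst p \<notin> ?Z \<and> snd p \<notin> ?Z" for p
  define Q where "Q p a b \<longleftrightarrow> a \<in> C p \<inter> ?Z \<and> b \<in> C p \<inter> ?Z \<and> (fst p, a) \<in> reach E (insert a (C p - ?Z))
      \<and> (b, snd p) \<in> reach E (insert b (C p - ?Z))" for p a b
  have "\<exists>a b. Q p a b" if "p \<in> P" "\<not> good p" for p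
  proof -
    have "(fst p, snd p) \<in> reach F (C p)" "fst p \<in> C p" "snd p \<in> C p" using C(2,3)[OF that(1)] by auto
    from clique_shortcut[OF assms(1-3) this] that(2) show ?thesis unfolding Q_def good_def by auto
  qed
  then obtain a b where Q: "\<And>p. p \<in> P \<Longrightarrow> \<not> good p \<Longrightarrow> Q p (a p) (b p)" by metis
  have ab: "a p \<in> C p \<inter> ?Z" "b p \<in> C p \<inter> ?Z" "(fst p, a p) \<in> reach E (insert (a p) (C p - ?Z))"
    "(b p, snd p) \<in> reach E (insert (b p) (C p - ?Z))" if "p \<in> P" "\<not> good p" for p
    using Q[OF that] unfolding Q_def by simp_all
  define R where "R = {p \<in> P. \<not> good p \<and> a p \<noteq> b p}"
  have pr: "pairing ((\<lambda>p. (a p, b p)) ` R) ?Z"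
    unfolding pairing_def
  proof (intro conjI ballI impI)
    fix p' assume "p' \<in> (\<lambda>p. (a p, b p)) ` R"
    then show "ends p' \<subseteq> ?Z" "fst p' \<noteq> snd p'" using ab(1,2) by (auto simp: R_def)
  next
    fix p' q' assume "p' \<in> (\<lambda>p. (a p, b p)) ` R" "q' \<in> (\<lambda>p. (a p, b p)) ` R" "p' \<noteq> q'"
    then obtain p q where pq: "p \<in> R" "q \<in> R" "p' = (a p, b p)" "q' = (a q, b q)" "p \<noteq> q" by auto
    then have "ends p' \<subseteq> C p" "ends q' \<subseteq> C q" using ab(1,2) by (auto simp: R_def)
    then show "ends p' \<inter> ends q' = {}" using C(4)[of p q] pq by (auto simp: R_def)
  qed
  obtain D where "linkage B E ?Z ((\<lambda>p. (a p, b p)) ` R) D" using linkedD[OF linB pr] by blast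
  note D = linkageD[OF this]
  define J where "J p = (if good p then {} else if a p = b p then {a p} else D (a p, b p))" for p
  have JB: "J p \<subseteq> B" if "p \<in> P" for p
  proof (cases "p \<in> R")
    case True
    then show ?thesis using D(1)[of "(a p, b p)"] by (auto simp: J_def R_def)
  next
    case False
    then show ?thesis using ab(1)[OF that] that by (auto simp: J_def R_def)
  qed
  have JZ: "J p \<inter> ?Z = (if good p then {} else {a p, b p})" if "p \<in> P" for p
  proof (cases "p \<in> R")
    case True
    then show ?thesis using D(2)[of "(a p, b p)"] by (auto simp: J_def R_def)
  next
    case False
    then show ?thesis using ab(1)[OF that] that by (auto simp: J_def R_def)
  qed
  have JZC: "J p \<inter> ?Z \<subseteq> C p" if "p \<in> P" for p
    using JZ[OF that] ab(1,2)[OF that] by auto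
  have JJ: "J p \<inter> J q = {}" if pq: "p \<in> P" "q \<in> P" "p \<noteq> q" for p q
  proof (cases "p \<in> R \<and> q \<in> R")
    case True
    have "a p \<in> C p" "a q \<in> C q" using True ab(1) by (auto simp: R_def)
    then have "(a p, b p) \<noteq> (a q, b q)" using C(4)[OF pq] by auto
    then show ?thesis using D(4)[of "(a p, b p)" "(a q, b q)"] True by (auto simp: J_def R_def)
  next
    case False
    then have "J p \<subseteq> ?Z \<or> J q \<subseteq> ?Z" using ab(1)[OF pq(1)] ab(1)[OF pq(2)] pq by (auto simp: J_def R_def)
    then show ?thesis using JZC[OF pq(1)] JZC[OF pq(2)] C(4)[OF pq] by blast
  qed
  define C' where "C' p = (C p - ?Z) \<union> J p" for p
  have "C' p \<subseteq> A \<union> B" if "p \<in> P" for p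
    using C(1)[OF that] JB[OF that] by (auto simp: C'_def)
  moreover have "p \<in> reach E (C' p) \<and> ends p \<subseteq> C' p" if p: "p \<in> P" for p
  proof (cases "good p")
    case True
    then have "p \<in> reach E (C' p)"
      using reach_mono[of "fst p" "snd p" E "C p - ?Z" E "C' p"] by (auto simp: C'_def good_def)
    then show ?thesis using True C(2)[OF p] by (auto simp: good_def C'_def)
  next
    case False
    have abJ: "a p \<in> J p" "b p \<in> J p" using JZ[OF p] False by auto
    have "(fst p, a p) \<in> reach E (C' p)" "(b p, snd p) \<in> reach E (C' p)"
      using ab(3,4)[OF p False] by (auto elim!: reach_mono simp: C'_def abJ)
    moreover have "(a p, b p) \<in> reach E (C' p)"
    proof (cases "a p = b p")
      case ne: False
      then have "(a p, b p) \<in> (\<lambda>p. (a p, b p)) ` R" using p False by (auto simp: R_def)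
      from D(3)[OF this] show ?thesis
        by (rule reach_mono) (use ne False in \<open>auto simp: C'_def J_def\<close>)
    qed simp
    ultimately have "(fst p, snd p) \<in> reach E (C' p)" using reach_trans by metis
    moreover have "fst p \<in> C' p" "snd p \<in> C' p"
      using reach_in[OF ab(3)[OF p False]] reach_in[OF ab(4)[OF p False]] abJ by (auto simp: C'_def)
    ultimately show ?thesis by simp
  qed
  moreover have ends_X: "ends p \<subseteq> X" if "p \<in> P" for p using C(2)[OF that] by blast
  moreover have "C' p \<inter> X \<subseteq> ends p" if p: "p \<in> P" for p
  proof -
    have "J p \<inter> X \<subseteq> C p" using JB[OF p] JZC[OF p] assms(4) by blast
    then show ?thesis using C(2)[OF p] unfolding C'_def by blast
  qed
  moreover have "C' p \<inter> C' q = {}" if pq: "p \<in> P" "q \<in> P" "p \<noteq> q" for p q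
  proof -
    have "(C p - ?Z) \<inter> J q = {}" "(C q - ?Z) \<inter> J p = {}"
      using C(1)[OF pq(1)] C(1)[OF pq(2)] JB[OF pq(1)] JB[OF pq(2)] by blast+
    then show ?thesis using C(4)[OF pq] JJ[OF pq] unfolding C'_def by blast
  qed
  ultimately show "\<exists>C. linkage (A \<union> B) E X P C"
    using ends_X by (intro exI[of _ C'] linkageI subset_antisym) simp_all
qed

text \<open>
  Menger's theorem leads the terminals disjointly into the overlap with \<open>B\<close>,
  where they are linked.
\<close>

lemma linked_if_no_small_separator:
  assumes fin: "finite A" and "sym E" "irrefl E" "X \<subseteq> A"
    and linB: "\<And>T. T \<subseteq> A \<inter> B \<Longrightarrow> card T \<le> card X \<Longrightarrow> linked B E T"
    and big: "\<And>S. S \<subseteq> A \<Longrightarrow> separates A E S X (A \<inter> B) \<Longrightarrow> card X \<le> card S"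
  shows "linked (A \<union> B) E X"
proof (rule linkedI)
  fix P assume P: "pairing P X"
  let ?Z = "A \<inter> B"
  have finX: "finite X" using fin assms(4) finite_subset by blast
  obtain T C f where T: "card T = card X" "disjoint_routes A E X ?Z T C f"
    using menger[OF fin assms(2-4) _ big] by blast
  have "T = X" using disjoint_routesD(1)[OF T(2)] T(1) finX by (simp add: card_subset_eq)
  note TX = T(2)[unfolded this]
  obtain D g where g: "inj_on g X" "g ` X \<subseteq> ?Z"
    and D: "\<And>t. t \<in> X \<Longrightarrow> D t \<subseteq> C t - ?Z" and gC: "\<And>t. t \<in> X \<Longrightarrow> g t \<in> C t"
    and Dr: "\<And>t v. t \<in> X \<Longrightarrow> v \<in> D t \<Longrightarrow> t \<in> D t \<and> (t, v) \<in> reach E (D t)"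
    and gr: "\<And>t. t \<in> X \<Longrightarrow> (t, g t) \<in> reach E (insert (g t) (D t))"
    and tin: "\<And>t. t \<in> X \<Longrightarrow> t \<in> insert (g t) (D t)"
    by (rule disjoint_routes_spines[OF assms(2) TX]) (rule that)
  define R where "R t = insert (g t) (D t)" for t
  have RC: "R t \<subseteq> C t" if "t \<in> X" for t using D[OF that] gC[OF that] by (auto simp: R_def)
  have RZ: "R t \<inter> ?Z = {g t}" if "t \<in> X" for t using D[OF that] g that by (auto simp: R_def)
  have RA: "R t \<subseteq> A" if "t \<in> X" for t using RC[OF that] disjoint_routesD(4)[OF TX that] by blast
  have Rdis: "R s \<inter> R t = {}" if "s \<in> X" "t \<in> X" "s \<noteq> t" for s t
    using RC[OF that(1)] RC[OF that(2)] disjoint_routesD(8)[OF TX that] by blast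
  have RX: "R t \<inter> X = {t}" if "t \<in> X" for t
  proof -
    have "s = t" if "s \<in> X" "s \<in> R t" for s
      using Rdis[OF that(1) \<open>t \<in> X\<close>] tin[OF that(1)] that(2) unfolding R_def by blast
    then show ?thesis using tin[OF that] that unfolding R_def by blast
  qed
  have Xg: "g x = x" if "x \<in> X" "x \<in> B" for x
  proof -
    have "x \<in> R x \<inter> ?Z" using tin[OF that(1)] that assms(4) by (auto simp: R_def)
    then show ?thesis using RZ[OF that(1)] by simp
  qed
  define h where "h p = (g (fst p), g (snd p))" for p
  have Pin: "fst p \<in> X" "snd p \<in> X" "fst p \<noteq> snd p" if "p \<in> P" for p
    using P that by (auto simp: pairing_def)
  have Pdis: "ends p \<inter> ends q = {}" if "p \<in> P" "q \<in> P" "p \<noteq> q" for p q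
    using P that by (auto simp: pairing_def)
  have gends: "ends (h p) = g ` ends p" for p by (auto simp: h_def)
  have hdis: "ends (h p) \<inter> ends (h q) = {}" if "p \<in> P" "q \<in> P" "p \<noteq> q" for p q
    using Pdis[OF that] Pin[OF that(1)] Pin[OF that(2)] unfolding gends
    by (subst inj_on_image_Int[OF g(1), symmetric]) auto
  have pr: "pairing (h ` P) (g ` X)"
    unfolding pairing_def
  proof (intro conjI ballI impI)
    fix p' assume "p' \<in> h ` P"
    then obtain p where p: "p \<in> P" "p' = h p" by blast
    then show "ends p' \<subseteq> g ` X" using Pin by (auto simp: h_def)
    show "fst p' \<noteq> snd p'" using p Pin[of p] inj_onD[OF g(1)] by (auto simp: h_def)
  next
    fix p' q' assume "p' \<in> h ` P" "q' \<in> h ` P" "p' \<noteq> q'"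
    then show "ends p' \<inter> ends q' = {}" using hdis by blast
  qed
  have "linked B E (g ` X)" using linB[OF g(2)] card_image_le[OF finX] by blast
  then obtain L where "linkage B E (g ` X) (h ` P) L" using linkedD pr by blast
  note L = linkageD[OF this]
  define C' where "C' p = R (fst p) \<union> R (snd p) \<union> L (h p)" for p
  have LR: "L (h p) \<inter> R t = {}" if p: "p \<in> P" and t: "t \<in> X" "t \<notin> ends p" for p t
  proof -
    have "L (h p) \<inter> R t \<subseteq> {g t}" using L(1)[of "h p"] p RA[OF t(1)] RZ[OF t(1)] by blast
    moreover have "g t \<notin> ends (h p)"
      unfolding gends using t Pin[OF p] inj_onD[OF g(1)] by blast
    then have "g t \<notin> L (h p)" using L(2)[of "h p"] p t by blast
    ultimately show ?thesis by blast
  qed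
  have hne: "h p \<noteq> h q" if "p \<in> P" "q \<in> P" "p \<noteq> q" for p q
    using hdis[OF that] by auto
  have "C' p \<subseteq> A \<union> B" if p: "p \<in> P" for p
    using RA[OF Pin(1)[OF p]] RA[OF Pin(2)[OF p]] L(1)[of "h p"] p by (auto simp: C'_def)
  moreover have "C' p \<inter> X = ends p" if p: "p \<in> P" for p
  proof -
    have "L (h p) \<inter> X \<subseteq> ends p"
    proof
      fix x assume x: "x \<in> L (h p) \<inter> X"
      then have "x \<in> B" using L(1)[of "h p"] p by blast
      then have "x \<in> R x" using x Xg by (auto simp: R_def)
      then show "x \<in> ends p" using LR[OF p, of x] x by blast
    qed
    then show ?thesis using RX[OF Pin(1)[OF p]] RX[OF Pin(2)[OF p]] unfolding C'_def by blast
  qed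
  moreover have "p \<in> reach E (C' p)" if p: "p \<in> P" for p
  proof -
    have "(fst p, g (fst p)) \<in> reach E (C' p)" "(snd p, g (snd p)) \<in> reach E (C' p)"
      using gr[OF Pin(1)[OF p]] gr[OF Pin(2)[OF p]] by (auto elim!: reach_mono simp: C'_def R_def)
    moreover have "(g (fst p), g (snd p)) \<in> reach E (C' p)"
      using L(3)[of "h p"] p by (auto elim!: reach_mono simp: C'_def h_def)
    ultimately have "(fst p, snd p) \<in> reach E (C' p)" using reach_trans reach_sym[OF assms(2)] by metis
    then show ?thesis by simp
  qed
  moreover have "C' p \<inter> C' q = {}" if pq: "p \<in> P" "q \<in> P" "p \<noteq> q" for p q
  proof -
    note d = Pdis[OF pq]
    have "L (h p) \<inter> L (h q) = {}" using L(4)[of "h p" "h q"] pq hne by blast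
    moreover have "L (h p) \<inter> R (fst q) = {}" "L (h p) \<inter> R (snd q) = {}"
      "L (h q) \<inter> R (fst p) = {}" "L (h q) \<inter> R (snd p) = {}"
      using LR pq Pin d by blast+
    moreover have "R s \<inter> R t = {}" if "s \<in> ends p" "t \<in> ends q" for s t
      using Rdis[of s t] that d Pin[OF pq(1)] Pin[OF pq(2)] by blast
    ultimately show ?thesis unfolding C'_def by blast
  qed
  ultimately show "\<exists>C. linkage (A \<union> B) E X P C" by (intro exI[of _ C'] linkageI) simp_all
qed

text \<open>
  Take a smallest separator \<open>S\<close> between \<open>X\<close> and \<open>A \<inter>
  B\<close>. If it is as large as \<open>X\<close>, the terminals are led to \<open>B\<close>
  and linked there. Otherwise \<open>S\<close> itself can be led to \<open>B\<close>, since no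
  smaller set separates it from \<open>A \<inter> B\<close>; so the part beyond
  \<open>S\<close> links \<open>S\<close>.
\<close>

lemma linked_or_small_rigid_separation:
  assumes fin: "finite A" and symE: "sym E" and irE: "irrefl E" and XA: "X \<subseteq> A"
    and sep: "separation V E A B"
    and linB: "\<And>T. T \<subseteq> A \<inter> B \<Longrightarrow> card T \<le> card X \<Longrightarrow> linked B E T"
  shows "linked V E X \<or> (\<exists>A1 B1. separation V E A1 B1 \<and> X \<subseteq> A1 \<and> B \<subseteq> B1 \<and>
    card (A1 \<inter> B1) < card X \<and> linked B1 E (A1 \<inter> B1))"
proof -
  let ?Z = "A \<inter> B"
  have V: "V = A \<union> B" using sep by (auto simp: separation_def)
  define Seps where "Seps = {S. S \<subseteq> A \<and> separates A E S X ?Z}"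
  have "A \<in> Seps" using XA by (auto simp: Seps_def separates_def)
  then obtain S where S: "S \<in> Seps" and min: "\<And>S'. S' \<in> Seps \<Longrightarrow> card S \<le> card S'"
    using ex_has_least_nat[of "\<lambda>S. S \<in> Seps" A card] by blast
  have SA: "S \<subseteq> A" and Ssep: "separates A E S X ?Z" using S by (auto simp: Seps_def)
  show ?thesis
  proof (cases "card X \<le> card S")
    case True
    have "linked (A \<union> B) E X"
      by (rule linked_if_no_small_separator[OF fin symE irE XA linB])
        (use True min in \<open>auto simp: Seps_def intro: order_trans\<close>)
    then show ?thesis using V by simp
  next
    case False
    define A1 where "A1 = S \<union> {v \<in> A - S. \<exists>x\<in>X - S. (x, v) \<in> reach E (A - S)}"
    define B1 where "B1 = (V - A1) \<union> S"
    have AB1: "A1 \<inter> B1 = S" by (auto simp: A1_def B1_def)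
    have A1A: "A1 \<subseteq> A" using SA by (auto simp: A1_def)
    have XA1: "X \<subseteq> A1" using XA by (auto simp: A1_def intro: reach_refl)
    have A1Z: "A1 \<inter> B \<subseteq> S" using Ssep by (auto simp: A1_def separates_def)
    have BB1: "B \<subseteq> B1" using A1Z V by (auto simp: B1_def)
    have sep1: "separation V E A1 B1"
      unfolding separation_def
    proof (intro conjI ballI notI)
      show "A1 \<union> B1 = V" using A1A V SA by (auto simp: B1_def)
      fix x y assume x: "x \<in> A1 - B1" and y: "y \<in> B1 - A1" and xy: "(x, y) \<in> E"
      have xS: "x \<notin> S" "y \<notin> S" "y \<in> V" using x y by (auto simp: B1_def A1_def)
      then have "x \<in> A - B" using x A1A A1Z by auto
      then have "y \<in> A" using sep xy xS V unfolding separation_def by blast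
      then have "y \<in> A1" using x xy xS by (auto simp: A1_def intro: reach_step)
      then show False using y by simp
    qed
    have "linked (A \<inter> B1 \<union> B) E S"
    proof (rule linked_if_no_small_separator[OF _ symE irE])
      show "finite (A \<inter> B1)" using fin by simp
      show "S \<subseteq> A \<inter> B1" using SA AB1 by blast
      show "linked B E T" if "T \<subseteq> A \<inter> B1 \<inter> B" "card T \<le> card S" for T
        using linB[of T] that False by auto
      fix S' assume S': "S' \<subseteq> A \<inter> B1" "separates (A \<inter> B1) E S' S (A \<inter> B1 \<inter> B)"
      have ZZ: "A \<inter> B1 \<inter> B = ?Z" using BB1 by blast
      have "separates A E S' X ?Z"
        unfolding separates_def
      proof (intro ballI notI)
        fix x z assume x: "x \<in> X - S'" and z: "z \<in> ?Z - S'" and xz: "(x, z) \<in> reach E (A - S')"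
        have xA: "x \<in> A - S'" "z \<in> A - S'" using x z XA by auto
        have "\<not> ((x, z) \<in> reach E (A - S' - S) \<and> x \<notin> S \<and> z \<notin> S)"
        proof
          assume *: "(x, z) \<in> reach E (A - S' - S) \<and> x \<notin> S \<and> z \<notin> S"
          then have "(x, z) \<in> reach E (A - S)" by (auto elim!: reach_mono)
          then show False using Ssep * x z by (auto simp: separates_def)
        qed
        then obtain b where b: "b \<in> (A - S') \<inter> S" "(b, z) \<in> reach E (insert b (A - S' - S))"
          using reach_last_exit[OF xz xA(1), of S] by blast
        have "(z, b) \<in> reach E (A - S')"
          using reach_sym[OF symE b(2)] by (rule reach_mono) (use b in auto)
        then obtain a D where D: "a \<in> (A - S') \<inter> S" "D \<subseteq> A - S' - S"
          "\<And>v. v \<in> D \<Longrightarrow> z \<in> D \<and> (z, v) \<in> reach E D" "(z, a) \<in> reach E (insert a D)"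
          using reach_spine[OF symE _ xA(2), of b S] b by (metis IntE)
        have "v \<in> B1" if v: "v \<in> D" for v
        proof (rule ccontr)
          assume "v \<notin> B1"
          then obtain x' where x': "x' \<in> X - S" "(x', v) \<in> reach E (A - S)"
            using D(2) v V by (auto simp: B1_def A1_def)
          have "(v, z) \<in> reach E (A - S)"
            using reach_sym[OF symE] D(3)[OF v] D(2) by (blast intro: reach_mono)
          then have "(x', z) \<in> reach E (A - S)" using x' reach_trans by metis
          moreover have "z \<in> ?Z - S" using D(3)[OF v] D(2) z by blast
          ultimately show False using Ssep x' by (auto simp: separates_def)
        qed
        then have "(z, a) \<in> reach E (A \<inter> B1 - S')"
          using D(4) by (rule_tac reach_mono) (use D AB1 in auto)
        then have "(a, z) \<in> reach E (A \<inter> B1 - S')" by (rule reach_sym[OF symE])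
        then show False using S'(2) D(1) z unfolding ZZ separates_def by blast
      qed
      then show "card S \<le> card S'" using min S' by (auto simp: Seps_def)
    qed
    moreover have "A \<inter> B1 \<union> B = B1" using BB1 V SA by (auto simp: B1_def)
    ultimately have "linked B1 E (A1 \<inter> B1)" using AB1 by simp
    then show ?thesis using sep1 XA1 BB1 AB1 False by (metis linorder_not_le)
  qed
qed

section \<open>Greedy routing in expanding graphs\<close>

text \<open>
  The balls around \<open>x\<close> and \<open>y\<close> gain \<open>g\<close> vertices in
  every step until they contain more than half of \<open>U\<close>; then they meet.
\<close>

lemma short_route:
  assumes fin: "finite U" and symE: "sym E" and x: "x \<in> U - Q" and y: "y \<in> U - Q"
    and grow: "\<And>z A. z \<in> {x, y} \<Longrightarrow> A \<subseteq> U - Q \<Longrightarrow> z \<in> A \<Longrightarrow> 2 * card A \<le> card U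
      \<Longrightarrow> g \<le> card (E `` A \<inter> U - A - Q)"
    and r: "card U \<le> 2 * r * g"
  obtains I where "I \<subseteq> U - Q" "card I \<le> 2 * r + 2" "x \<in> I" "y \<in> I" "(x, y) \<in> reach E I"
proof -
  define L where "L z i = {v \<in> U - Q. \<exists>I \<subseteq> U - Q. card I \<le> i + 1 \<and> z \<in> I \<and> v \<in> I \<and> (z, v) \<in> reach E I}" for z i
  have finL: "finite (L z i)" for z i using fin by (simp add: L_def)
  have LI: "v \<in> L z i" if "I \<subseteq> U - Q" "card I \<le> i + 1" "z \<in> I" "v \<in> I" "(z, v) \<in> reach E I" for v z i I
    unfolding L_def mem_Collect_eq using that by (intro conjI exI[of _ I]) auto
  have LU: "L z i \<subseteq> U - Q" for z i by (auto simp: L_def)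
  have zL: "z \<in> L z i" if "z \<in> {x, y}" for z i
    using that x y by (intro LI[of "{z}"]) auto
  have step: "L z i \<union> (E `` L z i \<inter> U - L z i - Q) \<subseteq> L z (Suc i)" for z i
  proof
    fix w assume w: "w \<in> L z i \<union> (E `` L z i \<inter> U - L z i - Q)"
    show "w \<in> L z (Suc i)"
    proof (cases "w \<in> L z i")
      case True
      then obtain I where I: "I \<subseteq> U - Q" "card I \<le> i + 1" "z \<in> I" "w \<in> I" "(z, w) \<in> reach E I"
        by (auto simp: L_def)
      then show ?thesis by (intro LI[of I]) auto
    next
      case False
      then obtain v where v: "v \<in> L z i" "(v, w) \<in> E" "w \<in> U - Q" using w by auto
      then obtain I where I: "I \<subseteq> U - Q" "card I \<le> i + 1" "z \<in> I" "v \<in> I" "(z, v) \<in> reach E I"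
        by (auto simp: L_def)
      have fI: "finite I" using I(1) fin finite_subset by blast
      have "(z, v) \<in> reach E (insert w I)" using I(5) by (rule reach_mono) auto
      then have "(z, w) \<in> reach E (insert w I)" using v I by (auto intro: reach_step)
      moreover have "card (insert w I) \<le> Suc i + 1" using I(2) fI by (simp add: card_insert_if)
      ultimately show ?thesis using I v by (intro LI[of "insert w I"]) auto
    qed
  qed
  have size: "card U < 2 * card (L z i) \<or> i * g + 1 \<le> card (L z i)" if z: "z \<in> {x, y}" for z i
  proof (induction i)
    case 0
    have "0 < card (L z 0)" using zL[OF z] finL by (metis card_gt_0_iff empty_iff)
    then show ?case by simp
  next
    case (Suc i)
    have le: "card (L z i) \<le> card (L z (Suc i))" using step by (intro card_mono finL) blast
    show ?case
    proof (cases "2 * card (L z i) \<le> card U")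
      case True
      have "card (L z i) + g \<le> card (L z i) + card (E `` L z i \<inter> U - L z i - Q)"
        using grow[OF z LU zL[OF z] True] by simp
      also have "\<dots> = card (L z i \<union> (E `` L z i \<inter> U - L z i - Q))"
        using finL fin by (subst card_Un_disjoint) auto
      also have "\<dots> \<le> card (L z (Suc i))" using step by (intro card_mono finL)
      finally show ?thesis using Suc True by auto
    next
      case False
      then show ?thesis using le by auto
    qed
  qed
  have big: "card U < 2 * card (L z r)" if "z \<in> {x, y}" for z
    using size[OF that, of r] r by (auto simp: algebra_simps)
  have "L x r \<inter> L y r \<noteq> {}"
  proof
    assume "L x r \<inter> L y r = {}"
    then have "card (L x r) + card (L y r) = card (L x r \<union> L y r)" using finL by (simp add: card_Un_disjoint)
    also have "\<dots> \<le> card U" using LU fin by (intro card_mono) auto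
    finally show False using big[of x] big[of y] by simp
  qed
  then obtain v I J where *: "I \<subseteq> U - Q" "card I \<le> r + 1" "x \<in> I" "v \<in> I" "(x, v) \<in> reach E I"
    "J \<subseteq> U - Q" "card J \<le> r + 1" "y \<in> J" "v \<in> J" "(y, v) \<in> reach E J"
    unfolding L_def by blast
  have "(x, v) \<in> reach E (I \<union> J)" "(y, v) \<in> reach E (I \<union> J)"
    using *(5,10) by (auto elim!: reach_mono)
  then have "(x, y) \<in> reach E (I \<union> J)" using reach_sym[OF symE] reach_trans by metis
  moreover have "card (I \<union> J) \<le> 2 * r + 2" using card_Un_le[of I J] * by simp
  ultimately show thesis using that[of "I \<union> J"] * by auto
qed

definition routed :: "'a set \<Rightarrow> 'a rel \<Rightarrow> 'a set \<Rightarrow> ('a \<times> 'a) set \<Rightarrow> ('a \<times> 'a \<Rightarrow> 'a set) \<Rightarrow> bool" where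
  "routed U E X M I \<longleftrightarrow> (\<forall>p\<in>M. I p \<subseteq> U - X \<and> p \<in> reach E (I p \<union> ends p)) \<and>
    (\<forall>p\<in>M. \<forall>q\<in>M. p \<noteq> q \<longrightarrow> I p \<inter> I q = {})"

text \<open>
  If the growth of balls survives the deletion of any \<open>b\<close> vertices, then the
  pairs can be joined one after another, and the short routes that have been chosen so far are
  among the deleted vertices.
\<close>

lemma greedy_routes:
  assumes fin: "finite U" and symE: "sym E" and XU: "X \<subseteq> U" and "finite M"
    and MX: "\<And>p. p \<in> M \<Longrightarrow> ends p \<subseteq> X"
    and grow: "\<And>Q z A. Q \<subseteq> U \<Longrightarrow> card Q \<le> b \<Longrightarrow> z \<in> X - Q \<Longrightarrow> A \<subseteq> U - Q \<Longrightarrow> z \<in> A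
      \<Longrightarrow> 2 * card A \<le> card U \<Longrightarrow> g \<le> card (E `` A \<inter> U - A - Q)"
    and r: "card U \<le> 2 * r * g" and b: "card X + card M * (2 * r + 2) \<le> b"
  shows "\<exists>I. routed U E X M I"
proof -
  have "\<exists>I. routed U E X M I \<and> (\<forall>p\<in>M. card (I p) \<le> 2 * r + 2)"
    using \<open>finite M\<close> MX b
  proof (induction M)
    case empty
    then show ?case by (simp add: routed_def)
  next
    case (insert p M)
    obtain I where I: "routed U E X M I" and small: "\<And>q. q \<in> M \<Longrightarrow> card (I q) \<le> 2 * r + 2"
      using insert by auto
    have Iq: "I q \<subseteq> U - X" if "q \<in> M" for q using I that by (simp add: routed_def)
    have Ireach: "q \<in> reach E (I q \<union> ends q)" if "q \<in> M" for q using I that by (simp add: routed_def)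
    have Idis: "I q \<inter> I q' = {}" if "q \<in> M" "q' \<in> M" "q \<noteq> q'" for q q' using I that by (simp add: routed_def)
    define Q where "Q = (X \<union> \<Union> (I ` M)) - ends p"
    have UN: "\<Union> (I ` M) \<subseteq> U - X" using Iq by blast
    have pX: "ends p \<subseteq> X" using insert by simp
    have "card (\<Union> (I ` M)) \<le> (\<Sum>q\<in>M. card (I q))" using insert(1) by (rule card_UN_le)
    also have "\<dots> \<le> card M * (2 * r + 2)" using sum_bounded_above[of M "\<lambda>q. card (I q)" "2 * r + 2"] small by simp
    finally have "card (X \<union> \<Union> (I ` M)) \<le> card X + card M * (2 * r + 2)"
      using card_Un_le[of X "\<Union> (I ` M)"] by simp
    moreover have "card Q \<le> card (X \<union> \<Union> (I ` M))"
      unfolding Q_def using XU UN fin finite_subset[of "X \<union> \<Union> (I ` M)" U] by (intro card_mono) auto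
    ultimately have Qb: "card Q \<le> b" using insert.prems(2) insert(1,2) by simp
    have QU: "Q \<subseteq> U" using XU UN by (auto simp: Q_def)
    have pQ: "fst p \<in> X - Q" "snd p \<in> X - Q" using pX by (auto simp: Q_def)
    obtain J where J: "J \<subseteq> U - Q" "card J \<le> 2 * r + 2" "fst p \<in> J" "snd p \<in> J" "(fst p, snd p) \<in> reach E J"
    proof (rule short_route[OF fin symE _ _ _ r, of "fst p" Q "snd p"])
      show "fst p \<in> U - Q" "snd p \<in> U - Q" using pQ XU by auto
      show "g \<le> card (E `` A \<inter> U - A - Q)"
        if "z \<in> {fst p, snd p}" "A \<subseteq> U - Q" "z \<in> A" "2 * card A \<le> card U" for z A
        using grow[OF QU Qb, of z A] pQ that by blast
    qed (rule that)
    have JX: "J \<inter> X \<subseteq> ends p" and JI: "J \<inter> \<Union> (I ` M) = {}"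
      using J(1) UN pX by (auto simp: Q_def)
    define I' where "I' q = (if q = p then J - X else I q)" for q
    have "routed U E X (insert p M) I'"
      unfolding routed_def
    proof (intro conjI ballI impI)
      fix q assume q: "q \<in> insert p M"
      show "I' q \<subseteq> U - X" using J(1) Iq[of q] q by (cases "q = p") (auto simp: I'_def)
      show "q \<in> reach E (I' q \<union> ends q)"
      proof (cases "q = p")
        case True
        have "(fst p, snd p) \<in> reach E (J - X \<union> ends p)"
          using J(5) by (rule reach_mono) (use JX in auto)
        then show ?thesis using True by (simp add: I'_def)
      next
        case False
        then show ?thesis using Ireach q by (simp add: I'_def)
      qed
      fix q' assume q': "q' \<in> insert p M" "q \<noteq> q'"
      show "I' q \<inter> I' q' = {}"
      proof (cases "q = p \<or> q' = p")
        case True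
        then show ?thesis using JI q q' by (auto simp: I'_def)
      next
        case False
        then show ?thesis using Idis q q' by (simp add: I'_def)
      qed
    qed
    moreover have "card (I' q) \<le> 2 * r + 2" if "q \<in> insert p M" for q
    proof (cases "q = p")
      case True
      have "card (J - X) \<le> card J" using J(1) fin finite_subset[of J U] by (intro card_mono) auto
      then show ?thesis using True J(2) by (simp add: I'_def)
    next
      case False
      then show ?thesis using small that by (simp add: I'_def)
    qed
    ultimately show ?case by blast
  qed
  then show ?thesis by blast
qed

section \<open>Dense sets that are highly connected\<close>

text \<open>
  Mader's argument: take \<open>H\<close> minimal with \<open>d (|H| - m) \<le> e(H)\<close>,
  where \<open>e(H)\<close> counts ordered pairs. The offset \<open>m\<close> makes the
  condition strictly superadditive: if \<open>H = A \<union> B\<close> without edges between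
  the two sides, then \<open>e(H) \<le> e(A) + e(B) < d (|A| + |B| - 2 m)\<close>, which
  forces more than \<open>m\<close> vertices into \<open>A \<inter> B\<close>. The condition
  \<open>4 m \<le> d\<close> excludes sets that are too small for the offset to be harmless.
\<close>

lemma mader_dense_connected_subset:
  assumes fin: "finite U" and symE: "sym E" and irE: "irrefl E" and mu: "0 < m" "4 * m \<le> d"
    and ne: "U \<noteq> {}" and dense: "d * card U \<le> card (E \<inter> U \<times> U)"
  obtains H where "H \<subseteq> U" "d * card H \<le> card (E \<inter> H \<times> H) + d * m"
    "\<And>W. W \<subset> H \<Longrightarrow> 2 * m \<le> card W \<Longrightarrow> card (E \<inter> W \<times> W) + d * m < d * card W"
    "\<And>v. v \<in> H \<Longrightarrow> d < 2 * card (E `` {v} \<inter> H)"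
    "\<And>A B. separation H E A B \<Longrightarrow> A - B \<noteq> {} \<Longrightarrow> B - A \<noteq> {} \<Longrightarrow> m < card (A \<inter> B)"
    "2 * m < card H"
proof -
  define P where "P W \<longleftrightarrow> W \<subseteq> U \<and> 2 * m \<le> card W \<and> d * card W \<le> card (E \<inter> W \<times> W) + d * m" for W
  have e2: "card (E \<inter> W \<times> W) + card W \<le> card W * card W" if "W \<subseteq> U" for W
  proof -
    have fW: "finite W" using that fin finite_subset by blast
    have "card (E \<inter> W \<times> W) + card ((\<lambda>x. (x, x)) ` W) = card (E \<inter> W \<times> W \<union> (\<lambda>x. (x, x)) ` W)"
      using irE fW by (subst card_Un_disjoint) (auto simp: irrefl_def)
    also have "\<dots> \<le> card (W \<times> W)" using fW by (intro card_mono) auto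
    finally show ?thesis by (simp add: card_cartesian_product card_image inj_on_def)
  qed
  have "d \<le> card U"
  proof -
    have "d * card U \<le> card U * card U"
      by (rule order_trans[OF dense]) (use e2[OF subset_refl] in linarith)
    then show ?thesis using ne fin by (simp add: card_gt_0_iff)
  qed
  then have "P U" using mu dense by (simp add: P_def)
  then obtain H where H: "P H" and min: "\<And>W. P W \<Longrightarrow> card H \<le> card W"
    using ex_has_least_nat[of P U card] by blast
  have HU: "H \<subseteq> U" and H2: "2 * m \<le> card H" and Hd: "d * card H \<le> card (E \<inter> H \<times> H) + d * m"
    using H by (auto simp: P_def)
  have fH: "finite H" using HU fin finite_subset by blast
  have sub: "card (E \<inter> W \<times> W) + d * m < d * card W" if "W \<subset> H" "2 * m \<le> card W" for W
  proof -
    have "card W < card H" using that fH by (simp add: psubset_card_mono)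
    then have "\<not> P W" using min[of W] by auto
    then show ?thesis using that HU by (auto simp: P_def)
  qed
  have H2': "2 * m < card H"
  proof (rule ccontr)
    assume "\<not> 2 * m < card H"
    then have c: "card H = 2 * m" using H2 by simp
    have "d * (2 * m) + 2 * m \<le> 2 * m * (2 * m) + d * m" using Hd e2[OF HU] c by simp
    moreover have "4 * m * m \<le> d * m" using mu by simp
    ultimately show False using mu by (simp add: algebra_simps)
  qed
  have deg: "d < 2 * card (E `` {v} \<inter> H)" if v: "v \<in> H" for v
  proof -
    have "E \<inter> H \<times> H \<subseteq> (E \<inter> (H - {v}) \<times> (H - {v})) \<union> ({v} \<times> (E `` {v} \<inter> H) \<union> (E `` {v} \<inter> H) \<times> {v})"
      using symE by (auto simp: sym_def)
    then have "card (E \<inter> H \<times> H) \<le> card ((E \<inter> (H - {v}) \<times> (H - {v})) \<union> ({v} \<times> (E `` {v} \<inter> H) \<union> (E `` {v} \<inter> H) \<times> {v}))"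
      using fH by (intro card_mono) auto
    also have "\<dots> \<le> card (E \<inter> (H - {v}) \<times> (H - {v})) + card ({v} \<times> (E `` {v} \<inter> H) \<union> (E `` {v} \<inter> H) \<times> {v})"
      by (rule card_Un_le)
    also have "\<dots> \<le> card (E \<inter> (H - {v}) \<times> (H - {v})) + 2 * card (E `` {v} \<inter> H)"
      using card_Un_le[of "{v} \<times> (E `` {v} \<inter> H)" "(E `` {v} \<inter> H) \<times> {v}"] by (simp add: card_cartesian_product)
    finally have 1: "card (E \<inter> H \<times> H) \<le> card (E \<inter> (H - {v}) \<times> (H - {v})) + 2 * card (E `` {v} \<inter> H)" .
    have "card (H - {v}) = card H - 1" using v fH by simp
    moreover have "H - {v} \<subset> H" using v by blast
    moreover have "2 * m \<le> card H - 1" using H2' by linarith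
    ultimately have "card (E \<inter> (H - {v}) \<times> (H - {v})) + d * m < d * (card H - 1)"
      using sub[of "H - {v}"] by simp
    then have "card (E \<inter> (H - {v}) \<times> (H - {v})) + d * m + d < d * card H"
      using H2' by (cases "card H") auto
    then show ?thesis using 1 Hd by simp
  qed
  have side: "card (E \<inter> A \<times> A) + d * m < d * card A"
    if AB: "A \<union> B = H" "B - A \<noteq> {}" and x: "x \<in> A - B" "E `` {x} \<inter> H \<subseteq> A" for A B x
  proof -
    have "card (E `` {x} \<inter> H) \<le> card A" using x AB fH finite_subset[of A H] by (intro card_mono) auto
    then have "2 * m \<le> card A" using deg[of x] x AB mu by auto
    then show ?thesis using sub[of A] AB by blast
  qed
  have conn: "m < card (A \<inter> B)" if sep: "separation H E A B" and ne: "A - B \<noteq> {}" "B - A \<noteq> {}" for A B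
  proof -
    have AB: "A \<union> B = H" using sep by (simp add: separation_def)
    have fAB: "finite A" "finite B" using AB fH by auto
    have cross: "(x, y) \<notin> E" "(y, x) \<notin> E" if "x \<in> A - B" "y \<in> B - A" for x y
      using sep that symE unfolding separation_def sym_def by blast+
    obtain x y where xy: "x \<in> A - B" "y \<in> B - A" using ne by blast
    have 1: "card (E \<inter> A \<times> A) + d * m < d * card A"
      by (rule side[OF AB ne(2) xy(1)]) (use cross xy AB in blast)
    have 2: "card (E \<inter> B \<times> B) + d * m < d * card B"
      by (rule side[OF _ ne(1) xy(2)]) (use cross xy AB in blast)+
    have "E \<inter> H \<times> H \<subseteq> E \<inter> A \<times> A \<union> E \<inter> B \<times> B" using cross AB by blast
    then have "card (E \<inter> H \<times> H) \<le> card (E \<inter> A \<times> A \<union> E \<inter> B \<times> B)"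
      using fAB by (intro card_mono) auto
    also have "\<dots> \<le> card (E \<inter> A \<times> A) + card (E \<inter> B \<times> B)" by (rule card_Un_le)
    finally have "d * card H + 2 * (d * m) < d * (card A + card B) + d * m"
      using 1 2 Hd by (simp add: algebra_simps)
    also have "card A + card B = card H + card (A \<inter> B)" using card_Un_Int[OF fAB] AB by simp
    finally have "d * m < d * card (A \<inter> B)" by (simp add: algebra_simps)
    then show ?thesis by simp
  qed
  show thesis by (rule that[OF HU Hd sub deg conn H2'])
qed

lemma connected_growth:
  assumes "finite H" "2 * m \<le> card H"
    and conn: "\<And>A B. separation H E A B \<Longrightarrow> A - B \<noteq> {} \<Longrightarrow> B - A \<noteq> {} \<Longrightarrow> m < card (A \<inter> B)"
    and A: "A \<subseteq> H" "A \<noteq> {}" "2 * card A \<le> card H"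
  shows "m \<le> card (E `` A \<inter> H - A)"
proof (cases "H - A - E `` A = {}")
  case True
  then have "E `` A \<inter> H - A = H - A" by blast
  then have "card (E `` A \<inter> H - A) = card H - card A"
    using assms A by (simp add: card_Diff_subset finite_subset)
  then show ?thesis using assms A by linarith
next
  case False
  have 1: "separation H E (A \<union> (E `` A \<inter> H)) (H - A)"
    using A by (auto simp: separation_def)
  have 2: "A \<union> (E `` A \<inter> H) - (H - A) \<noteq> {}" "(H - A) - (A \<union> (E `` A \<inter> H)) \<noteq> {}"
    using A False by auto
  have "(A \<union> (E `` A \<inter> H)) \<inter> (H - A) = E `` A \<inter> H - A" by blast
  then show ?thesis using conn[OF 1 2] by simp
qed

lemma pairing_card: "finite X \<Longrightarrow> pairing P X \<Longrightarrow> finite P \<and> card P \<le> card X"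
proof -
  assume fin: "finite X" and P: "pairing P X"
  have inj: "inj_on fst P"
  proof (rule inj_onI)
    fix p q assume "p \<in> P" "q \<in> P" "fst p = fst q"
    then show "p = q" using P unfolding pairing_def by auto
  qed
  moreover have "fst ` P \<subseteq> X" using P unfolding pairing_def by auto
  ultimately show ?thesis using fin inj_on_finite card_inj_on_le by metis
qed

text \<open>
  Half of all pairs of \<open>U\<close> are adjacent, up to a small error, so Mader's subset
  is connected to an order linear in its size. Even after deletion of all vertices that are
  used by \<open>K\<close> pairs, balls grow by a fixed fraction of \<open>U\<close> in each
  step, and the pairs can be routed greedily. The numbers fit together since \<open>|U| / 2 <
  202 K < 10 \<sqdot> 26 K\<close>: ten steps reach half of the set.
\<close>

lemma dense_subset_linked:
  assumes fin: "finite U" and symE: "sym E" and irE: "irrefl E" and K: "0 < K"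
    and U: "U \<noteq> {}" "card U \<le> 400 * K + 3"
    and deg: "\<And>v. v \<in> U \<Longrightarrow> 199 * K \<le> card (E `` {v} \<inter> U)"
  obtains H where "H \<subseteq> U" "K < card H" "\<And>T. T \<subseteq> H \<Longrightarrow> card T \<le> K \<Longrightarrow> linked H E T"
proof -
  have "196 * K * card U \<le> (\<Sum>v\<in>U. card (E `` {v} \<inter> U))"
    using sum_bounded_below[of U "196 * K" "\<lambda>v. card (E `` {v} \<inter> U)"] deg by (force simp: mult.commute)
  also have "\<dots> = card (SIGMA v:U. E `` {v} \<inter> U)" using fin by (subst card_SigmaI) auto
  also have "(SIGMA v:U. E `` {v} \<inter> U) = E \<inter> U \<times> U" by auto
  finally have dense: "196 * K * card U \<le> card (E \<inter> U \<times> U)" .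
  obtain H where H: "H \<subseteq> U"
    "\<And>A B. separation H E A B \<Longrightarrow> A - B \<noteq> {} \<Longrightarrow> B - A \<noteq> {} \<Longrightarrow> 49 * K < card (A \<inter> B)"
    "2 * (49 * K) < card H"
  proof (rule mader_dense_connected_subset[OF fin symE irE _ _ U(1) dense, of "49 * K"])
    show "0 < 49 * K" "4 * (49 * K) \<le> 196 * K" using K by auto
  qed (rule that)
  have fH: "finite H" using H fin finite_subset by blast
  have "linked H E T" if T: "T \<subseteq> H" "card T \<le> K" for T
  proof (rule linkedI)
    fix P assume P: "pairing P T"
    have fT: "finite T" using T fH finite_subset by blast
    have "card H \<le> 403 * K" using card_mono[OF fin H(1)] U K by linarith
    moreover have cP: "finite P" "card P \<le> K" using pairing_card[OF fT P] T by auto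
    have "\<exists>I. routed H E T P I"
    proof (rule greedy_routes[OF fH symE T(1) cP(1), where r = 10 and g = "26 * K" and b = "23 * K"])
      show "ends p \<subseteq> T" if "p \<in> P" for p using P that by (simp add: pairing_def)
      show "card H \<le> 2 * 10 * (26 * K)" using \<open>card H \<le> 403 * K\<close> by simp
      show "card T + card P * (2 * 10 + 2) \<le> 23 * K" using T cP by simp
      fix Q z A assume Q: "Q \<subseteq> H" "card Q \<le> 23 * K" and A: "A \<subseteq> H - Q" "z \<in> A" "2 * card A \<le> card H"
      have "49 * K \<le> card (E `` A \<inter> H - A)"
        by (rule connected_growth[OF fH _ H(2)]) (use H(3) A in auto)
      moreover have "card (E `` A \<inter> H - A) - card Q \<le> card (E `` A \<inter> H - A - Q)"
        using finite_subset[OF Q(1) fH] by (rule diff_card_le_card_Diff)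
      ultimately show "26 * K \<le> card (E `` A \<inter> H - A - Q)" using Q by linarith
    qed
    then obtain I where I: "routed H E T P I" by blast
    have IP: "I p \<subseteq> H - T" "p \<in> reach E (I p \<union> ends p)" "ends p \<subseteq> T" if "p \<in> P" for p
      using I P that by (simp_all add: routed_def pairing_def)
    have "linkage H E T P (\<lambda>p. I p \<union> ends p)"
    proof (rule linkageI)
      fix p assume p: "p \<in> P"
      show "I p \<union> ends p \<subseteq> H" "(I p \<union> ends p) \<inter> T = ends p" using IP[OF p] T by blast+
      show "p \<in> reach E (I p \<union> ends p)" using IP[OF p] by blast
      fix q assume q: "q \<in> P" "p \<noteq> q"
      have "I p \<inter> I q = {}" "ends p \<inter> ends q = {}" using I P p q by (simp_all add: routed_def pairing_def)
      then show "(I p \<union> ends p) \<inter> (I q \<union> ends q) = {}" using IP[OF p] IP[OF q(1)] by blast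
    qed
    then show "\<exists>C. linkage H E T P C" by blast
  qed
  then show thesis using that[of H] H K by auto
qed

section \<open>Massed graphs\<close>

text \<open>
  Edges are counted as ordered pairs, so every edge counts twice, and the constants below are
  twice those for edges.
\<close>

definition incident :: "'a set \<Rightarrow> 'a rel \<Rightarrow> 'a set \<Rightarrow> 'a rel" where
  "incident V E S = {e \<in> E \<inter> V \<times> V. fst e \<in> S \<or> snd e \<in> S}"

text \<open>
  The edge density outside the terminals exceeds \<open>c\<close>, but not behind a separator
  that is smaller than the set of terminals. This is the induction hypothesis of Thomas and
  Wollan. It follows from high connectivity and high density, but unlike connectivity it is
  inherited by the graphs that arise in the induction.
\<close>

definition massed :: "nat \<Rightarrow> 'a set \<Rightarrow> 'a rel \<Rightarrow> 'a set \<Rightarrow> bool" where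
  "massed c V E X \<longleftrightarrow> X \<subseteq> V \<and> c * card (V - X) < card (incident V E (V - X)) \<and>
    (\<forall>A B. separation V E A B \<longrightarrow> X \<subseteq> A \<longrightarrow> card (A \<inter> B) < card X \<longrightarrow>
      card (incident V E (B - A)) \<le> c * card (B - A))"

lemma finite_incident [simp]: "finite V \<Longrightarrow> finite (incident V E S)"
  by (simp add: incident_def)

lemma incident_empty [simp]: "incident V E {} = {}"
  by (simp add: incident_def)

lemma separation_cross:
  assumes "separation V E A B" "sym E" "x \<in> A - B" "y \<in> B - A"
  shows "(x, y) \<notin> E" "(y, x) \<notin> E"
  using assms unfolding separation_def sym_def by blast+

lemma separation_incident:
  assumes "separation V E A B" "sym E"
  shows "incident V E (B - A) = incident B E (B - A)"
proof -
  have V: "A \<union> B = V" using assms by (simp add: separation_def)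
  have *: "x \<in> B \<and> y \<in> B" if "(x, y) \<in> E" "x \<in> V" "y \<in> V" "x \<in> B - A \<or> y \<in> B - A" for x y
    using separation_cross[OF assms] that V by blast
  show ?thesis
  proof (rule set_eqI)
    fix e
    show "e \<in> incident V E (B - A) \<longleftrightarrow> e \<in> incident B E (B - A)"
      using *[of "fst e" "snd e"] V by (cases e) (auto simp: incident_def)
  qed
qed

lemma separation_extend:
  assumes "separation V E A B" "separation B E A1 B1" "A \<inter> B \<subseteq> A1" "sym E"
  shows "separation V E (A \<union> A1) B1" "(A \<union> A1) \<inter> B1 = A1 \<inter> B1" "B1 - (A \<union> A1) = B1 - A1"
proof -
  have V: "A \<union> B = V" and B: "A1 \<union> B1 = B" using assms by (simp_all add: separation_def)
  show "(A \<union> A1) \<inter> B1 = A1 \<inter> B1" "B1 - (A \<union> A1) = B1 - A1" using assms(3) B by blast+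
  show "separation V E (A \<union> A1) B1"
    unfolding separation_def
  proof (intro conjI ballI)
    show "A \<union> A1 \<union> B1 = V" using V B by blast
    fix x y assume x: "x \<in> A \<union> A1 - B1" and y: "y \<in> B1 - (A \<union> A1)"
    show "(x, y) \<notin> E"
    proof (cases "x \<in> A1")
      case True
      then show ?thesis using separation_cross(1)[OF assms(2,4), of x y] x y by blast
    next
      case False
      then have "x \<in> A - B" "y \<in> B - A" using x y assms(3) B by blast+
      then show ?thesis using separation_cross(1)[OF assms(1,4)] by blast
    qed
  qed
qed

lemma massedD:
  assumes "massed c V E X"
  shows "X \<subseteq> V" "c * card (V - X) < card (incident V E (V - X))"
    "separation V E A B \<Longrightarrow> X \<subseteq> A \<Longrightarrow> card (A \<inter> B) < card X \<Longrightarrow>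
      card (incident V E (B - A)) \<le> c * card (B - A)"
  using assms unfolding massed_def by blast+

text \<open>
  Among the separations that violate the second condition choose one with smallest side
  \<open>B\<close>. A violation inside \<open>B\<close> would be a violation in the whole
  graph with a smaller side.
\<close>

lemma massed_side:
  assumes fin: "finite V" and symE: "sym E" and XV: "X \<subseteq> V"
    and mass: "c * card (V - X) < card (incident V E (V - X))" and not: "\<not> massed c V E X"
  obtains A B where "separation V E A B" "X \<subseteq> A" "card (A \<inter> B) < card X" "massed c B E (A \<inter> B)"
proof -
  define P where "P B \<longleftrightarrow> (\<exists>A. separation V E A B \<and> X \<subseteq> A \<and> card (A \<inter> B) < card X \<and>
      c * card (B - A) < card (incident B E (B - A)))" for B
  have "\<exists>B. P B"
    using not XV mass separation_incident[OF _ symE] unfolding massed_def P_def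
    by (metis linorder_not_le)
  then obtain B where B: "P B" and min: "\<And>B'. P B' \<Longrightarrow> card B \<le> card B'"
    using ex_has_least_nat[of P _ card] by blast
  obtain A where A: "separation V E A B" "X \<subseteq> A" "card (A \<inter> B) < card X"
    "c * card (B - A) < card (incident B E (B - A))" using B P_def by auto
  have AB: "A \<union> B = V" using A by (simp add: separation_def)
  have fB: "finite A" "finite B" using AB fin by auto
  have BA: "B - A \<inter> B = B - A" by blast
  have "massed c B E (A \<inter> B)"
    unfolding massed_def BA
  proof (intro conjI allI impI)
    show "A \<inter> B \<subseteq> B" "c * card (B - A) < card (incident B E (B - A))" using A by auto
    fix A1 B1 assume *: "separation B E A1 B1" "A \<inter> B \<subseteq> A1" "card (A1 \<inter> B1) < card (A \<inter> B)"
    note ext = separation_extend[OF A(1) *(1,2) symE]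
    have B1: "A1 \<union> B1 = B" using * by (simp add: separation_def)
    show "card (incident B E (B1 - A1)) \<le> c * card (B1 - A1)"
    proof (rule ccontr)
      assume "\<not> ?thesis"
      then have "c * card (B1 - A1) < card (incident B1 E (B1 - A1))"
        using separation_incident[OF *(1) symE] by simp
      then have "P B1" unfolding P_def using ext A(2,3) *(3)
        by (intro exI[of _ "A \<union> A1"]) auto
      then have "card B \<le> card B1" by (rule min)
      then have "B1 = B" using B1 fB by (metis Un_upper2 card_seteq)
      then have "A \<inter> B \<subseteq> A1 \<inter> B1" using *(2) by blast
      then have "card (A \<inter> B) \<le> card (A1 \<inter> B1)" using fB B1 by (intro card_mono) auto
      then show False using *(3) by simp
    qed
  qed
  then show thesis using that A by blast
qed

definition contract :: "'a rel \<Rightarrow> 'a \<Rightarrow> 'a \<Rightarrow> 'a rel" where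
  "contract E u v = {(x, y). x \<noteq> y \<and> x \<noteq> v \<and> y \<noteq> v \<and>
    ((x, y) \<in> E \<or> x = u \<and> (v, y) \<in> E \<or> y = u \<and> (x, v) \<in> E)}"

lemma sym_contract: "sym E \<Longrightarrow> sym (contract E u v)"
  unfolding contract_def sym_def by blast

lemma irrefl_contract: "irrefl (contract E u v)"
  unfolding contract_def irrefl_def by blast

text \<open>
  A route through the contracted vertex becomes a route in the original graph when
  \<open>v\<close> is added to it.
\<close>

lemma linked_uncontract:
  assumes lin: "linked W (contract E u v) T" and symE: "sym E" and uv: "(u, v) \<in> E" and vT: "v \<notin> T" and "v \<notin> W"
  shows "linked (insert v W) E T"
proof (rule linkedI)
  fix P assume P: "pairing P T"
  obtain C where "linkage W (contract E u v) T P C" using linkedD[OF lin P] by blast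
  note C = linkageD[OF this]
  define D where "D p = (if u \<in> C p then insert v (C p) else C p)" for p
  have vu: "(v, u) \<in> E" using uv symE by (auto simp: sym_def)
  have "(x, y) \<in> reach E (D p)" if "(x, y) \<in> reach (contract E u v) (C p)" for x y p
    using that
  proof (induction rule: reach_induct)
    case base
    then show ?case by simp
  next
    case (step y z)
    have yz: "y \<in> D p" "z \<in> D p" using step by (auto simp: D_def)
    consider "(y, z) \<in> E" | "y = u" "(v, z) \<in> E" | "z = u" "(y, v) \<in> E"
      using step(2) by (auto simp: contract_def)
    then have "(y, z) \<in> reach E (D p)"
    proof cases
      case 1
      then show ?thesis using yz by (rule reach_edge)
    next
      case 2
      then have "v \<in> D p" using step by (simp add: D_def)
      then show ?thesis using 2 uv yz by (meson reach_edge reach_step)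
    next
      case 3
      then have "v \<in> D p" using step by (simp add: D_def)
      then show ?thesis using 3 vu yz by (meson reach_edge reach_step)
    qed
    then show ?case using step.IH reach_trans by metis
  qed
  note R = this
  have "linkage (insert v W) E T P D"
  proof (rule linkageI)
    fix p assume p: "p \<in> P"
    show "D p \<subseteq> insert v W" using C(1)[OF p] by (auto simp: D_def)
    show "D p \<inter> T = ends p" using C(2)[OF p] vT by (auto simp: D_def)
    show "p \<in> reach E (D p)" using R[of "fst p" "snd p" p] C(3)[OF p] by simp
    fix q assume q: "q \<in> P" "p \<noteq> q"
    have "v \<notin> C p" "v \<notin> C q" using C(1)[OF p] C(1)[OF q(1)] assms(5) by auto
    then show "D p \<inter> D q = {}" using C(4)[OF p q] by (auto simp: D_def)
  qed
  then show "\<exists>C. linkage (insert v W) E T P C" by blast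
qed

text \<open>
  Contraction of \<open>u v\<close> loses this edge and one of the two edges to each common
  neighbour.
\<close>

lemma contract_incident:
  assumes fin: "finite V" and symE: "sym E" and irE: "irrefl E" and uv: "u \<in> V - X" "v \<in> V - X"
  shows "card (incident V E (V - X)) \<le> card (incident (V - {v}) (contract E u v) (V - {v} - X))
    + 2 + 2 * card (E `` {u} \<inter> E `` {v} \<inter> V)"
proof -
  let ?F = "contract E u v" and ?V = "V - {v}"
  define P where "P = {e \<in> incident V E (V - X). fst e \<noteq> v \<and> snd e \<noteq> v}"
  define N where "N = E `` {v} \<inter> V"
  define M where "M = N - E `` {u} - {u}"
  have fN: "finite N" "finite M" and fP: "finite P" using fin by (auto simp: N_def M_def P_def)
  have vN: "v \<notin> N" using irE by (auto simp: N_def irrefl_def)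
  have "incident V E (V - X) \<subseteq> P \<union> ({v} \<times> N \<union> N \<times> {v})"
    using symE by (auto simp: incident_def P_def N_def sym_def)
  then have "card (incident V E (V - X)) \<le> card (P \<union> ({v} \<times> N \<union> N \<times> {v}))"
    using fP fN by (intro card_mono) auto
  also have "\<dots> \<le> card P + card ({v} \<times> N \<union> N \<times> {v})" by (rule card_Un_le)
  also have "\<dots> \<le> card P + 2 * card N"
    using card_Un_le[of "{v} \<times> N" "N \<times> {v}"] by (simp add: card_cartesian_product)
  finally have 1: "card (incident V E (V - X)) \<le> card P + 2 * card N" .
  have "N \<subseteq> M \<union> ((E `` {u} \<inter> E `` {v} \<inter> V) \<union> {u})" by (auto simp: M_def N_def)
  then have "card N \<le> card (M \<union> ((E `` {u} \<inter> E `` {v} \<inter> V) \<union> {u}))"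
    using fN fin by (intro card_mono) auto
  also have "\<dots> \<le> card M + card ((E `` {u} \<inter> E `` {v} \<inter> V) \<union> {u})" by (rule card_Un_le)
  also have "\<dots> \<le> card M + (card (E `` {u} \<inter> E `` {v} \<inter> V) + 1)"
    using card_Un_le[of "E `` {u} \<inter> E `` {v} \<inter> V" "{u}"] by simp
  finally have 2: "card N \<le> card M + card (E `` {u} \<inter> E `` {v} \<inter> V) + 1" by simp
  have d1: "{u} \<times> M \<inter> M \<times> {u} = {}" by (auto simp: M_def)
  have d2: "P \<inter> ({u} \<times> M \<union> M \<times> {u}) = {}"
    using symE by (auto simp: P_def incident_def M_def sym_def)
  have "card P + 2 * card M = card (P \<union> ({u} \<times> M \<union> M \<times> {u}))"
    using fP fN d1 d2 by (simp add: card_Un_disjoint card_cartesian_product)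
  also have "\<dots> \<le> card (incident ?V ?F (?V - X))"
  proof (intro card_mono finite_incident subsetI)
    show "finite ?V" using fin by simp
    fix e assume e: "e \<in> P \<union> ({u} \<times> M \<union> M \<times> {u})"
    obtain x y where xy: "e = (x, y)" by (cases e)
    have symD: "(b, a) \<in> E" if "(a, b) \<in> E" for a b using symE that by (auto simp: sym_def)
    have uvne: "M \<noteq> {} \<Longrightarrow> u \<noteq> v" by (auto simp: M_def N_def)
    show "e \<in> incident ?V ?F (?V - X)"
      using e uv irE vN uvne symD unfolding xy
      by (auto simp: P_def incident_def contract_def M_def N_def irrefl_def)
  qed
  finally show ?thesis using 1 2 by linarith
qed

section \<open>Massed graphs are linked\<close>

lemma incident_nonempty: "c * card S < card (incident V E S) \<Longrightarrow> S \<noteq> {}"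
  by (metis card.empty incident_empty less_nat_zero_code)

text \<open>
  A smallest counterexample, with respect to the number of vertices and then of edges. The
  number of vertices has to come first, because the induction adds edges to smaller graphs.
\<close>

locale minimal_unlinked =
  fixes V :: "'a set" and E X K
  assumes fin: "finite V" and symE: "sym E" and irE: "irrefl E"
    and massed: "massed (400 * K) V E X" and XK: "card X \<le> K"
    and unlinked: "\<not> linked V E X"
    and smaller_linked: "\<And>(W :: 'a set) F T. finite W \<Longrightarrow> sym F \<Longrightarrow> irrefl F \<Longrightarrow> massed (400 * K) W F T \<Longrightarrow> card T \<le> K \<Longrightarrow>
      card W < card V \<or> card W = card V \<and> card (F \<inter> W \<times> W) < card (E \<inter> V \<times> V) \<Longrightarrow> linked W F T"
begin

lemmas XV = massedD(1)[OF massed]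
lemmas mass = massedD(2)[OF massed]
lemmas sparse_side = massedD(3)[OF massed]

lemma finX: "finite X" using XV fin finite_subset by blast

lemma K_pos: "0 < card X"
proof (rule ccontr)
  assume "\<not> ?thesis"
  then have "X = {}" using finX by simp
  then have "pairing P X \<Longrightarrow> P = {}" for P :: "('a \<times> 'a) set" by (auto simp: pairing_def)
  then have "linked V E X" by (intro linkedI) (auto simp: linkage_def)
  then show False using unlinked by simp
qed

lemma linked_subgraph: "linked W F X \<Longrightarrow> W \<subseteq> V \<Longrightarrow> F \<inter> W \<times> W \<subseteq> E \<Longrightarrow> False"
  using linked_mono unlinked by blast

text \<open>
  Take such a separation with smallest side \<open>A\<close>. Since \<open>B\<close> links the
  overlap, it may be replaced by a clique on the overlap. The resulting graph on
  \<open>A\<close> is smaller; it is massed, since \<open>B\<close> is sparse, and a dense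
  side behind a small separator would be linked and would extend to a separation of the same
  kind with a smaller side \<open>A\<close>. So it is linked, and so is the whole graph.
\<close>

lemma no_small_rigid_separation:
  assumes "separation V E A B" "X \<subseteq> A" "card (A \<inter> B) < card X" "B - A \<noteq> {}" "linked B E (A \<inter> B)"
  shows False
proof -
  define Rg where "Rg A \<longleftrightarrow> (\<exists>B. separation V E A B \<and> X \<subseteq> A \<and> card (A \<inter> B) < card X \<and> B - A \<noteq> {} \<and> linked B E (A \<inter> B))" for A
  have "Rg A" using assms unfolding Rg_def by blast
  then obtain A where RA: "Rg A" and minA: "\<And>A'. Rg A' \<Longrightarrow> card A \<le> card A'"
    using ex_has_least_nat[of Rg A card] by blast
  obtain B where sep: "separation V E A B" and XA: "X \<subseteq> A" and ord: "card (A \<inter> B) < card X"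
    and BA: "B - A \<noteq> {}" and linB: "linked B E (A \<inter> B)"
    using RA by (auto simp: Rg_def)
  have V: "A \<union> B = V" using sep by (simp add: separation_def)
  have fA: "finite A" "finite B" using V fin by auto
  have AV: "card A < card V" using V BA fin by (intro psubset_card_mono) auto
  define F where "F = E \<union> {(x, y). x \<in> A \<inter> B \<and> y \<in> A \<inter> B \<and> x \<noteq> y}"
  have symF: "sym F" and irF: "irrefl F" using symE irE by (auto simp: F_def sym_def irrefl_def)
  have FE: "F \<subseteq> E \<union> (A \<inter> B) \<times> (A \<inter> B)" by (auto simp: F_def)
  have massA: "400 * K * card (A - X) < card (incident A F (A - X))"
  proof -
    have "incident V E (V - X) \<subseteq> incident A F (A - X) \<union> incident V E (B - A)"
      using V XA by (auto simp: incident_def F_def)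
    then have "card (incident V E (V - X)) \<le> card (incident A F (A - X) \<union> incident V E (B - A))"
      using fA fin by (intro card_mono) auto
    also have "\<dots> \<le> card (incident A F (A - X)) + card (incident V E (B - A))" by (rule card_Un_le)
    also have "\<dots> \<le> card (incident A F (A - X)) + 400 * K * card (B - A)"
      using sparse_side[OF sep XA ord] by simp
    finally have "400 * K * card (V - X) < card (incident A F (A - X)) + 400 * K * card (B - A)"
      using mass by simp
    moreover have "card (V - X) = card (A - X) + card (B - A)"
    proof -
      have "V - X = (A - X) \<union> (B - A)" using V XA by blast
      then show ?thesis using fA by (simp add: card_Un_disjoint[of "A - X" "B - A"] Diff_Int_distrib2 disjoint_iff)
    qed
    ultimately show ?thesis by (simp add: algebra_simps)
  qed
  have "massed (400 * K) A F X"
  proof (rule ccontr)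
    assume "\<not> massed (400 * K) A F X"
    then obtain A1 B1 where sep1: "separation A F A1 B1" and XA1: "X \<subseteq> A1" and ord1: "card (A1 \<inter> B1) < card X"
      and m1: "massed (400 * K) B1 F (A1 \<inter> B1)"
      using massed_side[OF fA(1) symF XA massA] by metis
    have A1: "A1 \<union> B1 = A" using sep1 by (simp add: separation_def)
    have fB1: "finite B1" "finite A1" using A1 fA by auto
    have BB: "B1 - A1 \<inter> B1 = B1 - A1" by blast
    note mass1 = massedD(2)[OF m1, unfolded BB]
    have ne1: "B1 - A1 \<noteq> {}" using incident_nonempty[OF mass1] .
    have "card B1 < card V" using card_mono[of A B1] A1 fA AV by auto
    then have lin1: "linked B1 F (A1 \<inter> B1)"
      using smaller_linked[OF fB1(1) symF irF m1] ord1 XK by auto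
    show False
    proof (cases "A \<inter> B \<subseteq> A1")
      case True
      have sep2: "separation V E (A1 \<union> B) B1"
        unfolding separation_def
      proof (intro conjI ballI)
        show "A1 \<union> B \<union> B1 = V" using V A1 by blast
        fix x y assume x: "x \<in> A1 \<union> B - B1" and y: "y \<in> B1 - (A1 \<union> B)"
        show "(x, y) \<notin> E"
        proof (cases "x \<in> A1")
          case True
          then have "(x, y) \<notin> F" using separation_cross(1)[OF sep1 symF, of x y] x y by blast
          then show ?thesis by (simp add: F_def)
        next
          case False
          then have "x \<in> B - A" "y \<in> A - B" using x y \<open>A \<inter> B \<subseteq> A1\<close> A1 by blast+
          then show ?thesis using separation_cross(2)[OF sep symE] by blast
        qed
      qed
      have eqs: "(A1 \<union> B) \<inter> B1 = A1 \<inter> B1" "B1 - (A1 \<union> B) = B1 - A1" using True A1 by blast+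
      have "card (incident V E (B1 - A1)) \<le> 400 * K * card (B1 - A1)"
        using sparse_side[OF sep2, unfolded eqs] XA1 ord1 by blast
      moreover have "B1 \<subseteq> V" using A1 V by blast
      then have "incident B1 F (B1 - A1) \<subseteq> incident V E (B1 - A1)"
        using True by (auto simp: incident_def F_def)
      then have "card (incident B1 F (B1 - A1)) \<le> card (incident V E (B1 - A1))"
        using fin by (intro card_mono) auto
      ultimately show False using mass1 by simp
    next
      case False
      have AB1: "A \<inter> B \<subseteq> B1"
      proof (rule ccontr)
        assume "\<not> A \<inter> B \<subseteq> B1"
        then obtain y where y: "y \<in> A \<inter> B" "y \<in> A1 - B1" using A1 by blast
        obtain x where x: "x \<in> A \<inter> B" "x \<in> B1 - A1" using False A1 by blast
        have "(y, x) \<in> F" using x y by (auto simp: F_def)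
        then show False using separation_cross(1)[OF sep1 symF] x y by blast
      qed
      have B1B: "B1 \<inter> B = A \<inter> B" using AB1 A1 by blast
      have lin2: "linked (B1 \<union> B) E (A1 \<inter> B1)"
        by (rule linked_replace_clique[OF symF irF]) (use B1B FE linB lin1 in auto)
      have eq2: "A1 \<inter> (B1 \<union> B) = A1 \<inter> B1" using AB1 A1 by blast
      have "separation V E A1 (B1 \<union> B)"
        unfolding separation_def
      proof (intro conjI ballI)
        show "A1 \<union> (B1 \<union> B) = V" using V A1 by blast
        fix x y assume x: "x \<in> A1 - (B1 \<union> B)" and y: "y \<in> B1 \<union> B - A1"
        show "(x, y) \<notin> E"
        proof (cases "y \<in> B1")
          case True
          then have "(x, y) \<notin> F" using separation_cross(1)[OF sep1 symF, of x y] x y by blast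
          then show ?thesis by (simp add: F_def)
        next
          case False
          then have "x \<in> A - B" "y \<in> B - A" using x y AB1 A1 by blast+
          then show ?thesis using separation_cross(1)[OF sep symE] by blast
        qed
      qed
      then have "Rg A1" unfolding Rg_def using XA1 eq2 ord1 lin2 ne1
        by (intro exI[of _ "B1 \<union> B"]) auto
      then have "card A \<le> card A1" by (rule minA)
      moreover have "card A1 < card A" using ne1 A1 fA by (intro psubset_card_mono) auto
      ultimately show False by simp
    qed
  qed
  then have "linked A F X" using smaller_linked[OF fA(1) symF irF] XK AV by blast
  then have "linked V E X" using linked_replace_clique[OF symF irF FE XA linB] V by simp
  then show False using unlinked by simp
qed

lemma no_core:
  assumes "finite A" "X \<subseteq> A" "separation V E A B" "card X \<le> card B"
    "\<And>T. T \<subseteq> A \<inter> B \<Longrightarrow> card T \<le> card X \<Longrightarrow> linked B E T"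
  shows False
proof -
  obtain A1 B1 where *: "separation V E A1 B1" "X \<subseteq> A1" "B \<subseteq> B1" "card (A1 \<inter> B1) < card X"
    "linked B1 E (A1 \<inter> B1)"
    using linked_or_small_rigid_separation[OF assms(1) symE irE assms(2,3,5)] unlinked by metis
  have "finite B1" using *(1) fin by (auto simp: separation_def)
  have "B1 - A1 \<noteq> {}"
  proof
    assume "B1 - A1 = {}"
    then have "A1 \<inter> B1 = B1" by blast
    then have "card B \<le> card (A1 \<inter> B1)" using *(3) \<open>finite B1\<close> by (simp add: card_mono)
    then show False using *(4) assms(4) by simp
  qed
  then show False using no_small_rigid_separation[OF *(1,2,4) _ *(5)] by blast
qed

text \<open>
  The case of an overlap as large as the set of terminals is reduced to smaller ones by
  Menger's theorem.
\<close>

lemma no_rigid_separation: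
  assumes "separation V E A B" "X \<subseteq> A" "card (A \<inter> B) \<le> card X" "B - A \<noteq> {}" "linked B E (A \<inter> B)"
  shows False
proof (cases "card (A \<inter> B) < card X")
  case True
  then show False using no_small_rigid_separation assms by blast
next
  case False
  have f: "finite A" "finite B" using assms(1) fin by (auto simp: separation_def)
  show False
  proof (rule no_core[OF f(1) assms(2,1)])
    show "card X \<le> card B" using False f card_mono[of B "A \<inter> B"] by auto
    show "linked B E T" if "T \<subseteq> A \<inter> B" for T using linked_terminals_mono[OF assms(5) that] .
  qed
qed

text \<open>
  Otherwise contract \<open>u v\<close>. The density condition survives, so the contracted
  graph has a dense, hence linked, side \<open>B\<close> behind a small separator. Lifted to
  the original graph, it gives a forbidden separation. If the contracted vertex is in the
  overlap, then both \<open>u\<close> and \<open>v\<close> are, the order grows by one to at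
  most \<open>card X\<close>, and the side is linked because it is massed in the original
  graph.
\<close>

lemma many_common_neighbours:
  assumes u: "u \<in> V - X" and v: "v \<in> V - X" and uv: "(u, v) \<in> E"
  shows "200 * K \<le> card (E `` {u} \<inter> E `` {v} \<inter> V)"
proof (rule ccontr)
  assume few: "\<not> ?thesis"
  let ?F = "contract E u v" and ?V = "V - {v}"
  have symF: "sym ?F" and irF: "irrefl ?F" using symE by (simp_all add: sym_contract irrefl_contract)
  have uv': "u \<noteq> v" using uv irE by (auto simp: irrefl_def)
  have XV': "X \<subseteq> ?V" and fV': "finite ?V" using XV v fin by auto
  have cV: "card ?V < card V" using v fin by (intro psubset_card_mono) auto
  have VX: "V - {v} - X = V - X - {v}" by blast
  have "card (V - X) = card (?V - X) + 1" using card.remove[of "V - X" v] v fin unfolding VX by simp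
  then have mass': "400 * K * card (?V - X) < card (incident ?V ?F (?V - X))"
    using mass contract_incident[OF fin symE irE u v] few by (simp add: algebra_simps)
  have *: "(x, y) \<in> E \<Longrightarrow> x \<noteq> v \<Longrightarrow> y \<noteq> v \<Longrightarrow> (x, y) \<in> ?F" for x y
    using irE by (auto simp: contract_def irrefl_def)
  have **: "(v, y) \<in> E \<Longrightarrow> y \<noteq> u \<Longrightarrow> (u, y) \<in> ?F" "(y, v) \<in> E \<Longrightarrow> y \<noteq> u \<Longrightarrow> (y, u) \<in> ?F" for y
    using irE uv' by (auto simp: contract_def irrefl_def)
  have "\<not> massed (400 * K) ?V ?F X"
  proof
    assume "massed (400 * K) ?V ?F X"
    then have "linked ?V ?F X" using smaller_linked[OF fV' symF irF] XK cV by blast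
    then have "linked (insert v ?V) E X" by (rule linked_uncontract[OF _ symE uv]) (use v in auto)
    moreover have "insert v ?V = V" using v by blast
    ultimately show False using unlinked by simp
  qed
  then obtain A B where sep: "separation ?V ?F A B" and XA: "X \<subseteq> A" and ord: "card (A \<inter> B) < card X"
    and mB: "massed (400 * K) B ?F (A \<inter> B)"
    using massed_side[OF fV' symF XV' mass'] by metis
  have AB: "A \<union> B = ?V" using sep by (simp add: separation_def)
  have f: "finite A" "finite B" using finite_subset[OF _ fV'] AB by blast+
  have vAB: "v \<notin> A" "v \<notin> B" using AB by auto
  have BAB: "B - A \<inter> B = B - A" by blast
  note massB = massedD(2)[OF mB, unfolded BAB]
  have neB: "B - A \<noteq> {}" using incident_nonempty[OF massB] .
  have "B \<subseteq> ?V" using AB by blast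
  then have cB: "card B < card V" using card_mono[OF fV'] cV by (meson le_less_trans)
  have cross: "(x, y) \<notin> E" if "x \<in> A - B" "y \<in> B - A" for x y
    using separation_cross(1)[OF sep symF that] *[of x y] that vAB by blast
  have crossv1: "(x, v) \<notin> E" if "x \<in> A - B" "u \<in> B - A" for x
    using separation_cross(1)[OF sep symF that] **(2)[of x] that by blast
  have crossv2: "(v, y) \<notin> E" if "u \<in> A - B" "y \<in> B - A" for y
    using separation_cross(1)[OF sep symF that] **(1)[of y] that by blast
  consider "u \<in> A - B" | "u \<in> B - A" | "u \<in> A \<inter> B" using AB u uv' by blast
  then show False
  proof cases
    case 1
    have sep': "separation V E (insert v A) B"
      unfolding separation_def using AB v vAB cross crossv2[OF 1] by auto
    have eqs: "insert v A \<inter> B = A \<inter> B" "B - insert v A = B - A" using vAB by auto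
    have "card (incident V E (B - A)) \<le> 400 * K * card (B - A)"
      using sparse_side[OF sep'] XA ord eqs by auto
    moreover have "incident B ?F (B - A) \<subseteq> incident V E (B - A)"
      using 1 AB by (auto simp: incident_def contract_def)
    then have "card (incident B ?F (B - A)) \<le> card (incident V E (B - A))"
      using fin by (intro card_mono) auto
    ultimately show False using massB by simp
  next
    case 2
    have "linked B ?F (A \<inter> B)" using smaller_linked[OF f(2) symF irF mB] ord XK cB by auto
    then have lin: "linked (insert v B) E (A \<inter> B)"
      by (rule linked_uncontract[OF _ symE uv]) (use vAB in auto)
    have sep': "separation V E A (insert v B)"
      unfolding separation_def using AB v vAB cross crossv1[OF _ 2] by auto
    have eqs: "A \<inter> insert v B = A \<inter> B" using vAB by auto
    show False using no_rigid_separation[OF sep' XA] eqs lin ord 2 by auto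
  next
    case 3
    let ?A = "insert v A" and ?B = "insert v B"
    have sep': "separation V E ?A ?B"
      unfolding separation_def using AB v cross by auto
    have eqI: "?A \<inter> ?B = insert v (A \<inter> B)" and eqD: "?B - ?A = B - A" "?B - insert v (A \<inter> B) = B - A"
      using vAB by auto
    have ordI: "card (?A \<inter> ?B) \<le> card X" using ord f vAB unfolding eqI by (simp add: card_insert_if)
    have "massed (400 * K) ?B E (?A \<inter> ?B)"
      unfolding massed_def eqI eqD
    proof (intro conjI allI impI)
      show "insert v (A \<inter> B) \<subseteq> ?B" by blast
      (* Edges at u that came from v are sent back to v, so no edge of the contracted side is lost. *)
      define h where "h e = (if e \<in> E then e else if fst e = u then (v, snd e) else (fst e, v))" for e
      have symD: "(b, a) \<in> E" if "(a, b) \<in> E" for a b using symE that by (auto simp: sym_def)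
      have inj: "inj_on h (incident B ?F (B - A))"
        using vAB by (auto simp: inj_on_def h_def incident_def contract_def)
      have "h ` incident B ?F (B - A) \<subseteq> incident ?B E (B - A)"
        using 3 by (auto simp: h_def incident_def contract_def)
      then have "card (incident B ?F (B - A)) \<le> card (incident ?B E (B - A))"
        using inj f by (intro card_inj_on_le[of h]) auto
      then show "400 * K * card (B - A) < card (incident ?B E (B - A))" using massB by simp
      fix A1 B1 assume s1: "separation ?B E A1 B1" "insert v (A \<inter> B) \<subseteq> A1"
        "card (A1 \<inter> B1) < card (insert v (A \<inter> B))"
      note ext = separation_extend[OF sep' s1(1) _ symE, unfolded eqI, OF s1(2)]
      have "card (incident V E (B1 - A1)) \<le> 400 * K * card (B1 - A1)"
        using sparse_side[OF ext(1)] ext(2,3) XA s1(3) ordI[unfolded eqI] by auto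
      moreover have "incident ?B E (B1 - A1) \<subseteq> incident V E (B1 - A1)"
        using AB v by (auto simp: incident_def)
      then have "card (incident ?B E (B1 - A1)) \<le> card (incident V E (B1 - A1))"
        using fin by (intro card_mono) auto
      ultimately show "card (incident ?B E (B1 - A1)) \<le> 400 * K * card (B1 - A1)" by simp
    qed
    moreover have "card ?B < card V"
    proof -
      have "\<not> X \<subseteq> A \<inter> B" using ord f card_mono[of "A \<inter> B" X] by auto
      then obtain x where "x \<in> X" "x \<in> A - B" using XA by blast
      then have "?B \<subset> V" using AB v XV vAB by blast
      then show ?thesis using fin by (intro psubset_card_mono)
    qed
    ultimately have "linked ?B E (?A \<inter> ?B)"
      using smaller_linked[of ?B E "?A \<inter> ?B"] f symE irE ordI XK by auto
    then show False using no_rigid_separation[OF sep'] XA ordI eqD neB by auto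
  qed
qed

text \<open>
  A vertex whose neighbours are all terminals could be deleted without affecting density or
  separations.
\<close>

lemma neighbour_outside_terminals:
  assumes w: "w \<in> V - X"
  shows "\<exists>u\<in>V - X. (w, u) \<in> E"
proof (rule ccontr)
  assume no: "\<not> ?thesis"
  let ?V = "V - {w}"
  have no': "(w, u) \<notin> E" "(u, w) \<notin> E" if "u \<in> V - X" for u
    using no that symE by (auto simp: sym_def)
  have VX: "V - {w} - X = V - X - {w}" by blast
  have c: "card (V - X) = card (?V - X) + 1" using card.remove[of "V - X" w] w fin unfolding VX by simp
  have "incident V E (V - X) \<subseteq> incident ?V E (?V - X) \<union> ({w} \<times> X \<union> X \<times> {w})"
    using no' by (auto simp: incident_def)
  then have "card (incident V E (V - X)) \<le> card (incident ?V E (?V - X) \<union> ({w} \<times> X \<union> X \<times> {w}))"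
    using fin finX by (intro card_mono) auto
  also have "\<dots> \<le> card (incident ?V E (?V - X)) + card ({w} \<times> X \<union> X \<times> {w})" by (rule card_Un_le)
  also have "\<dots> \<le> card (incident ?V E (?V - X)) + 2 * card X"
    using card_Un_le[of "{w} \<times> X" "X \<times> {w}"] by (simp add: card_cartesian_product)
  finally have mass': "400 * K * card (?V - X) < card (incident ?V E (?V - X))"
    using mass XK unfolding c by (simp add: algebra_simps)
  have "massed (400 * K) ?V E X"
    unfolding massed_def
  proof (intro conjI allI impI mass')
    show "X \<subseteq> ?V" using XV w by blast
    fix A B assume s: "separation ?V E A B" "X \<subseteq> A" "card (A \<inter> B) < card X"
    have AB: "A \<union> B = ?V" using s by (simp add: separation_def)
    have s': "separation V E (insert w A) B"
      unfolding separation_def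
    proof (intro conjI ballI)
      show "insert w A \<union> B = V" using AB w by blast
      fix x y assume x: "x \<in> insert w A - B" and y: "y \<in> B - insert w A"
      have "y \<in> V - X" using y s(2) AB by blast
      then show "(x, y) \<notin> E" using no'(1)[of y] separation_cross(1)[OF s(1) symE, of x y] x y by blast
    qed
    have eqs: "insert w A \<inter> B = A \<inter> B" "B - insert w A = B - A" using AB by auto
    have "card (incident V E (B - A)) \<le> 400 * K * card (B - A)"
      using sparse_side[OF s'] s eqs by auto
    moreover have "card (incident ?V E (B - A)) \<le> card (incident V E (B - A))"
      using fin by (intro card_mono) (auto simp: incident_def)
    ultimately show "card (incident ?V E (B - A)) \<le> 400 * K * card (B - A)" by simp
  qed
  moreover have "card ?V < card V" using w fin by (intro psubset_card_mono) auto
  ultimately have "linked ?V E X" using smaller_linked[of ?V E X] fin symE irE XK by auto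
  then show False using linked_subgraph by blast
qed

text \<open>
  Delete an edge \<open>u v\<close> away from the terminals. A small separator of the new
  graph that splits \<open>u\<close> from \<open>v\<close> would have to contain all their
  common neighbours, which are too many. So only the density condition can fail, and this says
  that the density is hardly above the threshold.
\<close>

lemma incident_bound: "card (incident V E (V - X)) \<le> 400 * K * card (V - X) + 2"
proof -
  have "V - X \<noteq> {}" using incident_nonempty[OF mass] .
  then obtain u v where uv: "u \<in> V - X" "v \<in> V - X" "(u, v) \<in> E"
    using neighbour_outside_terminals by blast
  define F where "F = E - {(u, v), (v, u)}"
  have symF: "sym F" and irF: "irrefl F" using symE irE by (auto simp: F_def sym_def irrefl_def)
  have "F \<inter> V \<times> V \<subset> E \<inter> V \<times> V" using uv by (auto simp: F_def)
  then have less: "card (F \<inter> V \<times> V) < card (E \<inter> V \<times> V)" using fin by (intro psubset_card_mono) auto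
  have side: "card (incident V F (B - A)) \<le> 400 * K * card (B - A)"
    if s: "separation V F A B" "X \<subseteq> A" "card (A \<inter> B) < card X" for A B
  proof -
    have AB: "A \<union> B = V" using s by (simp add: separation_def)
    have "separation V E A B"
      unfolding separation_def
    proof (intro conjI ballI notI AB)
      fix x y assume x: "x \<in> A - B" and y: "y \<in> B - A" and xy: "(x, y) \<in> E"
      then have xyuv: "x = u \<and> y = v \<or> x = v \<and> y = u"
        using separation_cross(1)[OF s(1) symF x y] by (auto simp: F_def)
      have "E `` {u} \<inter> E `` {v} \<inter> V \<subseteq> A \<inter> B"
      proof
        fix w assume w: "w \<in> E `` {u} \<inter> E `` {v} \<inter> V"
        then have wE: "(x, w) \<in> E" "(y, w) \<in> E" "w \<in> V" using xyuv by auto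
        then have "w \<noteq> x" "w \<noteq> y" using irE by (auto simp: irrefl_def)
        then have "(x, w) \<in> F" "(y, w) \<in> F" using wE xyuv by (auto simp: F_def)
        then show "w \<in> A \<inter> B"
          using separation_cross[OF s(1) symF] x y wE(3) AB by blast
      qed
      then have "card (E `` {u} \<inter> E `` {v} \<inter> V) \<le> card (A \<inter> B)"
        using AB fin finite_subset[of "A \<inter> B" V] by (intro card_mono) auto
      then show False using many_common_neighbours[OF uv] s(3) XK by linarith
    qed
    then have "card (incident V E (B - A)) \<le> 400 * K * card (B - A)" using sparse_side s by blast
    moreover have "card (incident V F (B - A)) \<le> card (incident V E (B - A))"
      using fin by (intro card_mono) (auto simp: incident_def F_def)
    ultimately show ?thesis by simp
  qed
  have "\<not> massed (400 * K) V F X"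
  proof
    assume "massed (400 * K) V F X"
    then have "linked V F X" using smaller_linked[OF fin symF irF] XK less by blast
    then show False using linked_subgraph[of V F] by (auto simp: F_def)
  qed
  then have "card (incident V F (V - X)) \<le> 400 * K * card (V - X)"
    using side XV unfolding massed_def by (metis linorder_not_le)
  moreover have "incident V E (V - X) \<subseteq> incident V F (V - X) \<union> {(u, v), (v, u)}"
    by (auto simp: incident_def F_def)
  then have "card (incident V E (V - X)) \<le> card (incident V F (V - X) \<union> {(u, v), (v, u)})"
    using fin by (intro card_mono) auto
  moreover have "\<dots> \<le> card (incident V F (V - X)) + 2"
  proof -
    have "card {(u, v), (v, u)} \<le> 2"
      using card_insert_le_m1[of 2 "{(v, u)}" "(u, v)"] by simp
    then show ?thesis using card_Un_le[of "incident V F (V - X)" "{(u, v), (v, u)}"] by linarith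
  qed
  ultimately show ?thesis by linarith
qed

text \<open>
  By the bound on the density there is a vertex \<open>w\<close> of degree at most \<open>400
  K + 2\<close>. Each neighbour of \<open>w\<close> shares about half as many neighbours with
  \<open>w\<close>, so the neighbourhood of \<open>w\<close> is dense and contains a linked
  set, to which the terminals are led.
\<close>

lemma contradiction: False
proof -
  let ?d = "\<lambda>w. card (E `` {w} \<inter> V)"
  have K: "0 < K" using K_pos XK by linarith
  have neVX: "V - X \<noteq> {}" using incident_nonempty[OF mass] .
  have "\<exists>w\<in>V - X. ?d w \<le> 400 * K + 2"
  proof (rule ccontr)
    assume "\<not> ?thesis"
    then have "(400 * K + 3) * card (V - X) \<le> (\<Sum>w\<in>V - X. ?d w)"
      using sum_bounded_below[of "V - X" "400 * K + 3" ?d] by (force simp: mult.commute)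
    also have "\<dots> = card (SIGMA w:V - X. E `` {w} \<inter> V)" using fin by (subst card_SigmaI) auto
    also have "\<dots> \<le> card (incident V E (V - X))"
      using fin by (intro card_mono) (auto simp: incident_def)
    finally have "3 * card (V - X) \<le> 2" using incident_bound by (simp add: algebra_simps)
    moreover have "card (V - X) \<noteq> 0" using neVX fin by (metis card_0_eq finite_Diff)
    ultimately show False by linarith
  qed
  then obtain w where w: "w \<in> V - X" "?d w \<le> 400 * K + 2" by blast
  define U where "U = insert w (E `` {w} \<inter> V - X)"
  have UV: "U \<subseteq> V - X" using w by (auto simp: U_def)
  have fU: "finite U" using fin by (simp add: U_def)
  have "card (E `` {w} \<inter> V - X) \<le> ?d w" using fin by (intro card_mono) auto
  then have cU: "card U \<le> 400 * K + 3" using w(2) fin by (simp add: U_def card_insert_if)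
  have big: "199 * K \<le> card (E `` {u} \<inter> E `` {v} \<inter> V - X)" if "u \<in> V - X" "v \<in> V - X" "(u, v) \<in> E" for u v
  proof -
    have "card (E `` {u} \<inter> E `` {v} \<inter> V) - card X \<le> card (E `` {u} \<inter> E `` {v} \<inter> V - X)"
      using finX by (rule diff_card_le_card_Diff)
    then show ?thesis using many_common_neighbours[OF that] XK by linarith
  qed
  have deg: "199 * K \<le> card (E `` {u} \<inter> U)" if u: "u \<in> U" for u
  proof -
    obtain u' where u': "u' \<in> V - X" "(w, u') \<in> E" "u = w \<or> u = u'"
    proof (cases "u = w")
      case True
      then show thesis using that neighbour_outside_terminals[OF w(1)] by blast
    next
      case False
      then show thesis using that u by (auto simp: U_def)
    qed
    have "E `` {w} \<inter> E `` {u'} \<inter> V - X \<subseteq> E `` {u} \<inter> U"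
      using u'(3) by (auto simp: U_def)
    then have "card (E `` {w} \<inter> E `` {u'} \<inter> V - X) \<le> card (E `` {u} \<inter> U)"
      using fU by (intro card_mono) auto
    then show ?thesis using big[OF w(1) u'(1,2)] by simp
  qed
  obtain H where H: "H \<subseteq> U" "K < card H" "\<And>T. T \<subseteq> H \<Longrightarrow> card T \<le> K \<Longrightarrow> linked H E T"
    by (rule dense_subset_linked[OF fU symE irE K _ cU deg]) (use that in \<open>auto simp: U_def\<close>)
  show False
  proof (rule no_core[of V H])
    show "separation V E V H" using H(1) UV by (auto simp: separation_def)
    show "linked H E T" if "T \<subseteq> V \<inter> H" "card T \<le> card X" for T using H(3)[of T] that XK by auto
  qed (use fin XV H(2) XK in auto)
qed

end

theorem massed_linked:
  fixes V :: "'a set"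
  assumes "finite V" "sym E" "irrefl E" "massed (400 * K) V E X" "card X \<le> K"
  shows "linked V E X"
proof -
  let ?R = "less_than <*lex*> less_than"
  let ?m = "\<lambda>(V :: 'a set, E, X :: 'a set). (card V, card (E \<inter> V \<times> V))"
  have "finite V \<longrightarrow> sym E \<longrightarrow> irrefl E \<longrightarrow> massed (400 * K) V E X \<longrightarrow> card X \<le> K \<longrightarrow> linked V E X"
    for V :: "'a set" and E X
  proof (induction "(V, E, X)" arbitrary: V E X rule: wf_induct_rule[OF wf_inv_image[of ?R ?m]])
    case 1
    show ?case by (simp add: wf_lex_prod)
  next
    case (2 V E X)
    show ?case
    proof (intro impI, rule ccontr)
      assume "finite V" "sym E" "irrefl E" "massed (400 * K) V E X" "card X \<le> K" "\<not> linked V E X"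
      then interpret minimal_unlinked V E X K
      proof unfold_locales
        show "linked W F T" if "finite W" "sym F" "irrefl F" "massed (400 * K) W F T" "card T \<le> K"
          "card W < card V \<or> card W = card V \<and> card (F \<inter> W \<times> W) < card (E \<inter> V \<times> V)"
          for W :: "'a set" and F T
          using 2[of W F T] that by (auto simp: inv_image_def)
      qed
      show False by (rule contradiction)
    qed
  qed
  then show ?thesis using assms by blast
qed

section \<open>Topological cliques from average degree\<close>

definition pairs_of :: "'a::linorder set \<Rightarrow> ('a \<times> 'a) set" where
  "pairs_of X = {(x, y). x \<in> X \<and> y \<in> X \<and> x < y}"

text \<open>
  A subdivision of a clique, except that the subdivided edges are given by disjoint sets
  instead of paths.
\<close>

definition topological_clique :: "'a::linorder set \<Rightarrow> 'a rel \<Rightarrow> nat \<Rightarrow> bool" where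
  "topological_clique V E s \<longleftrightarrow> (\<exists>X I. X \<subseteq> V \<and> card X = s \<and> routed V E X (pairs_of X) I)"

lemma greedy_distinct_representatives:
  assumes "finite J" "\<And>j. j \<in> J \<Longrightarrow> finite (N j) \<and> card J \<le> card (N j)"
  shows "\<exists>f. inj_on f J \<and> (\<forall>j\<in>J. f j \<in> N j)"
  using assms
proof (induction J)
  case empty
  then show ?case by simp
next
  case (insert j J)
  obtain f where f: "inj_on f J" "\<forall>i\<in>J. f i \<in> N i" using insert by force
  have "card (f ` J) < card (N j)" using insert(1,2,4) f(1) by (force simp: card_image)
  then have "\<not> N j \<subseteq> f ` J" using insert(1) by (metis card_mono finite_imageI linorder_not_le)
  then obtain a where a: "a \<in> N j" "a \<notin> f ` J" by blast
  then have "inj_on (f(j := a)) (insert j J) \<and> (\<forall>i\<in>insert j J. (f(j := a)) i \<in> N i)"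
    using f insert(2) by (auto simp: inj_on_def)
  then show ?case by blast
qed

text \<open>
  Deletion of \<open>s\<close> branch vertices from a set with the properties of
  \<open>mader_dense_connected_subset\<close> leaves the second condition void: a separator
  with fewer than \<open>s\<^sup>2\<close> vertices, together with \<open>Z\<close>, would be
  too small for the connectivity. For the first one, enlarge \<open>Z \<union> X\<close> to a
  set \<open>W\<close> of size \<open>4 s\<^sup>2\<close>; by minimality \<open>W\<close>
  spans few edges, and the others are incident with its complement.
\<close>

lemma massed_after_deleting:
  assumes fin: "finite H" and symE: "sym E" and Z: "Z \<subseteq> H" "card Z \<le> s" and X: "X \<subseteq> H - Z" "card X \<le> s\<^sup>2"
    and s: "0 < s"
    and dense: "800 * s\<^sup>2 * card H \<le> card (E \<inter> H \<times> H) + 800 * s\<^sup>2 * (2 * s\<^sup>2)"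
    and sub: "\<And>W. W \<subset> H \<Longrightarrow> 2 * (2 * s\<^sup>2) \<le> card W \<Longrightarrow>
      card (E \<inter> W \<times> W) + 800 * s\<^sup>2 * (2 * s\<^sup>2) < 800 * s\<^sup>2 * card W"
    and conn: "\<And>A B. separation H E A B \<Longrightarrow> A - B \<noteq> {} \<Longrightarrow> B - A \<noteq> {} \<Longrightarrow> 2 * s\<^sup>2 < card (A \<inter> B)"
    and big: "400 * s\<^sup>2 \<le> card H"
  shows "massed (400 * s\<^sup>2) (H - Z) E X"
proof -
  have ss: "s \<le> s\<^sup>2" using s by (simp add: power2_eq_square)
  have finZX: "finite Z" "finite X" using fin Z X finite_subset by blast+
  have mass: "400 * s\<^sup>2 * card (H - Z - X) < card (incident (H - Z) E (H - Z - X))"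
  proof -
    have "card (Z \<union> X) \<le> 4 * s\<^sup>2" using card_Un_le[of Z X] Z X ss by linarith
    moreover have "4 * s\<^sup>2 \<le> card H" using big by linarith
    ultimately obtain W where W: "Z \<union> X \<subseteq> W" "W \<subseteq> H" "card W = 4 * s\<^sup>2"
      using exists_subset_between[of "Z \<union> X" "4 * s\<^sup>2" H] Z X fin by auto
    have "0 < s\<^sup>2" using s by simp
    then have "card W < card H" using W big by linarith
    then have "W \<subset> H" using W by blast
    then have e1: "card (E \<inter> W \<times> W) < 800 * s\<^sup>2 * (2 * s\<^sup>2)" using sub[of W] W(3) by simp
    have "E \<inter> H \<times> H \<subseteq> E \<inter> W \<times> W \<union> (incident (H - Z) E (H - Z - X) \<union> (Z \<times> H \<union> H \<times> Z))"
      using W(1) by (auto simp: incident_def)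
    then have "card (E \<inter> H \<times> H) \<le> card (E \<inter> W \<times> W \<union> (incident (H - Z) E (H - Z - X) \<union> (Z \<times> H \<union> H \<times> Z)))"
      using fin finZX W(2) by (intro card_mono) (auto intro: finite_subset)
    also have "\<dots> \<le> card (E \<inter> W \<times> W) + (card (incident (H - Z) E (H - Z - X)) + (card (Z \<times> H) + card (H \<times> Z)))"
      by (meson add_left_mono card_Un_le order_trans)
    also have "\<dots> = card (E \<inter> W \<times> W) + card (incident (H - Z) E (H - Z - X)) + 2 * (card Z * card H)"
      by (simp add: card_cartesian_product)
    finally have e2: "card (E \<inter> H \<times> H) \<le> card (E \<inter> W \<times> W) + card (incident (H - Z) E (H - Z - X)) + 2 * (card Z * card H)" .
    have z: "card Z * card H \<le> s\<^sup>2 * card H" using Z(2) ss by (simp add: order_trans)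
    have b: "s\<^sup>2 * (400 * s\<^sup>2) \<le> s\<^sup>2 * card H" using big by (rule mult_le_mono2)
    have "400 * s\<^sup>2 * card (H - Z - X) \<le> 400 * s\<^sup>2 * card H"
      using fin by (intro mult_le_mono2 card_mono) auto
    also have "\<dots> = 400 * (s\<^sup>2 * card H)" by simp
    finally have c: "400 * s\<^sup>2 * card (H - Z - X) \<le> 400 * (s\<^sup>2 * card H)" .
    have d: "800 * (s\<^sup>2 * card H) \<le> card (E \<inter> H \<times> H) + 1600 * (s\<^sup>2 * s\<^sup>2)"
      using dense by (simp add: mult.assoc)
    have e1': "card (E \<inter> W \<times> W) < 1600 * (s\<^sup>2 * s\<^sup>2)" using e1 by (simp add: mult.assoc)
    have b': "400 * (s\<^sup>2 * s\<^sup>2) \<le> s\<^sup>2 * card H" using b mult.left_commute[of 400 "s\<^sup>2" "s\<^sup>2"] by linarith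
    show ?thesis using c d e1' e2 z b' by linarith
  qed
  show ?thesis
    unfolding massed_def
  proof (intro conjI allI impI mass X(1))
    fix A B assume *: "separation (H - Z) E A B" "X \<subseteq> A" "card (A \<inter> B) < card X"
    have AB: "A \<union> B = H - Z" using * by (simp add: separation_def)
    have fAB: "finite (A \<inter> B)" using AB fin by (metis finite_Diff finite_Int finite_Un)
    have "B - A = {}"
    proof (rule ccontr)
      assume ne: "B - A \<noteq> {}"
      have "\<not> X \<subseteq> A \<inter> B" using *(3) fAB card_mono linorder_not_le by metis
      then have ne': "A - B \<noteq> {}" using *(2) by blast
      have "separation H E (A \<union> Z) (B \<union> Z)"
        unfolding separation_def
      proof (intro conjI ballI)
        show "A \<union> Z \<union> (B \<union> Z) = H" using AB Z by blast
        fix x y assume "x \<in> A \<union> Z - (B \<union> Z)" "y \<in> B \<union> Z - (A \<union> Z)"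
        then show "(x, y) \<notin> E" using separation_cross(1)[OF *(1) symE] by blast
      qed
      moreover have "A \<union> Z - (B \<union> Z) \<noteq> {}" "B \<union> Z - (A \<union> Z) \<noteq> {}" using ne ne' AB by blast+
      ultimately have "2 * s\<^sup>2 < card ((A \<union> Z) \<inter> (B \<union> Z))" by (rule conn)
      also have "(A \<union> Z) \<inter> (B \<union> Z) = (A \<inter> B) \<union> Z" by blast
      also have "card \<dots> \<le> card (A \<inter> B) + card Z" by (rule card_Un_le)
      finally show False using *(3) X(2) Z(2) ss by linarith
    qed
    then show "card (incident (H - Z) E (B - A)) \<le> 400 * s\<^sup>2 * card (B - A)"
      by (simp only: incident_empty card.empty)
  qed
qed

text \<open>
  Bollobas and Thomason; Komlos and Szemeredi. Any \<open>s\<close> vertices of the highly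
  connected subset can serve as branch vertices: each receives \<open>s - 1\<close> neighbours
  of its own, and linking these terminals in pairs amounts to at most \<open>s\<^sup>2\<close>
  terminals.
\<close>

theorem dense_topological_clique:
  fixes V :: "'a::linorder set"
  assumes fin: "finite V" and symE: "sym E" and irE: "irrefl E" and ne: "V \<noteq> {}" and s: "0 < s"
    and dense: "800 * s\<^sup>2 * card V \<le> card (E \<inter> V \<times> V)"
  shows "topological_clique V E s"
proof -
  have s2: "0 < s\<^sup>2" using s by simp
  have ss: "s \<le> s\<^sup>2" using s by (simp add: power2_eq_square)
  obtain H where HV: "H \<subseteq> V" and H1: "800 * s\<^sup>2 * card H \<le> card (E \<inter> H \<times> H) + 800 * s\<^sup>2 * (2 * s\<^sup>2)"
    and H2: "\<And>W. W \<subset> H \<Longrightarrow> 2 * (2 * s\<^sup>2) \<le> card W \<Longrightarrow>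
      card (E \<inter> W \<times> W) + 800 * s\<^sup>2 * (2 * s\<^sup>2) < 800 * s\<^sup>2 * card W"
    and H3: "\<And>v. v \<in> H \<Longrightarrow> 800 * s\<^sup>2 < 2 * card (E `` {v} \<inter> H)"
    and H4: "\<And>A B. separation H E A B \<Longrightarrow> A - B \<noteq> {} \<Longrightarrow> B - A \<noteq> {} \<Longrightarrow> 2 * s\<^sup>2 < card (A \<inter> B)"
    and H5: "2 * (2 * s\<^sup>2) < card H"
  proof (rule mader_dense_connected_subset[OF fin symE irE _ _ ne dense, of "2 * s\<^sup>2"])
    show "0 < 2 * s\<^sup>2" "4 * (2 * s\<^sup>2) \<le> 800 * s\<^sup>2" using s2 by auto
  qed (rule that)
  have fH: "finite H" using HV fin finite_subset by blast
  have "H \<noteq> {}" using H5 by auto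
  then obtain v where v: "v \<in> H" by blast
  have "card (E `` {v} \<inter> H) \<le> card H" using fH by (intro card_mono) auto
  then have big: "400 * s\<^sup>2 \<le> card H" using H3[OF v] by linarith
  then have "s \<le> card H" using ss by linarith
  then obtain Z where Z: "Z \<subseteq> H" "card Z = s" by (meson obtain_subset_with_card_n)
  have fZ: "finite Z" using Z fH finite_subset by blast
  define J where "J = {(z, z'). z \<in> Z \<and> z' \<in> Z \<and> z \<noteq> z'}"
  have JZ: "J \<subseteq> Z \<times> Z" by (auto simp: J_def)
  then have fJ: "finite J" using fZ finite_subset by blast
  have cJ: "card J \<le> s\<^sup>2"
    using card_mono[OF _ JZ] fZ Z by (simp add: card_cartesian_product power2_eq_square)
  have "\<exists>f. inj_on f J \<and> (\<forall>j\<in>J. f j \<in> E `` {fst j} \<inter> H - Z)"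
  proof (rule greedy_distinct_representatives[OF fJ])
    fix j assume "j \<in> J"
    then have j: "fst j \<in> H" using Z by (auto simp: J_def)
    have "card (E `` {fst j} \<inter> H) - card Z \<le> card (E `` {fst j} \<inter> H - Z)"
      using fZ by (rule diff_card_le_card_Diff)
    then show "finite (E `` {fst j} \<inter> H - Z) \<and> card J \<le> card (E `` {fst j} \<inter> H - Z)"
      using fH H3[OF j] Z(2) cJ ss by auto
  qed
  then obtain f where f: "inj_on f J" "\<And>j. j \<in> J \<Longrightarrow> f j \<in> E `` {fst j} \<inter> H - Z" by blast
  define X where "X = f ` J"
  have X: "X \<subseteq> H - Z" "card X \<le> s\<^sup>2"
    using f(2) cJ card_image_le[OF fJ, of f] by (auto simp: X_def)
  have "massed (400 * s\<^sup>2) (H - Z) E X"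
    by (rule massed_after_deleting[OF fH symE Z(1) _ X s H1 H2 H4 big]) (use Z in simp)
  then have lin: "linked (H - Z) E X"
    using massed_linked[of "H - Z" E "s\<^sup>2" X] fH symE irE X by blast
  define h where "h p = (f p, f (snd p, fst p))" for p
  have JJ: "p \<in> J" "(snd p, fst p) \<in> J" if "p \<in> pairs_of Z" for p
    using that by (auto simp: J_def pairs_of_def)
  have hdis: "ends (h p) \<inter> ends (h q) = {}" if "p \<in> pairs_of Z" "q \<in> pairs_of Z" "p \<noteq> q" for p q
  proof -
    have "f a \<noteq> f b" if "a \<in> {p, (snd p, fst p)}" "b \<in> {q, (snd q, fst q)}" for a b
    proof -
      have "a \<noteq> b" using that \<open>p \<in> pairs_of Z\<close> \<open>q \<in> pairs_of Z\<close> \<open>p \<noteq> q\<close>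
        by (auto simp: pairs_of_def)
      moreover have "a \<in> J" "b \<in> J"
        using that JJ[OF \<open>p \<in> pairs_of Z\<close>] JJ[OF \<open>q \<in> pairs_of Z\<close>] by auto
      ultimately show ?thesis using f(1) by (auto dest: inj_onD)
    qed
    then show ?thesis by (auto simp: h_def)
  qed
  have pr: "pairing (h ` pairs_of Z) X"
    unfolding pairing_def
  proof (intro conjI ballI impI)
    fix p' assume "p' \<in> h ` pairs_of Z"
    then obtain p where p: "p \<in> pairs_of Z" "p' = h p" by blast
    then show "ends p' \<subseteq> X" using JJ[OF p(1)] by (auto simp: h_def X_def)
    have "p \<noteq> (snd p, fst p)" using p(1) by (auto simp: pairs_of_def)
    then have "f p \<noteq> f (snd p, fst p)" using inj_onD[OF f(1) _ JJ(1)[OF p(1)] JJ(2)[OF p(1)]] by blast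
    then show "fst p' \<noteq> snd p'" using p(2) by (simp add: h_def)
  next
    fix p' q' assume "p' \<in> h ` pairs_of Z" "q' \<in> h ` pairs_of Z" "p' \<noteq> q'"
    then show "ends p' \<inter> ends q' = {}" using hdis by blast
  qed
  obtain C where "linkage (H - Z) E X (h ` pairs_of Z) C" using linkedD[OF lin pr] by blast
  note C = linkageD[OF this]
  have "routed V E Z (pairs_of Z) (\<lambda>p. C (h p))"
    unfolding routed_def
  proof (intro conjI ballI impI)
    fix p assume p: "p \<in> pairs_of Z"
    then have hp: "h p \<in> h ` pairs_of Z" by blast
    show "C (h p) \<subseteq> V - Z" using C(1)[OF hp] HV by blast
    have sub: "ends (h p) \<subseteq> C (h p)" using C(2)[OF hp] by blast
    have "(fst p, f p) \<in> E" "(snd p, f (snd p, fst p)) \<in> E"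
      using f(2)[OF JJ(1)[OF p]] f(2)[OF JJ(2)[OF p]] by auto
    then have "(fst p, f p) \<in> reach E (C (h p) \<union> ends p)"
      "(f (snd p, fst p), snd p) \<in> reach E (C (h p) \<union> ends p)"
      using sub symE by (auto simp: h_def sym_def intro!: reach_edge)
    moreover have "(f p, f (snd p, fst p)) \<in> reach E (C (h p) \<union> ends p)"
      using C(3)[OF hp] by (auto elim!: reach_mono simp: h_def)
    ultimately have "(fst p, snd p) \<in> reach E (C (h p) \<union> ends p)" using reach_trans by metis
    then show "p \<in> reach E (C (h p) \<union> ends p)" by simp
    fix q assume q: "q \<in> pairs_of Z" "p \<noteq> q"
    then have "h p \<noteq> h q" using hdis[OF p q] by auto
    then show "C (h p) \<inter> C (h q) = {}" using C(4)[OF hp] q by blast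
  qed
  then show ?thesis unfolding topological_clique_def using Z HV by blast
qed

section \<open>From routes to subdivisions\<close>

fun chain :: "'a rel \<Rightarrow> 'a \<Rightarrow> 'a list \<Rightarrow> 'a \<Rightarrow> bool" where
  "chain E x [] y \<longleftrightarrow> (x, y) \<in> E"
| "chain E x (w # ws) y \<longleftrightarrow> (x, w) \<in> E \<and> chain E w ws y"

lemma chain_append: "chain E x (us @ w # vs) y \<longleftrightarrow> chain E x us w \<and> chain E w vs y"
  by (induction us arbitrary: x) auto

text \<open>
  A shortest list of inner vertices is free of repetitions and avoids the ends.
\<close>

lemma reach_chain:
  assumes "(x, y) \<in> reach E C" "x \<noteq> y"
  shows "\<exists>ws. chain E x ws y \<and> set ws \<subseteq> C - {x, y} \<and> distinct ws"
proof -
  have "x = y \<or> (\<exists>ws. chain E x ws y \<and> set ws \<subseteq> C)"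
    using assms(1)
  proof (induction rule: reach_induct)
    case base
    then show ?case by simp
  next
    case (step y z)
    show ?case
    proof (cases "x = y")
      case True
      then have "chain E x [] z" using step by simp
      then show ?thesis by (metis empty_subsetI list.set(1))
    next
      case False
      then obtain ws where "chain E x ws y" "set ws \<subseteq> C" using step by blast
      then have "chain E x (ws @ [y]) z \<and> set (ws @ [y]) \<subseteq> C" using step by (simp add: chain_append)
      then show ?thesis by blast
    qed
  qed
  then obtain ws0 where "chain E x ws0 y \<and> set ws0 \<subseteq> C" using assms(2) by blast
  then obtain ws where ws: "chain E x ws y \<and> set ws \<subseteq> C"
    and min: "\<And>vs. chain E x vs y \<and> set vs \<subseteq> C \<Longrightarrow> length ws \<le> length vs"
    using ex_has_least_nat[of "\<lambda>ws. chain E x ws y \<and> set ws \<subseteq> C" ws0 length] by blast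
  have "distinct ws"
  proof (rule ccontr)
    assume "\<not> distinct ws"
    then obtain us w vs zs where d: "ws = us @ [w] @ vs @ [w] @ zs" using not_distinct_decomp by blast
    then have "chain E x (us @ w # zs) y \<and> set (us @ w # zs) \<subseteq> C"
      using ws by (auto simp: chain_append)
    then show False using min[of "us @ w # zs"] d by simp
  qed
  moreover have "x \<notin> set ws"
  proof
    assume "x \<in> set ws"
    then obtain us vs where d: "ws = us @ x # vs" by (meson split_list)
    then have "chain E x vs y \<and> set vs \<subseteq> C" using ws by (auto simp: chain_append)
    then show False using min[of vs] d by simp
  qed
  moreover have "y \<notin> set ws"
  proof
    assume "y \<in> set ws"
    then obtain us vs where d: "ws = us @ y # vs" by (meson split_list)
    then have "chain E x us y \<and> set us \<subseteq> C" using ws by (auto simp: chain_append)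
    then show False using min[of us] d by simp
  qed
  ultimately show ?thesis using ws by blast
qed

text \<open>
  Subdivide \<open>x y\<close> with the first inner vertex \<open>w\<close> and continue with
  the new edge \<open>w y\<close>. The last piece is an edge of \<open>E\<close>.
\<close>

lemma subdivide_along_chain:
  assumes "subdivision_pair K H" "(x, y) \<in> parcs H" "chain E x ws y" "sym E"
    "distinct ws" "set ws \<inter> pverts H = {}"
  shows "\<exists>H'. subdivision_pair K H' \<and> pverts H' = pverts H \<union> set ws \<and>
    parcs H' \<subseteq> parcs H - {(x, y), (y, x)} \<union> E \<and> parcs H - {(x, y), (y, x)} \<subseteq> parcs H'"
  using assms
proof (induction ws arbitrary: x H)
  case Nil
  have "(y, x) \<in> E" using Nil(3,4) by (auto simp: sym_def)
  then have "parcs H \<subseteq> parcs H - {(x, y), (y, x)} \<union> E" using Nil(3) by auto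
  then show ?case using Nil(1) by (intro exI[of _ H]) simp
next
  case (Cons w ws)
  let ?H = "subdivide H (x, y) w"
  have w: "w \<notin> pverts H" using Cons.prems by auto
  have sub: "subdivision_pair K ?H" using subdivision_pair_divide[OF Cons.prems(2) w Cons.prems(1)] .
  have H: "pverts ?H = pverts H \<union> {w}"
    "parcs ?H = (parcs H - {(x, y), (y, x)}) \<union> {(x, w), (w, x), (w, y), (y, w)}"
    by (auto simp: subdivide.simps)
  interpret H: pair_bidirected_digraph H using bidirected_digraphI_subdivision[OF Cons.prems(1)] .
  have nw: "(a, w) \<notin> parcs H" "(w, a) \<notin> parcs H" for a
    using w H.in_arcsD1 H.in_arcsD2 by blast+
  have wy: "(w, y) \<in> parcs ?H" using H by simp
  have ch: "chain E w ws y" and xw: "(x, w) \<in> E" using Cons.prems(3) by auto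
  have wx: "(w, x) \<in> E" using xw Cons.prems(4) by (auto simp: sym_def)
  have "set ws \<inter> pverts ?H = {}" "distinct ws" using Cons.prems H by auto
  from Cons.IH[OF sub wy ch Cons.prems(4) this(2,1)] obtain H' where
    H': "subdivision_pair K H'" "pverts H' = pverts ?H \<union> set ws"
    "parcs H' \<subseteq> parcs ?H - {(w, y), (y, w)} \<union> E" "parcs ?H - {(w, y), (y, w)} \<subseteq> parcs H'" by blast
  have "pverts H' = pverts H \<union> set (w # ws)" using H' H by auto
  moreover have "parcs H' \<subseteq> parcs H - {(x, y), (y, x)} \<union> E" using H'(3) xw wx unfolding H(2) by auto
  moreover have "parcs H - {(x, y), (y, x)} \<subseteq> parcs H'"
  proof
    fix e assume e: "e \<in> parcs H - {(x, y), (y, x)}"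
    then have "e \<noteq> (w, y)" "e \<noteq> (y, w)" using nw by auto
    then show "e \<in> parcs H'" using H'(4) H(2) e by auto
  qed
  ultimately show ?case using H'(1) by blast
qed

text \<open>
  Start from the complete graph on the branch vertices and subdivide its edges one by one. The
  arcs that are not yet arcs of \<open>G\<close> are those between pairs that remain to be
  treated.
\<close>

lemma topological_clique_subdivision:
  fixes G :: "'a::linorder pair_pre_digraph"
  assumes G: "pair_graph G" and tc: "topological_clique (pverts G) (parcs G) s"
  shows "contains_clique_subdivision G s"
proof -
  interpret G: pair_graph G by fact
  have symG: "sym (parcs G)" using G.arcs_symmetric by (auto intro: symI)
  obtain X I where X: "X \<subseteq> pverts G" "card X = s" and I: "routed (pverts G) (parcs G) X (pairs_of X) I"
    using tc unfolding topological_clique_def by blast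
  have fX: "finite X" using X G.pair_finite_verts finite_subset by blast
  define K where "K = \<lparr>pverts = X, parcs = {(u, v). (u, v) \<in> X \<times> X \<and> u \<noteq> v}\<rparr>"
  have cK: "complete_digraph s (with_proj K)" using fX X by (simp add: K_def complete_digraph_pair_def)
  interpret K: pair_graph K using cK by (rule pair_graphI_complete)
  define sy where "sy M = M \<union> M\<inverse>" for M :: "'a rel"
  have parcsK: "parcs K = sy (pairs_of X)" by (auto simp: K_def sy_def pairs_of_def)
  have fin: "finite (pairs_of X)"
    using finite_subset[of "pairs_of X" "X \<times> X"] fX by (auto simp: pairs_of_def)
  have "\<exists>H. subdivision_pair K H \<and> pverts H = X \<union> (pverts H \<inter> \<Union> (I ` M)) \<and>
      parcs H \<subseteq> parcs G \<union> sy (pairs_of X - M) \<and> sy (pairs_of X - M) \<subseteq> parcs H"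
    if "finite M" "M \<subseteq> pairs_of X" for M
    using that
  proof (induction M)
    case empty
    have "subdivision_pair K K" by (intro subdivision_pair_base) unfold_locales
    then show ?case by (intro exI[of _ K]) (simp add: parcsK, simp add: K_def)
  next
    case (insert p M)
    obtain H where H: "subdivision_pair K H" "pverts H = X \<union> (pverts H \<inter> \<Union> (I ` M))"
      "parcs H \<subseteq> parcs G \<union> sy (pairs_of X - M)" "sy (pairs_of X - M) \<subseteq> parcs H"
      using insert by auto
    obtain x y where p: "p = (x, y)" by (cases p)
    have pX: "(x, y) \<in> pairs_of X" using insert p by simp
    then have xy: "x \<noteq> y" "x \<in> X" "y \<in> X" by (auto simp: pairs_of_def)
    have Ip: "I p \<subseteq> pverts G - X" "(x, y) \<in> reach (parcs G) (I p \<union> {x, y})"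
      using I pX p by (auto simp: routed_def)
    obtain ws where ws: "chain (parcs G) x ws y" "set ws \<subseteq> I p" "distinct ws"
      using reach_chain[OF Ip(2) xy(1)] by blast
    have "I p \<inter> I q = {}" if "q \<in> M" for q
      using I insert that unfolding routed_def by (metis insert_subset subset_iff)
    then have "set ws \<inter> pverts H = {}" using H(2) ws(2) Ip(1) by blast
    moreover have "(x, y) \<in> parcs H" using H(4) insert p by (auto simp: sy_def)
    ultimately obtain H' where H': "subdivision_pair K H'" "pverts H' = pverts H \<union> set ws"
      "parcs H' \<subseteq> parcs H - {(x, y), (y, x)} \<union> parcs G" "parcs H - {(x, y), (y, x)} \<subseteq> parcs H'"
      using subdivide_along_chain[OF H(1) _ ws(1) symG ws(3)] by blast
    have "(y, x) \<notin> pairs_of X" using pX by (auto simp: pairs_of_def)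
    then have split: "sy (pairs_of X - insert p M) = sy (pairs_of X - M) - {(x, y), (y, x)}"
      using insert p by (auto simp: sy_def)
    have "pverts H' = X \<union> (pverts H' \<inter> \<Union> (I ` insert p M))" using H'(2) H(2) ws(2) by blast
    moreover have "parcs H' \<subseteq> parcs G \<union> sy (pairs_of X - insert p M)" using H'(3) H(3) unfolding split by blast
    moreover have "sy (pairs_of X - insert p M) \<subseteq> parcs H'" using H'(4) H(4) unfolding split by blast
    ultimately show ?case using H'(1) by blast
  qed
  from this[OF fin subset_refl] obtain H where H: "subdivision_pair K H"
    "pverts H = X \<union> (pverts H \<inter> \<Union> (I ` pairs_of X))" "parcs H \<subseteq> parcs G" by (auto simp: sy_def)
  have "\<Union> (I ` pairs_of X) \<subseteq> pverts G" using I by (auto simp: routed_def)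
  then have HG: "pverts H \<subseteq> pverts G" using H(2) X by blast
  interpret H: pair_bidirected_digraph H using bidirected_digraphI_subdivision[OF H(1)] .
  have "subgraph (with_proj H) (with_proj G)"
    using HG H(3) H.wf_digraph_axioms G.wf_digraph_axioms by (simp add: subgraph_def compatible_def)
  then show ?thesis using cK H(1) unfolding contains_clique_subdivision_def by blast
qed

section \<open>Independence numbers and near-cliques\<close>

definition indep :: "'a rel \<Rightarrow> 'a set \<Rightarrow> bool" where
  "indep E S \<longleftrightarrow> (\<forall>u\<in>S. \<forall>v\<in>S. (u, v) \<notin> E)"

definition alpha :: "'a rel \<Rightarrow> 'a set \<Rightarrow> nat" where
  "alpha E U = Max (card ` {S. S \<subseteq> U \<and> indep E S})"

lemma finite_indep: "finite U \<Longrightarrow> finite (card ` {S. S \<subseteq> U \<and> indep E S})"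
  by (rule finite_imageI, rule finite_subset[of _ "Pow U"]) auto

lemma indep_le_alpha: "finite U \<Longrightarrow> S \<subseteq> U \<Longrightarrow> indep E S \<Longrightarrow> card S \<le> alpha E U"
  unfolding alpha_def by (rule Max_ge[OF finite_indep]) auto

lemma alpha_witness:
  assumes "finite U"
  obtains S where "S \<subseteq> U" "indep E S" "card S = alpha E U"
proof -
  have "{} \<in> {S. S \<subseteq> U \<and> indep E S}" by (simp add: indep_def)
  then have "alpha E U \<in> card ` {S. S \<subseteq> U \<and> indep E S}"
    unfolding alpha_def by (intro Max_in finite_indep assms) blast
  then show thesis using that by auto
qed

lemma alpha_leI: "finite U \<Longrightarrow> (\<And>S. S \<subseteq> U \<Longrightarrow> indep E S \<Longrightarrow> card S \<le> k) \<Longrightarrow> alpha E U \<le> k"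
  by (metis alpha_witness)

lemma alpha_mono: "finite U \<Longrightarrow> W \<subseteq> U \<Longrightarrow> alpha E W \<le> alpha E U"
  by (meson alpha_leI finite_subset indep_le_alpha order_trans)

lemma alpha_pos:
  assumes "finite U" "irrefl E" "U \<noteq> {}"
  shows "0 < alpha E U"
proof -
  obtain u where "u \<in> U" using assms by blast
  then have "card {u} \<le> alpha E U"
    using assms by (intro indep_le_alpha) (auto simp: indep_def irrefl_def)
  then show ?thesis by simp
qed

lemma alpha_add_far:
  assumes "finite U" "sym E" "A \<union> B \<subseteq> U" "A \<inter> B = {}" "\<And>a b. a \<in> A \<Longrightarrow> b \<in> B \<Longrightarrow> (a, b) \<notin> E"
  shows "alpha E A + alpha E B \<le> alpha E U"
proof -
  have f: "finite A" "finite B" using assms finite_subset by blast+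
  obtain S where S: "S \<subseteq> A" "indep E S" "card S = alpha E A" using alpha_witness f by metis
  obtain T where T: "T \<subseteq> B" "indep E T" "card T = alpha E B" using alpha_witness f by metis
  have "(b, a) \<notin> E" if "a \<in> A" "b \<in> B" for a b using assms(2,5) that by (auto simp: sym_def)
  then have "indep E (S \<union> T)" using S T assms(5) unfolding indep_def by blast
  then have "card (S \<union> T) \<le> alpha E U" using S T assms by (intro indep_le_alpha) auto
  moreover have "card (S \<union> T) = card S + card T"
    using S T f assms(4) finite_subset by (intro card_Un_disjoint) blast+
  ultimately show ?thesis using S T by simp
qed

text \<open>
  As long as some vertex has too many non-neighbours, pass to these. Together with that
  vertex, an independent set among them grows by one, so this happens at most \<open>w\<close>
  times, and each time a factor \<open>q\<close> is lost.
\<close>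

lemma near_clique_subset:
  fixes q :: real
  assumes "finite W" "sym E" "irrefl E" "W \<noteq> {}" "alpha E W \<le> Suc w" "0 < q" "q \<le> 1"
  shows "\<exists>Y\<subseteq>W. q ^ w * card W \<le> card Y \<and> (\<forall>y\<in>Y. card {z \<in> Y. z \<noteq> y \<and> (y, z) \<notin> E} \<le> q * card Y)"
  using assms(1,4,5)
proof (induction w arbitrary: W)
  case 0
  have "(y, z) \<in> E" if "y \<in> W" "z \<in> W" "z \<noteq> y" for y z
  proof (rule ccontr)
    assume "(y, z) \<notin> E"
    then have "indep E {y, z}" using assms(2,3) by (auto simp: indep_def sym_def irrefl_def)
    then have "card {y, z} \<le> alpha E W" using that 0 by (intro indep_le_alpha) auto
    then show False using that 0 by simp
  qed
  then have emp: "{z \<in> W. z \<noteq> y \<and> (y, z) \<notin> E} = {}" if "y \<in> W" for y using that by blast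
  have "card {z \<in> W. z \<noteq> y \<and> (y, z) \<notin> E} \<le> q * card W" if "y \<in> W" for y
    unfolding emp[OF that] using assms(6) by simp
  then show ?case by (intro exI[of _ W]) simp
next
  case (Suc w)
  show ?case
  proof (cases "\<forall>y\<in>W. card {z \<in> W. z \<noteq> y \<and> (y, z) \<notin> E} \<le> q * card W")
    case True
    have "q ^ Suc w \<le> 1" using assms by (intro power_le_one) auto
    then have "q ^ Suc w * card W \<le> card W" by (simp add: mult_left_le_one_le assms(6) less_imp_le)
    then show ?thesis using True by blast
  next
    case False
    then obtain y where y: "y \<in> W" "q * card W < card {z \<in> W. z \<noteq> y \<and> (y, z) \<notin> E}" by auto
    define Z where "Z = {z \<in> W. z \<noteq> y \<and> (y, z) \<notin> E}"
    have ZW: "Z \<subseteq> W" "finite Z" using Suc.prems by (auto simp: Z_def)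
    have Zq: "q * card W < card Z" using y by (simp add: Z_def)
    have "0 \<le> q * card W" using assms(6) by simp
    then have "0 < real (card Z)" using Zq by linarith
    then have "Z \<noteq> {}" by auto
    moreover have "alpha E Z + alpha E {y} \<le> alpha E W"
    proof (rule alpha_add_far[OF Suc.prems(1) assms(2)])
      show "(a, b) \<notin> E" if "a \<in> Z" "b \<in> {y}" for a b
        using that assms(2) by (auto simp: Z_def sym_def)
    qed (use y in \<open>auto simp: Z_def\<close>)
    moreover have "0 < alpha E {y}" using alpha_pos[of "{y}"] assms(3) by auto
    ultimately obtain Y where Y: "Y \<subseteq> Z" "q ^ w * card Z \<le> card Y"
      "\<forall>y\<in>Y. card {z \<in> Y. z \<noteq> y \<and> (y, z) \<notin> E} \<le> q * card Y"
      using Suc.IH[of Z] ZW Suc.prems(3) by force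
    have "q ^ Suc w * card W = q ^ w * (q * card W)" by simp
    also have "\<dots> \<le> q ^ w * card Z" using Zq assms(6) by (intro mult_left_mono) auto
    finally show ?thesis using Y ZW by (meson order_trans)
  qed
qed

text \<open>
  Greedily: as long as half of \<open>Y\<close> is left, some vertex is nonadjacent to at most
  \<open>2 q s\<close> of the \<open>s\<close> vertices that have been chosen, and \<open>q
  s\<^sup>2 + 2 q s \<le> q (s + 1)\<^sup>2\<close>.
\<close>

lemma few_nonadjacent_pairs:
  fixes Y :: "'a::linorder set" and q :: real
  assumes "finite Y" "sym E" "0 \<le> q" "\<And>y. y \<in> Y \<Longrightarrow> card {z \<in> Y. z \<noteq> y \<and> (y, z) \<notin> E} \<le> q * card Y"
    and "2 * s \<le> card Y"
  shows "\<exists>X\<subseteq>Y. card X = s \<and> card {p \<in> pairs_of X. p \<notin> E} \<le> q * (real s)\<^sup>2"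
  using assms(5)
proof (induction s)
  case 0
  show ?case by (intro exI[of _ "{}"]) (simp add: pairs_of_def)
next
  case (Suc s)
  then obtain X where X: "X \<subseteq> Y" "card X = s" "card {p \<in> pairs_of X. p \<notin> E} \<le> q * (real s)\<^sup>2" by auto
  have fX: "finite X" using X assms(1) finite_subset by blast
  define c where "c y = card {x \<in> X. (x, y) \<notin> E}" for y
  have cY: "card (Y - X) = card Y - s" using X fX by (simp add: card_Diff_subset)
  have "\<exists>y\<in>Y - X. c y \<le> 2 * q * s"
  proof (rule ccontr)
    assume no: "\<not> ?thesis"
    have ge: "2 * real s + 2 \<le> card Y" using Suc.prems by simp
    have "0 < card (Y - X)" using cY Suc.prems by simp
    then have "Y - X \<noteq> {}" by (metis card.empty less_irrefl)
    then have "(\<Sum>y\<in>Y - X. 2 * q * s) < (\<Sum>y\<in>Y - X. real (c y))"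
      using no assms(1) by (intro sum_strict_mono) force+
    also have "\<dots> = (\<Sum>y\<in>Y - X. \<Sum>x\<in>X. if (x, y) \<notin> E then 1 else 0)"
      using fX by (simp add: c_def sum.If_cases Int_def flip: of_nat_sum)
    also have "\<dots> = (\<Sum>x\<in>X. \<Sum>y\<in>Y - X. if (x, y) \<notin> E then 1 else 0)" by (rule sum.swap)
    also have "\<dots> = (\<Sum>x\<in>X. real (card {y \<in> Y - X. (x, y) \<notin> E}))"
      using assms(1) by (simp add: sum.If_cases Int_def flip: of_nat_sum)
    also have "\<dots> \<le> (\<Sum>x\<in>X. q * card Y)"
    proof (intro sum_mono)
      fix x assume x: "x \<in> X"
      have "card {y \<in> Y - X. (x, y) \<notin> E} \<le> card {z \<in> Y. z \<noteq> x \<and> (x, z) \<notin> E}"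
        using assms(1) x by (intro card_mono) auto
      then show "real (card {y \<in> Y - X. (x, y) \<notin> E}) \<le> q * card Y" using assms(4)[of x] x X by fastforce
    qed
    also have "\<dots> = s * (q * card Y)" using X by simp
    finally have a: "(real (card Y) - s) * (2 * q * s) < s * (q * card Y)" using cY ge by (simp add: of_nat_diff)
    have "real (card Y) * (q * s) \<le> 2 * (real (card Y) - s) * (q * s)"
      using ge assms(3) by (intro mult_right_mono) auto
    then show False using a by (simp add: algebra_simps)
  qed
  then obtain y where y: "y \<in> Y - X" "c y \<le> 2 * q * s" by blast
  have "{p \<in> pairs_of (insert y X). p \<notin> E} \<subseteq> {p \<in> pairs_of X. p \<notin> E} \<union>
      (\<lambda>x. if x < y then (x, y) else (y, x)) ` {x \<in> X. (x, y) \<notin> E}"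
    using assms(2) by (auto simp: pairs_of_def sym_def image_iff)
  then have "card {p \<in> pairs_of (insert y X). p \<notin> E} \<le> card ({p \<in> pairs_of X. p \<notin> E} \<union>
      (\<lambda>x. if x < y then (x, y) else (y, x)) ` {x \<in> X. (x, y) \<notin> E})"
    using fX by (intro card_mono) (auto simp: pairs_of_def intro: finite_subset[of _ "X \<times> X"])
  also have "\<dots> \<le> card {p \<in> pairs_of X. p \<notin> E} + c y"
    unfolding c_def
    by (rule order_trans[OF card_Un_le], intro add_left_mono card_image_le) (use fX in simp)
  finally have "card {p \<in> pairs_of (insert y X). p \<notin> E} \<le> q * (real s)\<^sup>2 + 2 * q * s"
    using X(3) y(2) by linarith
  also have "\<dots> \<le> q * (real (Suc s))\<^sup>2" using assms(3) by (simp add: power2_eq_square algebra_simps)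
  finally show ?case using X y fX by (intro exI[of _ "insert y X"]) auto
qed

lemma sum_Pow_power: "finite I \<Longrightarrow> (\<Sum>T\<in>Pow I. (y::real) ^ card T) = (1 + y) ^ card I"
proof (induction I rule: finite_induct)
  case empty
  then show ?case by simp
next
  case (insert x I)
  have inj: "inj_on (insert x) (Pow I)" using insert(2) by (auto simp: inj_on_def)
  have "Pow I \<inter> insert x ` Pow I = {}" using insert(2) by auto
  then have "(\<Sum>T\<in>Pow (insert x I). y ^ card T) = (\<Sum>T\<in>Pow I. y ^ card T) + (\<Sum>T\<in>insert x ` Pow I. y ^ card T)"
    using insert(1) by (simp add: Pow_insert sum.union_disjoint)
  also have "(\<Sum>T\<in>insert x ` Pow I. y ^ card T) = (\<Sum>T\<in>Pow I. y ^ card (insert x T))"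
    by (simp add: sum.reindex[OF inj])
  also have "\<dots> = (\<Sum>T\<in>Pow I. y * y ^ card T)"
  proof (rule sum.cong[OF refl])
    fix T assume "T \<in> Pow I"
    then have "x \<notin> T" "finite T" using insert finite_subset by auto
    then show "y ^ card (insert x T) = y * y ^ card T" by simp
  qed
  finally show ?case using insert by (simp add: sum_distrib_left[symmetric] algebra_simps)
qed

text \<open>
  A subset of size at most \<open>h\<close> has weight at least \<open>\<kappa> powr (-
  h)\<close> when every element is given the weight \<open>1 / \<kappa>\<close>, and the total
  weight of all subsets is \<open>(1 + 1 / \<kappa>) ^ card I\<close>.
\<close>

lemma card_small_subsets:
  assumes "finite I" "1 \<le> (\<kappa>::real)"
  shows "card {T. T \<subseteq> I \<and> real (card T) \<le> h} \<le> \<kappa> powr h * exp (card I / \<kappa>)"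
proof -
  let ?S = "{T. T \<subseteq> I \<and> real (card T) \<le> h}"
  have "card ?S * \<kappa> powr (- h) = (\<Sum>T\<in>?S. \<kappa> powr (- h))" by simp
  also have "\<dots> \<le> (\<Sum>T\<in>?S. (1 / \<kappa>) ^ card T)"
  proof (intro sum_mono)
    fix T assume "T \<in> ?S"
    then have "\<kappa> powr (- h) \<le> \<kappa> powr (- real (card T))" using assms(2) by (intro powr_mono) auto
    also have "\<dots> = (1 / \<kappa>) ^ card T" using assms(2) by (simp add: powr_minus powr_realpow power_divide divide_inverse power_inverse)
    finally show "\<kappa> powr (- h) \<le> (1 / \<kappa>) ^ card T" .
  qed
  also have "\<dots> \<le> (\<Sum>T\<in>Pow I. (1 / \<kappa>) ^ card T)"
    using assms by (intro sum_mono2) auto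
  also have "\<dots> = (1 + 1 / \<kappa>) ^ card I" using assms by (intro sum_Pow_power)
  also have "\<dots> \<le> exp (1 / \<kappa>) ^ card I" using assms by (intro power_mono) auto
  also have "\<dots> = exp (card I / \<kappa>)" by (simp add: exp_of_nat_mult[symmetric])
  finally have *: "card ?S * \<kappa> powr (- h) \<le> exp (card I / \<kappa>)" .
  have "\<kappa> powr (- h) * \<kappa> powr h = 1" using assms(2) by (simp add: powr_add[symmetric])
  then have "card ?S = card ?S * \<kappa> powr (- h) * \<kappa> powr h" by (simp add: mult.assoc)
  also have "\<dots> \<le> exp (card I / \<kappa>) * \<kappa> powr h" using * by (intro mult_right_mono) auto
  finally show ?thesis by (simp add: mult.commute)
qed

lemma pigeonhole_fibre:
  assumes "finite R" "finite S" "f ` R \<subseteq> S" "R \<noteq> {}"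
  shows "\<exists>t\<in>S. card R \<le> card S * card {v \<in> R. f v = t}"
proof (rule ccontr)
  assume no: "\<not> ?thesis"
  have S: "S \<noteq> {}" using assms by auto
  have "card R = (\<Sum>t\<in>S. card {v \<in> R. f v = t})"
    using sum.group[OF assms(1,2,3), of "\<lambda>_. 1::nat"] by simp
  then have "card S * card R = (\<Sum>t\<in>S. card S * card {v \<in> R. f v = t})" by (simp add: sum_distrib_left)
  also have "\<dots> < (\<Sum>t\<in>S. card R)" using no S assms(2) by (intro sum_strict_mono) auto
  finally show False by simp
qed

text \<open>
  Let \<open>I\<close> be a maximum independent set. By double counting, half of the vertices
  have at most \<open>h\<close> neighbours in \<open>I\<close>, and by the pigeonhole
  principle many of these vertices have the same set \<open>T\<close> of neighbours in
  \<open>I\<close>. An independent set \<open>J\<close> among them can replace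
  \<open>T\<close> in \<open>I\<close>, so it is not larger than \<open>T\<close>.
\<close>

lemma erdos_szemeredi_subset:
  fixes h d \<kappa> :: real
  assumes fin: "finite R" and symE: "sym E" and irE: "irrefl E" and ne: "R \<noteq> {}"
    and deg: "\<And>v. v \<in> R \<Longrightarrow> card (E `` {v} \<inter> R) \<le> d" and kappa: "1 \<le> \<kappa>"
    and h: "1 \<le> h" "2 * alpha E R * d \<le> h * card R"
  obtains W where "W \<subseteq> R" "W \<noteq> {}" "alpha E W \<le> h"
    "card R \<le> 2 * (\<kappa> powr h * exp (alpha E R / \<kappa>)) * card W"
proof -
  obtain I where I: "I \<subseteq> R" "indep E I" "card I = alpha E R" using alpha_witness fin by metis
  have fI: "finite I" using I fin finite_subset by blast
  (* A vertex of I is its own trace; with the empty set instead, the exchange would fail for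
     it. *)
  define S where "S v = (if v \<in> I then {v} else E `` {v} \<inter> I)" for v
  define Good where "Good = {v \<in> R. real (card (S v)) \<le> h}"
  have "card (R - Good) * h \<le> (\<Sum>v\<in>R - Good. real (card (E `` {v} \<inter> I)))"
  proof (rule sum_bounded_below)
    fix v assume "v \<in> R - Good"
    then show "h \<le> real (card (E `` {v} \<inter> I))"
      using h(1) by (auto simp: Good_def S_def split: if_splits)
  qed
  also have "\<dots> \<le> (\<Sum>v\<in>R. real (card (E `` {v} \<inter> I)))" using fin by (intro sum_mono2) auto
  also have "\<dots> = real (card (SIGMA v:R. E `` {v} \<inter> I))"
    using fin fI by (subst card_SigmaI) auto
  also have "card (SIGMA v:R. E `` {v} \<inter> I) = card (SIGMA u:I. E `` {u} \<inter> R)"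
    by (rule bij_betw_same_card[of prod.swap], rule bij_betwI[where g = prod.swap])
      (use symE in \<open>auto simp: sym_def\<close>)
  also have "real \<dots> = (\<Sum>u\<in>I. real (card (E `` {u} \<inter> R)))" using fin fI by (subst card_SigmaI) auto
  also have "\<dots> \<le> (\<Sum>u\<in>I. d)" using deg I(1) by (intro sum_mono) auto
  also have "\<dots> = alpha E R * d" using I by simp
  finally have "2 * (card (R - Good) * h) \<le> h * card R" using h(2) by linarith
  then have "h * (2 * card (R - Good)) \<le> h * card R" by (simp add: algebra_simps)
  then have "2 * real (card (R - Good)) \<le> card R" using h(1) by (simp add: mult_le_cancel_left)
  moreover have "card (R - Good) = card R - card Good"
    using fin by (intro card_Diff_subset) (auto simp: Good_def)
  moreover have "card Good \<le> card R" using fin by (intro card_mono) (auto simp: Good_def)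
  ultimately have half: "card R \<le> 2 * card Good" by linarith
  have "0 < card R" using ne fin by (simp add: card_gt_0_iff)
  then have "Good \<noteq> {}" using half by auto
  let ?T = "{T. T \<subseteq> I \<and> real (card T) \<le> h}"
  have fT: "finite ?T" using fI by (intro finite_subset[of ?T "Pow I"]) auto
  have "S ` Good \<subseteq> ?T" by (auto simp: Good_def S_def)
  from pigeonhole_fibre[OF _ fT this \<open>Good \<noteq> {}\<close>] obtain T
    where T: "T \<subseteq> I" "real (card T) \<le> h" "card Good \<le> card ?T * card {v \<in> Good. S v = T}"
    using fin by (auto simp: Good_def)
  define W where "W = {v \<in> Good. S v = T}"
  have WR: "W \<subseteq> R" by (auto simp: W_def Good_def)
  have fW: "finite W" using WR fin finite_subset by blast
  have "alpha E W \<le> card T"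
  proof (rule alpha_leI[OF fW])
    fix J assume J: "J \<subseteq> W" "indep E J"
    have fJ: "finite J" using J fW finite_subset by blast
    have far: "v \<notin> I - T" "(v, u) \<notin> E" "(u, v) \<notin> E" if "v \<in> J" "u \<in> I - T" for u v
    proof -
      have Sv: "S v = T" using that J by (auto simp: W_def)
      show v: "v \<notin> I - T" using Sv by (auto simp: S_def split: if_splits)
      show "(v, u) \<notin> E"
      proof (cases "v \<in> I")
        case True
        then show ?thesis using I(2) that(2) by (auto simp: indep_def)
      next
        case False
        then show ?thesis using Sv that(2) by (auto simp: S_def)
      qed
      then show "(u, v) \<notin> E" using symE by (auto simp: sym_def)
    qed
    have "indep E ((I - T) \<union> J)" using I(2) J(2) far unfolding indep_def by blast
    then have "card ((I - T) \<union> J) \<le> alpha E R" using I J WR fin by (intro indep_le_alpha) auto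
    moreover have "(I - T) \<inter> J = {}" using far(1) by blast
    then have "card ((I - T) \<union> J) = card (I - T) + card J" using fI fJ by (simp add: card_Un_disjoint)
    moreover have "card (I - T) = card I - card T" using T(1) finite_subset[OF T(1) fI] by (simp add: card_Diff_subset)
    moreover have "card T \<le> card I" using T fI by (simp add: card_mono)
    ultimately show "card J \<le> card T" using I(3) by linarith
  qed
  then have "real (alpha E W) \<le> h" using T(2) by linarith
  moreover have "W \<noteq> {}"
  proof
    assume "W = {}"
    then have "card Good = 0" using T(3) unfolding W_def[symmetric] by simp
    moreover have "finite Good" using fin by (simp add: Good_def)
    ultimately show False using \<open>Good \<noteq> {}\<close> by simp
  qed
  moreover have "card R \<le> 2 * (\<kappa> powr h * exp (alpha E R / \<kappa>)) * card W"
  proof -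
    have "real (card R) \<le> 2 * real (card Good)" using half by linarith
    also have "\<dots> \<le> 2 * (real (card ?T) * card W)"
    proof -
      have "real (card Good) \<le> real (card ?T) * real (card W)"
        using T(3) unfolding W_def[symmetric] of_nat_mult[symmetric] of_nat_le_iff .
      then show ?thesis by simp
    qed
    also have "\<dots> \<le> 2 * ((\<kappa> powr h * exp (card I / \<kappa>)) * card W)"
      using card_small_subsets[OF fI kappa, of h] by (intro mult_left_mono mult_right_mono) auto
    finally show ?thesis using I(3) by simp
  qed
  ultimately show thesis using that[of W] WR by blast
qed

text \<open>
  The weights \<open>1 / ((i + 1) (i + 2))\<close> sum to 1. They decay slowly enough for the
  loss to be negligible against the geometric growth in \<open>i\<close> of the gain.
\<close>

lemma weighted_pigeonhole:
  assumes "finite S" "S \<noteq> {}"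
  shows "\<exists>i::nat. real (card S) \<le> (real i + 1) * (real i + 2) * card {v \<in> S. f v = i}"
proof (rule ccontr)
  assume no: "\<not> ?thesis"
  define m where "m = Max (f ` S)"
  have tel: "(\<Sum>i\<le>m. 1 / ((real i + 1) * (real i + 2))) = 1 - 1 / (real m + 2)" for m
  proof (induction m)
    case (Suc m)
    have "1 - 1 / (real m + 2) + 1 / ((real (Suc m) + 1) * (real (Suc m) + 2)) = 1 - 1 / (real (Suc m) + 2)"
      by (simp add: divide_simps) (simp add: algebra_simps)
    then show ?case by (simp only: sum.atMost_Suc Suc.IH)
  qed simp
  have "f ` S \<subseteq> {..m}" using assms by (auto simp: m_def)
  then have "real (card S) = (\<Sum>i\<le>m. real (card {v \<in> S. f v = i}))"
    using sum.group[OF assms(1) finite_atMost, of f m "\<lambda>_. 1::real"] by simp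
  also have "\<dots> \<le> (\<Sum>i\<le>m. card S * (1 / ((real i + 1) * (real i + 2))))"
  proof (intro sum_mono)
    fix i
    have "0 < (real i + 1) * (real i + 2)" by (intro mult_pos_pos) auto
    moreover have "(real i + 1) * (real i + 2) * card {v \<in> S. f v = i} \<le> card S" using no by (meson linorder_not_le less_imp_le)
    ultimately have "real (card {v \<in> S. f v = i}) \<le> card S / ((real i + 1) * (real i + 2))"
      by (simp only: pos_le_divide_eq mult.commute)
    then show "real (card {v \<in> S. f v = i}) \<le> card S * (1 / ((real i + 1) * (real i + 2)))" by simp
  qed
  also have "\<dots> = card S * (1 - 1 / (real m + 2))" by (simp only: sum_distrib_left[symmetric] tel)
  also have "\<dots> < card S" using assms by (simp add: card_gt_0_iff field_simps)
  finally show False by simp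
qed

section \<open>Expansion of extremal vertex sets\<close>

text \<open>
  If \<open>y\<close> is at most \<open>3 / 4\<close>, then \<open>y = y powr (1 + \<tau>) * y
  powr (- \<tau>)\<close>, and the second factor is at least \<open>1 + \<tau> (1 -
  y)\<close>; otherwise \<open>y\<close> exceeds \<open>x\<close> by far.
\<close>

lemma powr_Bernoulli_growth:
  fixes x y \<tau> :: real
  assumes "0 < x" "x \<le> 1 / 2" "0 < \<tau>" "\<tau> \<le> 1" "0 < y" "x \<le> y powr (1 + \<tau>)"
  shows "x * (1 + \<tau> / 4) \<le> y"
proof (cases "y \<le> 3 / 4")
  case True
  have "ln y \<le> y - 1" using assms(5) ln_le_minus_one by blast
  then have "1 / 4 \<le> - ln y" using True by linarith
  then have "\<tau> * (1 / 4) \<le> \<tau> * (- ln y)" using assms(3) by (intro mult_left_mono) auto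
  then have "1 + \<tau> / 4 \<le> 1 + (- \<tau>) * ln y" by simp
  also have "\<dots> \<le> exp ((- \<tau>) * ln y)" by (rule exp_ge_add_one_self)
  also have "\<dots> = y powr (- \<tau>)" using assms(5) by (simp add: powr_def)
  finally have "x * (1 + \<tau> / 4) \<le> y powr (1 + \<tau>) * y powr (- \<tau>)"
    using assms by (intro mult_mono) auto
  also have "\<dots> = y" using assms(5) by (simp add: powr_add[symmetric])
  finally show ?thesis .
next
  case False
  have "x * (1 + \<tau> / 4) \<le> 1 / 2 * (1 + 1 / 4)" using assms by (intro mult_mono) auto
  then show ?thesis using False by simp
qed

text \<open>
  Extremality says that independence numbers of subsets are larger than proportional: the part
  \<open>x\<close> of the vertices carries at least the part \<open>x powr (1 / (1 +
  \<tau>))\<close> of the independence number.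
\<close>

locale extremal_subset =
  fixes U :: "'a::linorder set" and E and \<tau> :: real
  assumes finU: "finite U" and symE: "sym E" and irE: "irrefl E" and ne: "U \<noteq> {}"
    and tau: "0 < \<tau>" "\<tau> \<le> 1"
    and extremal: "\<And>A. A \<subseteq> U \<Longrightarrow> A \<noteq> {} \<Longrightarrow>
      card A / alpha E A powr (1 + \<tau>) \<le> card U / alpha E U powr (1 + \<tau>)"
begin

abbreviation N where "N \<equiv> real (card U)"
abbreviation b where "b \<equiv> real (alpha E U)"

lemma N_pos: "0 < N" using ne finU by (simp add: card_gt_0_iff)
lemma b_pos: "0 < b" using alpha_pos[OF finU irE ne] by simp

lemma card_le_ratio:
  assumes "A \<subseteq> U" "A \<noteq> {}"
  shows "card A \<le> N * (alpha E A / b) powr (1 + \<tau>)"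
proof -
  have a: "0 < real (alpha E A)" using alpha_pos[OF _ irE assms(2)] assms(1) finU finite_subset by auto
  have "card A / alpha E A powr (1 + \<tau>) \<le> N / b powr (1 + \<tau>)" using extremal[OF assms] .
  then have "card A \<le> N / b powr (1 + \<tau>) * alpha E A powr (1 + \<tau>)"
    using a by (simp add: pos_divide_le_eq)
  also have "\<dots> = N * (alpha E A / b) powr (1 + \<tau>)" using a b_pos by (simp add: powr_divide)
  finally show ?thesis .
qed

text \<open>
  The vertices outside the closed neighbourhood of \<open>A\<close> have independence number
  at most \<open>alpha E U - alpha E A\<close>, so by extremality they are few.
\<close>

lemma closed_neighbourhood_large:
  assumes "A \<subseteq> U" "A \<noteq> {}"
  shows "N * (alpha E A / b) \<le> card (A \<union> (E `` A \<inter> U))"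
proof -
  define B where "B = U - (A \<union> (E `` A \<inter> U))"
  have "alpha E A + alpha E B \<le> alpha E U"
    using assms(1) by (intro alpha_add_far[OF finU symE]) (auto simp: B_def)
  then have ab: "alpha E A / b + alpha E B / b \<le> 1"
    using b_pos by (simp add: add_divide_distrib[symmetric] del: of_nat_add)
  have a0: "0 \<le> alpha E A / b" "0 \<le> alpha E B / b" by auto
  have "card B \<le> N * (alpha E B / b)"
  proof (cases "B = {}")
    case False
    have "card B \<le> N * (alpha E B / b) powr (1 + \<tau>)" using False by (intro card_le_ratio) (auto simp: B_def)
    also have "\<dots> \<le> N * (alpha E B / b) powr 1"
    proof -
      have "alpha E B / b \<le> 1" using ab a0 by linarith
      then show ?thesis using tau a0 by (intro mult_left_mono powr_mono') auto
    qed
    finally show ?thesis by simp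
  qed (use N_pos in auto)
  also have "\<dots> \<le> N * (1 - alpha E A / b)" using ab N_pos by (intro mult_left_mono) auto
  finally have "real (card B) \<le> N - N * (alpha E A / b)" by (simp add: algebra_simps)
  moreover have "card U = card (A \<union> (E `` A \<inter> U)) + card B"
  proof -
    have C: "A \<union> (E `` A \<inter> U) \<subseteq> U" using assms(1) by blast
    show ?thesis unfolding B_def
      using card_Diff_subset[OF finite_subset[OF C finU] C] card_mono[OF finU C] by linarith
  qed
  ultimately show ?thesis by simp
qed

lemma expansion:
  assumes "A \<subseteq> U" "A \<noteq> {}" "2 * card A \<le> card U"
  shows "\<tau> / 4 * card A \<le> card (E `` A \<inter> U - A)"
proof -
  have fA: "finite A" using assms finU finite_subset by blast
  have A0: "0 < real (card A)" using assms fA by (simp add: card_gt_0_iff)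
  have a: "0 < real (alpha E A)" using alpha_pos[OF fA irE assms(2)] by simp
  define x where "x = card A / N"
  have x: "0 < x" "x \<le> 1 / 2" using A0 N_pos assms(3) by (auto simp: x_def field_simps)
  have "x \<le> (alpha E A / b) powr (1 + \<tau>)"
    using card_le_ratio[OF assms(1,2)] N_pos by (simp add: x_def field_simps)
  then have "x * (1 + \<tau> / 4) \<le> alpha E A / b"
    using powr_Bernoulli_growth[OF x tau] a b_pos by simp
  then have "N * (x * (1 + \<tau> / 4)) \<le> N * (alpha E A / b)" using N_pos by (intro mult_left_mono) auto
  also have "\<dots> \<le> card (A \<union> (E `` A \<inter> U))" using closed_neighbourhood_large[OF assms(1,2)] .
  also have "A \<union> (E `` A \<inter> U) = A \<union> (E `` A \<inter> U - A)" by blast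
  also have "card \<dots> = card A + card (E `` A \<inter> U - A)" using fA finU by (intro card_Un_disjoint) auto
  also have "N * (x * (1 + \<tau> / 4)) = card A * (1 + \<tau> / 4)" using N_pos by (simp add: x_def)
  finally show ?thesis by (simp add: algebra_simps)
qed

lemma degree_lower:
  assumes "v \<in> U"
  shows "N / b \<le> card (E `` {v} \<inter> U) + 1"
proof -
  have "1 \<le> alpha E {v}" using alpha_pos[of "{v}"] irE by (simp add: Suc_le_eq)
  then have "N * (1 / b) \<le> N * (alpha E {v} / b)" using b_pos by (intro mult_left_mono divide_right_mono) auto
  also have "\<dots> \<le> card ({v} \<union> (E `` {v} \<inter> U))" using assms closed_neighbourhood_large[of "{v}"] by auto
  also have "\<dots> \<le> card (E `` {v} \<inter> U) + 1"
    using card_Un_le[of "{v}" "E `` {v} \<inter> U"] by simp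
  finally show ?thesis by simp
qed

text \<open>
  In \<open>U\<close> every set that contains some \<open>x \<in> X\<close> gains \<open>2
  g\<close> vertices, where \<open>g = \<tau> N / (16 k)\<close>: small sets because of the
  degree of \<open>x\<close>, large ones by expansion. So \<open>g\<close> vertices may be
  deleted. Routes then have at most \<open>20 k / \<tau>\<close> vertices, which leaves room
  for \<open>\<tau>\<^sup>2 N / (640 k\<^sup>2)\<close> of them.
\<close>

lemma topological_clique_on:
  fixes k :: real
  assumes XU: "X \<subseteq> U" and deg: "\<And>x. x \<in> X \<Longrightarrow> N / k \<le> card (E `` {x} \<inter> U)" and k: "1 \<le> k"
    and small: "card X \<le> \<tau> * N / (32 * k)"
    and few: "card {p \<in> pairs_of X. p \<notin> E} \<le> \<tau>\<^sup>2 * N / (640 * k\<^sup>2)"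
  shows "topological_clique U E (card X)"
proof -
  have fX: "finite X" using XU finU finite_subset by blast
  define g where "g = \<tau> * N / (16 * k)"
  have g0: "0 < g" using tau N_pos k by (simp add: g_def)
  define M where "M = {p \<in> pairs_of X. p \<notin> E}"
  have fM: "finite M" using fX by (auto simp: M_def pairs_of_def intro: finite_subset[of _ "X \<times> X"])
  have gN: "2 * g \<le> N / (4 * k)"
  proof -
    have "\<tau> * N \<le> 1 * N" using tau N_pos by (intro mult_right_mono) auto
    then show ?thesis using k by (simp add: g_def field_simps)
  qed
  have "\<exists>I. routed U E X M I"
  proof (rule greedy_routes[OF finU symE XU fM, where r = "nat \<lceil>8 * k / \<tau>\<rceil>" and g = "nat \<lceil>g\<rceil>" and b = "nat \<lfloor>g\<rfloor>"])
    show "ends p \<subseteq> X" if "p \<in> M" for p using that by (auto simp: M_def pairs_of_def)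
  next
    fix Q z A assume Q: "Q \<subseteq> U" "card Q \<le> nat \<lfloor>g\<rfloor>" and z: "z \<in> X - Q" "z \<in> A"
      and A: "A \<subseteq> U - Q" "2 * card A \<le> card U"
    have Qg: "real (card Q) \<le> g" using Q(2) g0 by linarith
    have fQ: "finite Q" "finite A" using Q A finU finite_subset by blast+
    have sub: "real (card W) - card Q \<le> card (W - Q)" for W
      using diff_card_le_card_Diff[OF fQ(1), of W] by linarith
    have "g \<le> card (E `` A \<inter> U - A - Q)"
    proof (cases "N / (2 * k) \<le> card A")
      case True
      have "2 * g = \<tau> / 4 * (N / (2 * k))" by (simp add: g_def)
      also have "\<dots> \<le> \<tau> / 4 * card A" using True tau by (intro mult_left_mono) auto
      also have "\<dots> \<le> card (E `` A \<inter> U - A)" using A z by (intro expansion) auto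
      finally show ?thesis using sub[of "E `` A \<inter> U - A"] Qg by linarith
    next
      case False
      have "N / k \<le> card (E `` {z} \<inter> U)" using deg z by blast
      also have "\<dots> \<le> card (A \<union> (E `` A \<inter> U - A))" using fQ finU z by (intro of_nat_mono card_mono) auto
      also have "\<dots> \<le> card A + card (E `` A \<inter> U - A)" using card_Un_le of_nat_mono by blast
      finally have "N / k - card A \<le> card (E `` A \<inter> U - A)" by simp
      moreover have "N / k = 2 * (N / (2 * k))" by simp
      moreover have "N / (4 * k) \<le> N / (2 * k)" using N_pos k by (simp add: field_simps)
      ultimately show ?thesis using sub[of "E `` A \<inter> U - A"] Qg gN False by linarith
    qed
    then show "nat \<lceil>g\<rceil> \<le> card (E `` A \<inter> U - A - Q)" by linarith
  next
    have "N = 2 * (8 * k / \<tau>) * g" using tau k by (simp add: g_def)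
    also have "0 \<le> 8 * k / \<tau>" using tau k by simp
    then have "2 * (8 * k / \<tau>) * g \<le> 2 * real (nat \<lceil>8 * k / \<tau>\<rceil>) * real (nat \<lceil>g\<rceil>)"
      using g0 by (intro mult_mono) (auto intro: real_nat_ceiling_ge)
    finally show "card U \<le> 2 * nat \<lceil>8 * k / \<tau>\<rceil> * nat \<lceil>g\<rceil>"
      by (metis of_nat_le_iff of_nat_mult of_nat_numeral)
  next
    have kt: "1 \<le> k / \<tau>" using k tau by (simp add: field_simps)
    have "real (2 * nat \<lceil>8 * k / \<tau>\<rceil> + 2) \<le> 2 * (8 * k / \<tau> + 1) + 2" using kt by (simp add: of_nat_nat) linarith
    also have "\<dots> \<le> 20 * (k / \<tau>)" using kt by simp
    finally have "real (card M) * real (2 * nat \<lceil>8 * k / \<tau>\<rceil> + 2) \<le> \<tau>\<^sup>2 * N / (640 * k\<^sup>2) * (20 * (k / \<tau>))"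
      using few tau N_pos by (intro mult_mono) (auto simp: M_def)
    also have "\<dots> = \<tau> * N / (32 * k)" using tau k by (simp add: power2_eq_square field_simps)
    finally have "real (card X) + real (card M) * real (2 * nat \<lceil>8 * k / \<tau>\<rceil> + 2) \<le> \<tau> * N / (32 * k) + \<tau> * N / (32 * k)"
      using small by (rule add_mono[rotated])
    also have "\<dots> = g" by (simp add: g_def)
    finally have "real (card X + card M * (2 * nat \<lceil>8 * k / \<tau>\<rceil> + 2)) \<le> g" by (simp only: of_nat_add of_nat_mult)
    then show "card X + card M * (2 * nat \<lceil>8 * k / \<tau>\<rceil> + 2) \<le> nat \<lfloor>g\<rfloor>" by (simp add: le_nat_floor)
  qed
  then obtain I where I: "routed U E X M I" by blast
  define J where "J p = (if p \<in> M then I p else {})" for p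
  have "routed U E X (pairs_of X) J"
    unfolding routed_def
  proof (intro conjI ballI impI)
    fix p assume p: "p \<in> pairs_of X"
    show "J p \<subseteq> U - X" using I by (auto simp: J_def routed_def)
    show "p \<in> reach E (J p \<union> ends p)"
    proof (cases "p \<in> M")
      case True
      then show ?thesis using I by (simp add: J_def routed_def)
    next
      case False
      then have "(fst p, snd p) \<in> E" using p by (simp add: M_def)
      then have "(fst p, snd p) \<in> reach E (J p \<union> ends p)" by (rule reach_edge) auto
      then show ?thesis by simp
    qed
    fix q assume "p \<noteq> q"
    then show "J p \<inter> J q = {}" using I by (simp add: J_def routed_def)
  qed
  then show ?thesis using XU unfolding topological_clique_def by blast
qed

lemma topological_clique_from_subset:
  fixes q k :: real
  assumes WU: "W \<subseteq> U" "W \<noteq> {}" and deg: "\<And>x. x \<in> W \<Longrightarrow> N / k \<le> card (E `` {x} \<inter> U)" and k: "1 \<le> k"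
    and w: "alpha E W \<le> Suc w" and q: "0 < q" "q \<le> 1"
    and size: "2 * real s \<le> q ^ w * card W" and s: "real s \<le> \<tau> * N / (32 * k)"
    and pairs: "q * (real s)\<^sup>2 \<le> \<tau>\<^sup>2 * N / (640 * k\<^sup>2)"
  shows "topological_clique U E s"
proof -
  have fW: "finite W" using WU finU finite_subset by blast
  obtain Y where Y: "Y \<subseteq> W" "q ^ w * card W \<le> card Y"
    "\<And>y. y \<in> Y \<Longrightarrow> card {z \<in> Y. z \<noteq> y \<and> (y, z) \<notin> E} \<le> q * card Y"
    using near_clique_subset[OF fW symE irE WU(2) w q] by blast
  have fY: "finite Y" using Y fW finite_subset by blast
  have "2 * s \<le> card Y" using size Y(2) by linarith
  then obtain X where X: "X \<subseteq> Y" "card X = s" "card {p \<in> pairs_of X. p \<notin> E} \<le> q * (real s)\<^sup>2"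
    using few_nonadjacent_pairs[OF fY symE less_imp_le[OF q(1)] Y(3)] by blast
  have "topological_clique U E (card X)"
    by (rule topological_clique_on[OF _ deg k]) (use X Y(1) WU(1) s pairs in auto)
  then show ?thesis using X by simp
qed

end

lemma extremal_subset_exists:
  fixes V :: "'a::linorder set"
  assumes "finite V" "sym E" "irrefl E" "V \<noteq> {}" "0 < \<tau>" "\<tau> \<le> 1"
  obtains U where "U \<subseteq> V" "extremal_subset U E \<tau>"
    "\<And>A. A \<subseteq> V \<Longrightarrow> A \<noteq> {} \<Longrightarrow>
      card A / alpha E A powr (1 + \<tau>) \<le> card U / alpha E U powr (1 + \<tau>)"
proof -
  define F where "F A = card A / alpha E A powr (1 + \<tau>)" for A
  define S where "S = {A. A \<subseteq> V \<and> A \<noteq> {}}"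
  have S: "finite (F ` S)" using assms by (simp add: S_def)
  moreover have "V \<in> S" using assms by (simp add: S_def)
  ultimately have "Max (F ` S) \<in> F ` S" by (intro Max_in) auto
  then obtain U where U: "U \<in> S" "F U = Max (F ` S)" by auto
  have max: "F A \<le> F U" if "A \<in> S" for A using U(2) S that by simp
  have UV: "U \<subseteq> V" "U \<noteq> {}" using U by (auto simp: S_def)
  have "extremal_subset U E \<tau>"
  proof
    show "finite U" using UV assms finite_subset by blast
    show "card A / alpha E A powr (1 + \<tau>) \<le> card U / alpha E U powr (1 + \<tau>)" if "A \<subseteq> U" "A \<noteq> {}" for A
      using max[of A] that UV by (auto simp: F_def S_def)
  qed (use assms UV in auto)
  then show thesis using that[of U] UV max by (simp add: F_def S_def)
qed

section \<open>Many vertices of low degree\<close>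

text \<open>
  The loss from choosing one of infinitely many layers, against the square root of the
  doubling between layers. The ratio of the two sides is largest near \<open>i = 4\<close>, which
  determines the constant.
\<close>

lemma dyadic_weight_bound: "(real i + 1) * (real i + 2) \<le> 8 * sqrt (2 ^ i)"
proof -
  have base: "((i + 1) * (i + 2))\<^sup>2 \<le> 64 * 2 ^ i" if "i \<le> 4" for i :: nat
  proof -
    have "i = 0 \<or> i = 1 \<or> i = 2 \<or> i = 3 \<or> i = 4" using that by arith
    then show ?thesis by (elim disjE) (simp_all add: power2_eq_square)
  qed
  have "((i + 1) * (i + 2))\<^sup>2 \<le> 64 * 2 ^ i" for i :: nat
  proof (cases "i \<le> 4")
    case True
    then show ?thesis by (rule base)
  next
    case False
    then have "4 \<le> i" by simp
    then show ?thesis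
    proof (induction i rule: dec_induct)
      case base
      show ?case by simp
    next
      case (step i)
      have "(i + 3)\<^sup>2 \<le> 2 * (i + 1)\<^sup>2"
      proof -
        have "4 * i \<le> i * i" using step(1) by simp
        moreover have "(i + 3)\<^sup>2 = i * i + 6 * i + 9" "2 * (i + 1)\<^sup>2 = 2 * (i * i) + 4 * i + 2"
          by (simp_all add: power2_eq_square algebra_simps)
        ultimately show ?thesis using step(1) by linarith
      qed
      then have "(i + 2)\<^sup>2 * (i + 3)\<^sup>2 \<le> (i + 2)\<^sup>2 * (2 * (i + 1)\<^sup>2)" by (rule mult_le_mono2)
      also have "\<dots> = 2 * ((i + 1) * (i + 2))\<^sup>2" by (simp only: power_mult_distrib ac_simps)
      also have "\<dots> \<le> 2 * (64 * 2 ^ i)" using step.IH by simp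
      also have "2 * (64 * 2 ^ i) = (64 :: nat) * 2 ^ Suc i" by simp
      finally have "((i + 2) * (i + 3))\<^sup>2 \<le> 64 * 2 ^ Suc i" by (simp only: power_mult_distrib)
      moreover have "(Suc i + 1) * (Suc i + 2) = (i + 2) * (i + 3)" by (simp add: algebra_simps)
      ultimately show ?case by (simp only:)
    qed
  qed
  then have "real (((i + 1) * (i + 2))\<^sup>2) \<le> real (64 * 2 ^ i)" using of_nat_le_iff by blast
  then have "((real i + 1) * (real i + 2))\<^sup>2 \<le> 64 * 2 ^ i"
    by (simp only: of_nat_power of_nat_mult of_nat_add of_nat_1 of_nat_numeral)
  also have "\<dots> = (8 * sqrt (2 ^ i))\<^sup>2" by (simp add: power_mult_distrib)
  finally show ?thesis by (rule power2_le_imp_le) simp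
qed

text \<open>
  Here \<open>\<eta>\<close> bounds the independence number that is left by the
  Erdos-Szemeredi argument, and the left-hand side is the exponent of all losses: \<open>4 ln
  P + L / \<alpha>\<close> for each step towards a near-clique, \<open>\<eta> ln P + \<alpha>
  / P\<close> for the pigeonhole principle. With \<open>z = P / a\<close> we have
  \<open>\<alpha> / P \<le> L / z\<close> and \<open>ln P = ln a + ln z\<close>. The first
  summand is the reason for the hypothesis: \<open>\<eta> ln a\<close> is small against
  \<open>L\<close> only if \<open>z\<close> is large against \<open>ln a\<close>.
\<close>

lemma gain_exponent:
  fixes P a L \<alpha> :: real
  assumes "exp 1 \<le> a" "0 < L" "1 \<le> \<alpha>" "\<alpha> \<le> a * L" and P: "100000000 * 2 ^ i * (a * ln a) \<le> P"
  defines "\<eta> \<equiv> 4 * ((real i + 1) * (real i + 2)) * \<alpha> / P"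
  shows "5 * \<eta> * ln P + \<eta> * (L / \<alpha>) + \<alpha> / P \<le> L / 25"
proof -
  define B where "B = sqrt (2 ^ i)"
  have "1 < exp (1::real)" by simp
  then have a1: "1 < a" using assms(1) by linarith
  then have a: "0 < a" by simp
  have lna: "1 \<le> ln a" using assms(1) a by (simp add: ln_ge_iff)
  have B1: "1 \<le> B" by (simp add: B_def)
  have BB: "B * B = 2 ^ i" by (simp add: B_def)
  define z where "z = P / a"
  have zC: "100000000 * (B * B) * ln a \<le> z" using P a BB by (simp add: z_def field_simps)
  have "100000000 * (B * B) * 1 \<le> 100000000 * (B * B) * ln a" using lna B1 by (intro mult_left_mono) auto
  then have zB: "100000000 * (B * B) \<le> z" using zC by linarith
  have BB1: "1 \<le> B * B" using mult_mono[OF B1 B1] B1 by simp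
  then have z1: "1 \<le> z" using zB by linarith
  have P_z: "P = a * z" using a by (simp add: z_def)
  have P0: "0 < P" using P_z a z1 by simp
  have aP: "\<alpha> / P \<le> L / z" using assms(4) a z1 by (simp add: P_z field_simps)
  have zP: "z \<le> P" using P_z a1 z1 by simp
  have eta_nonneg: "0 \<le> \<eta>" using P0 assms(3) by (simp add: \<eta>_def)
  have eta: "\<eta> \<le> 32 * B * (\<alpha> / P)"
  proof -
    have "4 * ((real i + 1) * (real i + 2)) * (\<alpha> / P) \<le> 4 * (8 * B) * (\<alpha> / P)"
      using dyadic_weight_bound[of i] P0 assms(3) by (intro mult_right_mono) (auto simp: B_def)
    then show ?thesis by (simp add: \<eta>_def)
  qed
  also have "\<dots> \<le> 32 * B * (L / z)" using aP B1 by (intro mult_left_mono) auto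
  finally have eta': "\<eta> \<le> 32 * B * (L / z)" .
  define r where "r = sqrt z"
  have r: "1 \<le> r" "r * r = z" using z1 by (auto simp: r_def)
  have Br: "10000 * B \<le> r"
  proof (rule power2_le_imp_le)
    show "(10000 * B)\<^sup>2 \<le> r\<^sup>2" using zB r by (simp add: power2_eq_square)
  qed (use r in simp)
  have lnz: "ln z \<le> 2 * r"
  proof -
    have "ln z = ln (r * r)" by (simp add: r(2))
    also have "\<dots> = 2 * ln r" using r(1) by (simp add: ln_mult)
    finally have "ln z = 2 * ln r" .
    then show ?thesis using r ln_le_minus_one[of r] by simp
  qed
  have "\<eta> * ln z \<le> 32 * B * (L / z) * (2 * r)"
    using eta' lnz eta_nonneg z1 by (intro mult_mono) auto
  also have "\<dots> = 64 * L * (B / r)" using r by (simp add: field_simps flip: r(2))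
  also have "\<dots> \<le> 64 * L * (1 / 10000)" using Br r assms(2) by (intro mult_left_mono) (auto simp: field_simps)
  finally have e1: "\<eta> * ln z \<le> L * (64 / 10000)" by simp
  have "\<eta> * ln a \<le> 32 * B * (L / z) * ln a" using eta' lna by (intro mult_right_mono) auto
  also have "\<dots> = 32 * L * (B * ln a / z)" by simp
  also have "\<dots> \<le> 32 * L * (1 / 100000000)"
  proof -
    have "100000000 * B * ln a * 1 \<le> 100000000 * B * ln a * B" using B1 lna by (intro mult_left_mono) auto
    also have "\<dots> \<le> z" using zC by (simp add: algebra_simps)
    finally have "B * ln a / z \<le> 1 / 100000000" using z1 by (simp add: field_simps)
    then show ?thesis using assms(2) by (intro mult_left_mono) auto
  qed
  finally have e2: "\<eta> * ln a \<le> L * (32 / 100000000)" by simp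
  have "\<eta> * (L / \<alpha>) \<le> 32 * B * (\<alpha> / P) * (L / \<alpha>)" using eta assms(2,3) by (intro mult_right_mono) auto
  also have "\<dots> = 32 * L * (B / P)" using assms(3) by simp
  also have "\<dots> \<le> 32 * L * (1 / 100000000)"
  proof -
    have "100000000 * (B * 1) \<le> 100000000 * (B * B)" using B1 by (intro mult_left_mono) auto
    then have "100000000 * B \<le> P" using zB zP by simp
    then have "B / P \<le> 1 / 100000000" using P0 by (simp add: field_simps)
    then show ?thesis using assms(2) by (intro mult_left_mono) auto
  qed
  finally have e3: "\<eta> * (L / \<alpha>) \<le> L * (32 / 100000000)" by simp
  have "L / z \<le> L * (1 / 100000000)"
  proof -
    have "100000000 \<le> z" using zB BB1 by linarith
    then have "1 / z \<le> 1 / 100000000" using z1 by (intro divide_left_mono) auto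
    then have "L * (1 / z) \<le> L * (1 / 100000000)" using assms(2) by (intro mult_left_mono) auto
    then show ?thesis by simp
  qed
  then have e4: "\<alpha> / P \<le> L * (1 / 100000000)" using aP by linarith
  have "ln P = ln a + ln z" using a z1 by (simp add: P_z ln_mult)
  then have "5 * \<eta> * ln P = 5 * (\<eta> * ln a) + 5 * (\<eta> * ln z)" by (simp add: algebra_simps)
  then show ?thesis using e1 e2 e3 e4 assms(2) by linarith
qed

lemma ln_le_powr: "1 \<le> n \<Longrightarrow> ln n \<le> 20 * n powr (1 / 20)" for n :: real
proof -
  assume n: "1 \<le> n"
  have "ln (n powr (1 / 20)) \<le> n powr (1 / 20) - 1" using n by (intro ln_le_minus_one) simp
  then show ?thesis using n by (simp add: ln_powr)
qed

text \<open>
  The hypotheses leave \<open>10^8 ln a \<le> 2 ln n\<close>, so that \<open>a\<close> and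
  \<open>P\<close> are bounded by small powers of \<open>n\<close>.
\<close>

lemma gain_parameter_bound:
  fixes P a n \<alpha> :: real
  assumes "2 \<le> n" "0 < a" "\<alpha> \<le> a * ln n" "P \<le> 2 * \<alpha>" and P: "100000000 * (a * ln a) \<le> P"
  shows "P \<le> 40 * n powr (3 / 50)" "ln a \<le> ln n"
proof -
  note a = assms(2)
  have L: "0 < ln n" using assms(1) by simp
  have "a * (100000000 * ln a) \<le> a * (2 * ln n)" using assms(3,4) P by (simp add: algebra_simps)
  then have l: "100000000 * ln a \<le> 2 * ln n" using a by (simp only: mult_le_cancel_left_pos)
  then have "ln a \<le> ln n * (1 / 100)" using L by simp
  then have "ln a \<le> ln (n powr (1 / 100))" using assms(1) by (simp add: ln_powr)
  then have a2: "a \<le> n powr (1 / 100)" using a assms(1) by (subst (asm) ln_le_cancel_iff) auto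
  show "ln a \<le> ln n" using l L by simp
  have "P \<le> 2 * (a * ln n)" using assms(3,4) by linarith
  also have "\<dots> \<le> 2 * (n powr (1 / 100) * (20 * n powr (1 / 20)))"
    using a2 ln_le_powr[of n] assms(1) a L by (intro mult_left_mono mult_mono) auto
  also have "\<dots> = 40 * n powr (1 / 100 + 1 / 20)" unfolding powr_add by simp
  finally show "P \<le> 40 * n powr (3 / 50)" by simp
qed


text \<open>
  Split the vertices of low degree into dyadic layers. No layer lies below degree \<open>N /
  (2 b)\<close>, by \<open>degree_lower\<close>.
\<close>

lemma (in extremal_subset) low_degree_layer:
  assumes edges: "2 * b \<le> N" and low: "N \<le> 2 * card {v \<in> U. card (E `` {v} \<inter> U) < N / \<theta>}" and \<theta>: "1 \<le> \<theta>"
  obtains i R where "R \<subseteq> U" "R \<noteq> {}" "N \<le> 2 * ((real i + 1) * (real i + 2)) * card R"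
    "\<And>v. v \<in> R \<Longrightarrow> card (E `` {v} \<inter> U) \<le> N / (\<theta> * 2 ^ i)"
    "\<And>v. v \<in> R \<Longrightarrow> N / (2 * (\<theta> * 2 ^ i)) \<le> card (E `` {v} \<inter> U)"
    "\<theta> * 2 ^ i \<le> 2 * b"
proof -
  define D where "D v = real (card (E `` {v} \<inter> U))" for v
  define Low where "Low = {v \<in> U. D v < N / \<theta>}"
  have low': "N \<le> 2 * card Low" using low by (simp add: Low_def D_def)
  have fL: "finite Low" using finU by (simp add: Low_def)
  have Lne: "Low \<noteq> {}" using low' N_pos by auto
  have Dlow: "N / (2 * b) \<le> D v" if "v \<in> U" for v
  proof -
    have "2 \<le> N / b" using edges b_pos by (simp add: field_simps)
    moreover have "N / b \<le> D v + 1" using degree_lower[OF that] by (simp add: D_def)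
    moreover have "N / (2 * b) = N / b / 2" by simp
    ultimately show ?thesis by linarith
  qed
  have Dpos: "0 < D v" if "v \<in> U" for v
  proof -
    have "0 < N / (2 * b)" using N_pos b_pos by simp
    then show ?thesis using Dlow[OF that] by linarith
  qed
  define f where "f v = (LEAST i::nat. N / (2 * (\<theta> * 2 ^ i)) \<le> D v)" for v
  have f: "N / (2 * (\<theta> * 2 ^ f v)) \<le> D v" "D v \<le> N / (\<theta> * 2 ^ f v)" if v: "v \<in> Low" for v
  proof -
    have vU: "v \<in> U" using v by (simp add: Low_def)
    obtain i where "N / (2 * \<theta> * D v) < 2 ^ i" using real_arch_pow[of 2] by auto
    then have "N / (2 * (\<theta> * 2 ^ i)) \<le> D v" using Dpos[OF vU] \<theta> by (simp add: field_simps)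
    then show 1: "N / (2 * (\<theta> * 2 ^ f v)) \<le> D v" unfolding f_def by (rule LeastI)
    show "D v \<le> N / (\<theta> * 2 ^ f v)"
    proof (cases "f v")
      case 0
      then show ?thesis using v by (simp add: Low_def)
    next
      case (Suc j)
      then have "\<not> N / (2 * (\<theta> * 2 ^ j)) \<le> D v" unfolding f_def by (metis lessI not_less_Least)
      then show ?thesis using Suc by (simp add: mult.left_commute)
    qed
  qed
  obtain i where i: "real (card Low) \<le> (real i + 1) * (real i + 2) * card {v \<in> Low. f v = i}"
    using weighted_pigeonhole[OF fL Lne] by blast
  define R where "R = {v \<in> Low. f v = i}"
  have RU: "R \<subseteq> U" by (auto simp: R_def Low_def)
  have "0 < card Low" using Lne fL by (simp add: card_gt_0_iff)
  then have Rne: "R \<noteq> {}" using i unfolding R_def[symmetric] by auto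
  have size: "N \<le> 2 * ((real i + 1) * (real i + 2)) * card R" using low' i by (simp add: R_def)
  have lo: "N / (2 * (\<theta> * 2 ^ i)) \<le> D v" and hi: "D v \<le> N / (\<theta> * 2 ^ i)" if "v \<in> R" for v
    using f[of v] that by (auto simp: R_def)
  obtain v where v: "v \<in> R" using Rne by blast
  have "N / (2 * b) \<le> N / (\<theta> * 2 ^ i)" using Dlow[of v] hi[OF v] v RU by force
  then have "\<theta> * 2 ^ i \<le> 2 * b" using N_pos b_pos \<theta> by (simp add: field_simps)
  then show thesis using that[OF RU Rne size] lo hi by (simp add: D_def)
qed

text \<open>
  The factor \<open>P ^ 3\<close> collects the polynomial losses. They are harmless since
  \<open>2 / 3\<close> is well below 1.
\<close>

lemma gain_size_arithmetic:
  fixes n P c :: real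
  assumes "2 \<le> n" "0 < P" "P \<le> 40 * n powr (3 / 50)" "0 < c" "c \<le> 1 / 100000000"
  shows "4 * (c * n powr (2 / 3)) \<le> exp (- (ln n / 25)) * (n / (32 * P ^ 3))"
    and "2 * (c * n powr (2 / 3)) \<le> n / (ln n * (64 * P\<^sup>2))"
proof -
  have n: "1 \<le> n" "0 < n" using assms(1) by auto
  have mono: "n powr u \<le> n powr v" if "u \<le> v" for u v using that n by (intro powr_mono) auto
  have P3: "P ^ 3 \<le> 64000 * n powr (9 / 50)"
  proof -
    have "P ^ 3 \<le> (40 * n powr (3 / 50)) ^ 3" using assms by (intro power_mono) auto
    also have "\<dots> = 64000 * (n powr (3 / 50)) ^ 3" by (simp add: power_mult_distrib)
    also have "(n powr (3 / 50)) ^ 3 = n powr (9 / 50)" using n by (simp add: powr_power)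
    finally show ?thesis .
  qed
  have P2: "P\<^sup>2 \<le> 1600 * n powr (6 / 50)"
  proof -
    have "P ^ 2 \<le> (40 * n powr (3 / 50)) ^ 2" using assms by (intro power_mono) auto
    also have "\<dots> = 1600 * (n powr (3 / 50)) ^ 2" by (simp add: power_mult_distrib)
    also have "(n powr (3 / 50)) ^ 2 = n powr (6 / 50)" using n by (simp add: powr_power)
    finally show ?thesis .
  qed
  have e: "exp (- (ln n / 25)) = n powr (- 1 / 25)" using n by (simp add: powr_def)
  have c: "c * u \<le> u / 100000000" if "0 \<le> u" for u using mult_right_mono[OF assms(5) that] by simp
  have "4 * (c * n powr (2 / 3)) * (32 * P ^ 3) \<le> 4 * (n powr (2 / 3) / 100000000) * (32 * (64000 * n powr (9 / 50)))"
    using P3 c[of "n powr (2 / 3)"] assms by (intro mult_mono) auto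
  also have "\<dots> \<le> n powr (2 / 3) * n powr (9 / 50)" by simp
  also have "\<dots> = n powr (2 / 3 + 9 / 50)" by (simp only: powr_add)
  also have "\<dots> \<le> n powr (- 1 / 25 + 1)" by (rule mono) simp
  also have "\<dots> = exp (- (ln n / 25)) * n" unfolding e powr_add using n by simp
  finally show "4 * (c * n powr (2 / 3)) \<le> exp (- (ln n / 25)) * (n / (32 * P ^ 3))"
    using assms(2) by (simp add: pos_le_divide_eq)
  have "2 * (c * n powr (2 / 3)) * (ln n * (64 * P\<^sup>2)) \<le>
      2 * (n powr (2 / 3) / 100000000) * (20 * n powr (1 / 20) * (64 * (1600 * n powr (6 / 50))))"
    using P2 c[of "n powr (2 / 3)"] ln_le_powr[OF n(1)] assms by (intro mult_mono) auto
  also have "\<dots> \<le> n powr (2 / 3) * n powr (1 / 20) * n powr (6 / 50)" by simp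
  also have "\<dots> = n powr (2 / 3 + 1 / 20 + 6 / 50)" by (simp only: powr_add)
  also have "\<dots> \<le> n powr 1" by (rule mono) simp
  finally show "2 * (c * n powr (2 / 3)) \<le> n / (ln n * (64 * P\<^sup>2))"
    using assms n by (simp add: pos_le_divide_eq)
qed

text \<open>
  Below, \<open>\<alpha>\<close> is large, so the target \<open>n powr (\<alpha> / (2 \<alpha>
  - 1))\<close> is far from \<open>n\<close>, and a small power of \<open>n\<close> can be
  wasted.
\<close>

lemma exponent_le_two_thirds: "2 \<le> \<alpha> \<Longrightarrow> \<alpha> / (2 * \<alpha> - 1) \<le> 2 / (3::real)"
  by (simp add: field_simps)

lemma square_target:
  fixes n \<alpha> c :: real
  assumes "0 < n" "1 \<le> \<alpha>"
  shows "(c * n powr (\<alpha> / (2 * \<alpha> - 1)))\<^sup>2 = c\<^sup>2 * (n * n powr (1 / (2 * \<alpha> - 1)))"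
proof -
  have "(n powr (\<alpha> / (2 * \<alpha> - 1)))\<^sup>2 = n powr (2 * (\<alpha> / (2 * \<alpha> - 1)))"
    using assms by (simp add: powr_power)
  also have "2 * (\<alpha> / (2 * \<alpha> - 1)) = 1 + 1 / (2 * \<alpha> - 1)" using assms(2) by (simp add: field_simps)
  finally show ?thesis using assms(1) by (simp add: power_mult_distrib powr_add)
qed

text \<open>
  The layer of degrees about \<open>N / \<kappa>\<close> contains a set \<open>W\<close> with
  \<open>alpha E W \<le> 1 + \<eta>\<close>, where \<open>\<eta>\<close> is far smaller than
  \<open>ln n\<close>. Hence \<open>q\<close> may be as small as the number of routes in
  \<open>topological_clique_on\<close> demands, that is, polynomially small in \<open>P =
  \<kappa> \<alpha> / b\<close>, and nearly the whole of \<open>W\<close> survives up to a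
  small power of \<open>n\<close>.
\<close>

lemma (in extremal_subset) clique_in_low_degrees:
  fixes n a \<alpha> c x :: real
  assumes n: "2 \<le> n" and a: "exp 1 \<le> a" and \<tau>a: "\<tau> = 1 / ln a" and \<alpha>: "1 \<le> \<alpha>" "\<alpha> \<le> a * ln n" "b \<le> \<alpha>"
    and N: "n * (b / \<alpha>)\<^sup>2 \<le> N" and edges: "2 * b \<le> N"
    and low: "N \<le> 2 * card {v \<in> U. card (E `` {v} \<inter> U) < N / (100000000 * (a * ln a) * (b / \<alpha>))}"
    and c: "0 < c" "c \<le> 1 / 100000000" and x: "x = c * n powr (\<alpha> / (2 * \<alpha> - 1))" and x1: "1 \<le> x"
  shows "topological_clique U E (nat \<lceil>x\<rceil>)"
proof -
  define t where "t = \<alpha> / b"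
  have t1: "1 \<le> t" using \<alpha>(3) b_pos by (simp add: t_def field_simps)
  have bt: "b / \<alpha> = 1 / t" by (simp add: t_def)
  have bat: "b = \<alpha> / t" using b_pos \<alpha>(1) by (simp add: t_def)
  define L where "L = ln n"
  have L: "0 < L" using n by (simp add: L_def)
  have "1 < exp (1::real)" by simp
  then have a1: "1 < a" using a by linarith
  have lna: "1 \<le> ln a" using a a1 by (simp add: ln_ge_iff)
  define \<theta> where "\<theta> = max (100000000 * (a * ln a) * (b / \<alpha>)) 1"
  have degN: "real (card (E `` {v} \<inter> U)) < N" if "v \<in> U" for v
  proof -
    have "E `` {v} \<inter> U \<subset> U" using irE that by (auto simp: irrefl_def)
    then show ?thesis using psubset_card_mono[OF finU] by simp
  qed
  have "{v \<in> U. card (E `` {v} \<inter> U) < N / (100000000 * (a * ln a) * (b / \<alpha>))} \<subseteq> {v \<in> U. card (E `` {v} \<inter> U) < N / \<theta>}"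
    using degN by (auto simp: \<theta>_def max_def)
  then have "card {v \<in> U. card (E `` {v} \<inter> U) < N / (100000000 * (a * ln a) * (b / \<alpha>))} \<le> card {v \<in> U. card (E `` {v} \<inter> U) < N / \<theta>}"
    using finU by (intro card_mono) auto
  then have low2: "N \<le> 2 * card {v \<in> U. card (E `` {v} \<inter> U) < N / \<theta>}" using low by linarith
  have th1: "1 \<le> \<theta>" by (simp add: \<theta>_def)
  obtain i R where R: "R \<subseteq> U" "R \<noteq> {}" and Rsize: "N \<le> 2 * ((real i + 1) * (real i + 2)) * card R"
    and Rhi: "\<And>v. v \<in> R \<Longrightarrow> card (E `` {v} \<inter> U) \<le> N / (\<theta> * 2 ^ i)"
    and Rlo: "\<And>v. v \<in> R \<Longrightarrow> N / (2 * (\<theta> * 2 ^ i)) \<le> card (E `` {v} \<inter> U)"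
    and kb: "\<theta> * 2 ^ i \<le> 2 * b"
    by (rule low_degree_layer[OF edges low2 th1]) (rule that)
  define \<kappa> where "\<kappa> = \<theta> * 2 ^ i"
  have k1: "1 \<le> \<kappa>" using th1 mult_mono[of 1 \<theta> 1 "2 ^ i"] by (simp add: \<kappa>_def)
  define P where "P = \<kappa> * t"
  have Pbig: "100000000 * 2 ^ i * (a * ln a) \<le> P"
  proof -
    have "100000000 * (a * ln a) * (b / \<alpha>) * (2 ^ i * t) \<le> \<theta> * (2 ^ i * t)"
      using t1 by (intro mult_right_mono) (auto simp: \<theta>_def)
    then show ?thesis using t1 by (simp add: bt P_def \<kappa>_def algebra_simps)
  qed
  have P2a: "P \<le> 2 * \<alpha>"
    using mult_right_mono[OF kb, of t] t1 by (simp add: P_def \<kappa>_def bat)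
  have Pal: "100000000 * (a * ln a) \<le> P"
  proof -
    have "100000000 * (a * ln a) * 1 \<le> 100000000 * (a * ln a) * 2 ^ i" using a1 lna by (intro mult_left_mono) auto
    then show ?thesis using Pbig by (simp add: algebra_simps)
  qed
  have "1 * 1 \<le> a * ln a" using a1 lna by (intro mult_mono) auto
  then have P8: "100000000 \<le> P" using Pal by linarith
  have \<alpha>2: "2 \<le> \<alpha>" using P8 P2a by simp
  have Pk: "\<kappa> \<le> P" using k1 t1 by (simp add: P_def)
  have Pt: "t \<le> P" using k1 t1 by (simp add: P_def)
  have t2k: "t\<^sup>2 * \<kappa> \<le> P\<^sup>2"
    using k1 t1 by (simp add: P_def power2_eq_square)
  have Pn: "P \<le> 40 * n powr (3 / 50)" "ln a \<le> ln n"
    using gain_parameter_bound[OF n _ \<alpha>(2) P2a Pal] a1 by auto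
  have Nn: "n / t\<^sup>2 \<le> N" using N by (simp add: bt power_divide)
  have xle: "x \<le> c * n powr (2 / 3)"
    unfolding x using exponent_le_two_thirds[OF \<alpha>2] n c by (intro mult_left_mono powr_mono) auto
  define s where "s = nat \<lceil>x\<rceil>"
  have s2: "real s \<le> 2 * x" using x1 by (simp add: s_def) linarith
  define ii where "ii = (real i + 1) * (real i + 2)"
  have ii1: "1 \<le> ii" using mult_mono[of 1 "real i + 1" 1 "real i + 2"] by (simp add: ii_def)
  define \<eta> where "\<eta> = 4 * ii * \<alpha> / P"
  have eta0: "0 \<le> \<eta>" using ii1 \<alpha>(1) P8 by (simp add: \<eta>_def)
  have eta_b: "\<eta> = 4 * ii * b / \<kappa>" using t1 k1 by (simp add: \<eta>_def P_def bat field_simps)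
  have expo: "5 * \<eta> * ln P + \<eta> * (L / \<alpha>) + \<alpha> / P \<le> L / 25"
    using gain_exponent[OF a L \<alpha>(1) _ Pbig] \<alpha>(2) by (simp add: \<eta>_def ii_def L_def)
  have fR: "finite R" using R(1) finU finite_subset by blast
  have aR: "real (alpha E R) \<le> b" using alpha_mono[OF finU R(1)] by simp
  obtain W where W: "W \<subseteq> R" "W \<noteq> {}" "alpha E W \<le> 1 + \<eta>"
    and WR: "card R \<le> 2 * (\<kappa> powr (1 + \<eta>) * exp (alpha E R / \<kappa>)) * card W"
  proof (rule erdos_szemeredi_subset[OF fR symE irE R(2), of "N / \<kappa>" \<kappa> "1 + \<eta>"])
    show "real (card (E `` {v} \<inter> R)) \<le> N / \<kappa>" if "v \<in> R" for v
    proof -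
      have "card (E `` {v} \<inter> R) \<le> card (E `` {v} \<inter> U)" using R(1) finU by (intro card_mono) auto
      then show ?thesis using Rhi[OF that] by (simp add: \<kappa>_def)
    qed
    have "real (2 * alpha E R) * (N / \<kappa>) \<le> 2 * b * (N / \<kappa>)"
      using aR N_pos k1 by (intro mult_right_mono) auto
    also have "\<dots> \<le> 2 * b * (2 * ii * card R / \<kappa>)"
      using Rsize b_pos k1 by (intro mult_left_mono divide_right_mono) (auto simp: ii_def)
    also have "\<dots> = \<eta> * card R" by (simp add: eta_b)
    also have "\<dots> \<le> (1 + \<eta>) * card R" by (simp add: algebra_simps)
    finally show "real (2 * alpha E R) * (N / \<kappa>) \<le> (1 + \<eta>) * real (card R)" .
  qed (use k1 eta0 in auto)
  define w where "w = nat \<lfloor>\<eta>\<rfloor>"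
  have w: "alpha E W \<le> Suc w" "real w \<le> \<eta>" using W(3) eta0 by (auto simp: w_def le_nat_iff nat_le_iff) linarith+
  define Q where "Q = n powr (1 / (2 * \<alpha> - 1))"
  have Q1: "1 \<le> Q" using n \<alpha>(1) by (simp add: Q_def ge_one_powr_ge_zero)
  have lnQ: "ln Q \<le> L / \<alpha>"
  proof -
    have "ln Q = L / (2 * \<alpha> - 1)" using n by (simp add: Q_def ln_powr L_def)
    also have "\<dots> \<le> L / \<alpha>" using \<alpha>(1) L by (intro divide_left_mono) auto
    finally show ?thesis .
  qed
  (* With x the target order, q (2 x)^2 stays below the number of routes that fit into U. *)
  define q where "q = 1 / ((ln a)\<^sup>2 * P\<^sup>2 * Q)"
  have "1 * 1 * 1 \<le> (ln a)\<^sup>2 * P\<^sup>2 * Q"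
    using lna P8 Q1 by (intro mult_mono one_le_power) auto
  then have den: "1 \<le> (ln a)\<^sup>2 * P\<^sup>2 * Q" by simp
  have q: "0 < q" "q \<le> 1" using den by (auto simp: q_def)
  have lnq: "- ln q \<le> 4 * ln P + L / \<alpha>"
  proof -
    have "- ln q = 2 * ln (ln a) + 2 * ln P + ln Q"
      using lna P8 Q1 by (simp add: q_def ln_div ln_mult ln_realpow)
    moreover have "ln a \<le> P"
    proof -
      have "1 * ln a \<le> (100000000 * a) * ln a" using a1 lna by (intro mult_right_mono) auto
      then show ?thesis using Pal by (simp add: mult.assoc)
    qed
    then have "ln (ln a) \<le> ln P" using lna by simp
    ultimately show ?thesis using lnQ by linarith
  qed
  have size: "2 * real s \<le> q ^ w * card W"
  proof -
    have qw: "exp (- (\<eta> * (4 * ln P + L / \<alpha>))) \<le> q ^ w"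
    proof -
      have "real w * (- ln q) \<le> \<eta> * (4 * ln P + L / \<alpha>)"
        using w(2) lnq q eta0 by (intro mult_mono) (auto simp: ln_le_zero_iff)
      then have "- (\<eta> * (4 * ln P + L / \<alpha>)) \<le> real w * ln q" by simp
      also have "\<dots> = ln (q ^ w)" using q by (simp add: ln_realpow)
      finally have "exp (- (\<eta> * (4 * ln P + L / \<alpha>))) \<le> exp (ln (q ^ w))" by (simp only: exp_le_cancel_iff)
      also have "\<dots> = q ^ w" using q by (intro exp_ln) simp
      finally show ?thesis .
    qed
    have "\<kappa> powr (1 + \<eta>) * exp (alpha E R / \<kappa>) \<le> \<kappa> * exp (\<eta> * ln P + \<alpha> / P)"
    proof -
      have "\<kappa> powr (1 + \<eta>) = \<kappa> * exp (\<eta> * ln \<kappa>)" 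
      proof -
        have "\<kappa> powr (1 + \<eta>) = \<kappa> powr 1 * \<kappa> powr \<eta>" by (rule powr_add)
        then show ?thesis using k1 by (simp add: powr_def[of \<kappa> \<eta>])
      qed
      moreover have "\<eta> * ln \<kappa> + alpha E R / \<kappa> \<le> \<eta> * ln P + \<alpha> / P"
      proof -
        have "\<eta> * ln \<kappa> \<le> \<eta> * ln P" using Pk k1 eta0 by (intro mult_left_mono) auto
        moreover have "alpha E R / \<kappa> \<le> b / \<kappa>" using aR k1 by (intro divide_right_mono) auto
        moreover have "b / \<kappa> = \<alpha> / P" using t1 by (simp add: P_def bat field_simps)
        ultimately show ?thesis by linarith
      qed
      ultimately show ?thesis using k1 by (simp add: exp_add[symmetric] mult.assoc)
    qed
    then have "2 * (\<kappa> powr (1 + \<eta>) * exp (alpha E R / \<kappa>)) * card W \<le> 2 * (\<kappa> * exp (\<eta> * ln P + \<alpha> / P)) * card W"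
      by (intro mult_right_mono mult_left_mono) auto
    then have "card R \<le> 2 * (\<kappa> * exp (\<eta> * ln P + \<alpha> / P)) * card W" using WR by linarith
    then have "card R / (2 * \<kappa>) \<le> exp (\<eta> * ln P + \<alpha> / P) * card W"
      using k1 by (simp add: pos_divide_le_eq algebra_simps)
    then have "exp (- (\<eta> * ln P + \<alpha> / P)) * (card R / (2 * \<kappa>)) \<le>
        exp (- (\<eta> * ln P + \<alpha> / P)) * (exp (\<eta> * ln P + \<alpha> / P) * card W)" by (intro mult_left_mono) auto
    then have cW: "exp (- (\<eta> * ln P + \<alpha> / P)) * (card R / (2 * \<kappa>)) \<le> card W"
      by (simp add: mult.assoc[symmetric] exp_add[symmetric])
    have Rn: "n / (32 * P ^ 3) \<le> card R / (2 * \<kappa>)"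
    proof -
      have "ii \<le> 8 * P"
      proof -
        have "ii \<le> 8 * sqrt (2 ^ i)" unfolding ii_def by (rule dyadic_weight_bound)
        also have "\<dots> \<le> 8 * 2 ^ i"
        proof -
          have "(1::real) \<le> 2 ^ i" by simp
          then show ?thesis by (simp add: real_le_lsqrt real_sqrt_le_iff sqrt_le_D power2_eq_square)
        qed
        also have "(2::real) ^ i \<le> P"
        proof -
          have "2 ^ i * 1 \<le> 2 ^ i * (100000000 * (a * ln a))"
            using \<open>1 * 1 \<le> a * ln a\<close> by (intro mult_left_mono) auto
          also have "\<dots> = 100000000 * 2 ^ i * (a * ln a)" by (simp only: ac_simps)
          finally show ?thesis using Pbig by linarith
        qed
        finally show ?thesis by simp
      qed
      then have "ii * (t\<^sup>2 * \<kappa>) \<le> 8 * P * P\<^sup>2" using t2k ii1 k1 P8 by (intro mult_mono) auto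
      moreover have "8 * P * P\<^sup>2 = 8 * P ^ 3" by (simp add: power3_eq_cube power2_eq_square)
      ultimately have *: "4 * (ii * (t\<^sup>2 * \<kappa>)) \<le> 32 * P ^ 3" by linarith
      have pos: "0 < 4 * (ii * (t\<^sup>2 * \<kappa>))" using ii1 t1 k1 by simp
      moreover have "0 < 32 * P ^ 3" using pos * by linarith
      ultimately have "n / (32 * P ^ 3) \<le> n / (4 * (ii * (t\<^sup>2 * \<kappa>)))"
        using n by (intro divide_left_mono[OF *] mult_pos_pos[of "32 * P ^ 3"]) auto
      also have "\<dots> = (n / t\<^sup>2) / (4 * ii * \<kappa>)" by simp
      also have "\<dots> \<le> N / (4 * ii * \<kappa>)" using Nn ii1 k1 by (intro divide_right_mono) auto
      also have "\<dots> \<le> (2 * ii * card R) / (4 * ii * \<kappa>)"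
        using Rsize ii1 k1 by (intro divide_right_mono) (auto simp: ii_def)
      also have "\<dots> = card R / (2 * \<kappa>)" using ii1 k1 by (simp add: field_simps)
      finally show ?thesis .
    qed
    have "2 * real s \<le> 4 * (c * n powr (2 / 3))" using s2 xle by linarith
    also have "\<dots> \<le> exp (- (L / 25)) * (n / (32 * P ^ 3))"
      using gain_size_arithmetic(1)[OF n _ Pn(1) c] P8 by (simp add: L_def)
    also have "\<dots> \<le> exp (- (\<eta> * (4 * ln P + L / \<alpha>) + (\<eta> * ln P + \<alpha> / P))) * (card R / (2 * \<kappa>))"
      using expo Rn n P8 by (intro mult_mono) (auto simp: algebra_simps)
    also have "\<dots> = exp (- (\<eta> * (4 * ln P + L / \<alpha>))) * (exp (- (\<eta> * ln P + \<alpha> / P)) * (card R / (2 * \<kappa>)))"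
      by (simp add: exp_add[symmetric] mult.assoc[symmetric])
    also have "\<dots> \<le> q ^ w * card W" using qw cW q k1 by (intro mult_mono) auto
    finally show ?thesis .
  qed
  have sN: "real s \<le> \<tau> * N / (32 * (2 * \<kappa>))"
  proof -
    have "real s \<le> 2 * (c * n powr (2 / 3))" using s2 xle by linarith
    also have "\<dots> \<le> n / (ln n * (64 * P\<^sup>2))"
      using gain_size_arithmetic(2)[OF n _ Pn(1) c] P8 by simp
    also have "\<dots> \<le> n / (ln a * (64 * (t\<^sup>2 * \<kappa>)))"
      using Pn(2) t2k lna t1 k1 n P8 by (intro divide_left_mono mult_mono mult_pos_pos) auto
    also have "\<dots> = (n / t\<^sup>2) * (\<tau> / (32 * (2 * \<kappa>)))" by (simp add: \<tau>a)
    also have "\<dots> \<le> N * (\<tau> / (32 * (2 * \<kappa>)))" using Nn tau k1 by (intro mult_right_mono) auto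
    finally show ?thesis by (simp add: mult.commute)
  qed
  have pairs: "q * (real s)\<^sup>2 \<le> \<tau>\<^sup>2 * N / (640 * (2 * \<kappa>)\<^sup>2)"
  proof -
    have "(real s)\<^sup>2 \<le> (2 * x)\<^sup>2" using s2 by (intro power_mono) auto
    also have "\<dots> = 4 * (c\<^sup>2 * (n * Q))" using square_target[of n \<alpha> c] n \<alpha>(1) by (simp add: x Q_def power_mult_distrib)
    also have "\<dots> \<le> 4 * ((1 / 100000000)\<^sup>2 * (n * Q))"
      using c n Q1 by (intro mult_left_mono mult_right_mono power_mono) auto
    finally have "q * (real s)\<^sup>2 \<le> q * (4 * ((1 / 100000000)\<^sup>2 * (n * Q)))" using q by (intro mult_left_mono) auto
    also have "\<dots> = (4 / 10000000000000000) * (\<tau>\<^sup>2 / \<kappa>\<^sup>2) * (n / t\<^sup>2)"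
      using Q1 lna k1 t1 by (simp add: q_def \<tau>a P_def power_mult_distrib power_divide)
    also have "\<dots> \<le> (4 / 10000000000000000) * (\<tau>\<^sup>2 / \<kappa>\<^sup>2) * N" using Nn by (intro mult_left_mono) auto
    also have "\<dots> \<le> (1 / 2560) * (\<tau>\<^sup>2 / \<kappa>\<^sup>2) * N" using N_pos by (intro mult_right_mono) auto
    also have "\<dots> = \<tau>\<^sup>2 * N / (640 * (2 * \<kappa>)\<^sup>2)" by (simp add: power_mult_distrib)
    finally show ?thesis .
  qed
  have "topological_clique U E s"
    by (rule topological_clique_from_subset[OF _ W(2) _ _ w(1) q size sN pairs])
      (use W(1) R(1) Rlo k1 in \<open>auto simp: \<kappa>_def\<close>)
  then show ?thesis by (simp add: s_def)
qed

section \<open>Many vertices of high degree\<close>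

lemma topological_clique_mono:
  assumes "topological_clique U E s" "U \<subseteq> V"
  shows "topological_clique V E s"
proof -
  obtain X I where X: "X \<subseteq> U" "card X = s" "routed U E X (pairs_of X) I"
    using assms(1) unfolding topological_clique_def by blast
  have "I p \<subseteq> V - X" if "p \<in> pairs_of X" for p
    using X(3) that assms(2) by (auto simp: routed_def)
  then have "routed V E X (pairs_of X) I" using X(3) by (simp add: routed_def)
  then show ?thesis unfolding topological_clique_def using X assms(2) by blast
qed

lemma topological_clique_single:
  assumes "v \<in> V"
  shows "topological_clique V E 1"
proof -
  have "pairs_of {v} = {}" by (auto simp: pairs_of_def)
  then have "routed V E {v} (pairs_of {v}) (\<lambda>_. {})" by (simp add: routed_def)
  then show ?thesis unfolding topological_clique_def using assms by (intro exI[of _ "{v}"]) auto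
qed

text \<open>
  All parameters except \<open>n\<close> and \<open>\<alpha>\<close> are bounded by
  \<open>K\<close>, so with \<open>q = n powr (- 1 / (2 \<alpha> - 1))\<close> the size of the
  near-clique and the number of routes are both of the right order. Here nothing may be lost
  in the exponent, and nothing is: \<open>n q powr (\<alpha> - 1) = n powr (\<alpha> / (2
  \<alpha> - 1))\<close>.
\<close>

lemma (in extremal_subset) clique_in_high_degrees:
  fixes n K \<alpha> c x k :: real
  assumes n: "2 \<le> n" and \<tau>1: "\<tau> = 1" and \<alpha>: "1 \<le> \<alpha>" "b \<le> \<alpha>"
    and K: "1 \<le> K" and N: "n / K\<^sup>2 \<le> N" and k: "1 \<le> k" "k \<le> K"
    and high: "N \<le> 2 * card {v \<in> U. N / k \<le> card (E `` {v} \<inter> U)}"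
    and c: "c = 1 / (64 * K ^ 3)" and x: "x = c * n powr (\<alpha> / (2 * \<alpha> - 1))" and x1: "1 \<le> x"
  shows "topological_clique U E (nat \<lceil>x\<rceil>)"
proof -
  define W where "W = {v \<in> U. N / k \<le> card (E `` {v} \<inter> U)}"
  have W: "W \<subseteq> U" by (auto simp: W_def)
  have W0: "W \<noteq> {}" using high N_pos unfolding W_def[symmetric] by auto
  define s where "s = nat \<lceil>x\<rceil>"
  have s2: "real s \<le> 2 * x" using x1 by (simp add: s_def) linarith
  have c0: "0 < c" using K c by simp
  have K23: "1 \<le> K\<^sup>2" "1 \<le> K ^ 3" "K\<^sup>2 \<le> K ^ 3" using K by (auto intro: power_increasing)
  define Q where "Q = n powr (1 / (2 * \<alpha> - 1))"
  have Q1: "1 \<le> Q" using n \<alpha>(1) by (simp add: Q_def ge_one_powr_ge_zero)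
  define q where "q = 1 / Q"
  have q: "0 < q" "q \<le> 1" using Q1 by (auto simp: q_def)
  define w where "w = alpha E U - 1"
  have w: "alpha E W \<le> Suc w" "real w \<le> \<alpha> - 1"
    using alpha_mono[OF finU W, of E] b_pos \<alpha>(2) by (auto simp: w_def)
  have nx: "x = c * (n * q powr (\<alpha> - 1))"
  proof -
    have "q powr (\<alpha> - 1) = n powr (- (\<alpha> - 1) / (2 * \<alpha> - 1))"
    proof -
      have "q = n powr (- (1 / (2 * \<alpha> - 1)))" by (simp only: q_def Q_def powr_minus_divide)
      then have "q powr (\<alpha> - 1) = n powr (- (1 / (2 * \<alpha> - 1)) * (\<alpha> - 1))" by (simp only: powr_powr)
      also have "- (1 / (2 * \<alpha> - 1)) * (\<alpha> - 1) = - (\<alpha> - 1) / (2 * \<alpha> - 1)"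
        by (simp only: minus_divide_left mult_minus_left times_divide_eq_left mult_1)
      finally show ?thesis .
    qed
    moreover have "1 + - (\<alpha> - 1) / (2 * \<alpha> - 1) = \<alpha> / (2 * \<alpha> - 1)" using \<alpha>(1) by (simp add: field_simps)
    ultimately have "n powr (\<alpha> / (2 * \<alpha> - 1)) = n * q powr (\<alpha> - 1)"
      using powr_add[of n 1 "- (\<alpha> - 1) / (2 * \<alpha> - 1)"] n by simp
    then show ?thesis by (simp add: x)
  qed
  have size: "2 * real s \<le> q ^ w * card W"
  proof -
    have "q powr (\<alpha> - 1) \<le> q powr real w" using w(2) q by (intro powr_mono') auto
    then have qw: "q powr (\<alpha> - 1) \<le> q ^ w" using q by (simp add: powr_realpow)
    have "K\<^sup>2 \<le> 8 * K ^ 3" using K23 by linarith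
    then have "4 * c * K\<^sup>2 * 2 \<le> 1" using K by (simp add: c divide_le_eq)
    then have "4 * c * n * 2 \<le> n / K\<^sup>2" 
    proof -
      have "4 * c * K\<^sup>2 * 2 * n \<le> 1 * n" using \<open>4 * c * K\<^sup>2 * 2 \<le> 1\<close> n by (intro mult_right_mono) auto
      moreover have "0 < K\<^sup>2" using K23(1) by linarith
      moreover have "4 * c * K\<^sup>2 * 2 * n = 4 * c * n * 2 * K\<^sup>2" by (simp only: ac_simps)
      ultimately show ?thesis by (simp only: pos_le_divide_eq mult_1)
    qed
    then have "4 * c * n \<le> card W" using N high unfolding W_def[symmetric] by linarith
    then have "q powr (\<alpha> - 1) * (4 * c * n) \<le> q ^ w * card W"
      using qw q c0 n by (intro mult_mono) auto
    moreover have "q powr (\<alpha> - 1) * (4 * c * n) = 4 * x" by (simp add: nx)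
    ultimately show ?thesis using s2 by linarith
  qed
  have sN: "real s \<le> \<tau> * N / (32 * k)"
  proof -
    have "q powr (\<alpha> - 1) \<le> 1" using q \<alpha>(1) by (intro powr_le1) auto
    then have "n * q powr (\<alpha> - 1) \<le> n * 1" using n by (intro mult_left_mono) auto
    then have "c * (n * q powr (\<alpha> - 1)) \<le> c * n" using c0 by (intro mult_left_mono) auto
    then have "real s \<le> 2 * (c * n)" using s2 by (simp add: nx)
    also have "\<dots> = (n / K\<^sup>2) / (32 * K)" using K by (simp add: c power3_eq_cube power2_eq_square)
    also have "\<dots> \<le> N / (32 * K)" using N K by (intro divide_right_mono) auto
    also have "\<dots> \<le> N / (32 * k)" using k N_pos by (intro divide_left_mono) auto
    finally show ?thesis by (simp add: \<tau>1)
  qed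
  have pairs: "q * (real s)\<^sup>2 \<le> \<tau>\<^sup>2 * N / (640 * k\<^sup>2)"
  proof -
    have "(real s)\<^sup>2 \<le> (2 * x)\<^sup>2" using s2 by (intro power_mono) auto
    also have "\<dots> = 4 * (c\<^sup>2 * (n * Q))" using square_target[of n \<alpha> c] n \<alpha>(1) by (simp add: x Q_def power_mult_distrib)
    finally have "q * (real s)\<^sup>2 \<le> q * (4 * (c\<^sup>2 * (n * Q)))" using q by (intro mult_left_mono) auto
    also have "\<dots> = 4 * c\<^sup>2 * n" using Q1 by (simp add: q_def)
    also have "\<dots> = (n / K\<^sup>2) / (1024 * K\<^sup>2 * K\<^sup>2)" using K by (simp add: c power_mult_distrib power_divide field_simps power2_eq_square power3_eq_cube)
    also have "\<dots> \<le> N / (1024 * K\<^sup>2 * K\<^sup>2)" using N K by (intro divide_right_mono) auto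
    also have "\<dots> \<le> N / (640 * k\<^sup>2)"
    proof -
      have "k\<^sup>2 \<le> K\<^sup>2" using k by (intro power_mono) auto
      moreover have "K\<^sup>2 * 1 \<le> K\<^sup>2 * K\<^sup>2" using K23(1) by (intro mult_left_mono) auto
      ultimately have "640 * k\<^sup>2 \<le> 1024 * K\<^sup>2 * K\<^sup>2" using K23(1) by linarith
      then show ?thesis using k N_pos by (intro divide_left_mono) auto
    qed
    finally show ?thesis by (simp add: \<tau>1)
  qed
  have "topological_clique U E s"
    by (rule topological_clique_from_subset[OF W W0 _ k(1) w(1) q size sN pairs]) (auto simp: W_def)
  then show ?thesis by (simp add: s_def)
qed

lemma (in extremal_subset) clique_by_average_degree:
  fixes x :: real
  assumes \<theta>: "0 < \<theta>" and high: "N \<le> 2 * card {v \<in> U. N / \<theta> \<le> card (E `` {v} \<inter> U)}"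
    and x1: "1 \<le> x" and x: "6400 * x\<^sup>2 \<le> N / \<theta>"
  shows "topological_clique U E (nat \<lceil>x\<rceil>)"
proof -
  define W where "W = {v \<in> U. N / \<theta> \<le> card (E `` {v} \<inter> U)}"
  define s where "s = nat \<lceil>x\<rceil>"
  have s2: "real s \<le> 2 * x" using x1 by (simp add: s_def) linarith
  have s0: "0 < s" using x1 by (simp add: s_def)
  have "(real s)\<^sup>2 \<le> (2 * x)\<^sup>2" using s2 by (intro power_mono) auto
  then have "800 * (real s)\<^sup>2 \<le> N / \<theta> / 2" using x by (simp add: power_mult_distrib)
  then have "800 * (real s)\<^sup>2 * N \<le> N / \<theta> / 2 * N" using N_pos by (intro mult_right_mono) auto
  also have "\<dots> = N / \<theta> * (N / 2)" by simp
  also have "\<dots> \<le> N / \<theta> * card W" using high N_pos \<theta> unfolding W_def[symmetric] by (intro mult_left_mono) auto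
  also have "\<dots> = (\<Sum>v\<in>W. N / \<theta>)" by simp
  also have "\<dots> \<le> (\<Sum>v\<in>W. real (card (E `` {v} \<inter> U)))" by (intro sum_mono) (simp add: W_def)
  also have "\<dots> \<le> (\<Sum>v\<in>U. real (card (E `` {v} \<inter> U)))" using finU by (intro sum_mono2) (auto simp: W_def)
  also have "\<dots> = real (card (SIGMA v:U. E `` {v} \<inter> U))" using finU by (subst card_SigmaI) auto
  also have "(SIGMA v:U. E `` {v} \<inter> U) = E \<inter> U \<times> U" by auto
  finally have "real (800 * s\<^sup>2 * card U) \<le> real (card (E \<inter> U \<times> U))" by simp
  then have "800 * s\<^sup>2 * card U \<le> card (E \<inter> U \<times> U)" by (simp only: of_nat_le_iff)
  then show ?thesis using dense_topological_clique[OF finU symE irE ne s0] by (simp add: s_def)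
qed


section \<open>The lower bounds\<close>

text \<open>
  The constant 300000000 bounds \<open>10^8 e\<close>, the value of the degree threshold
  \<open>\<theta>\<close> for \<open>a = e\<close>. If the target is below 1, a single vertex
  suffices.
\<close>

theorem clique_subdivision_with_edges:
  fixes V :: "'a::linorder set" and \<alpha> n a c :: real
  assumes fin: "finite V" and symE: "sym E" and irE: "irrefl E" and edge: "E \<inter> V \<times> V \<noteq> {}"
    and n: "n = card V" "2 \<le> n" and \<alpha>: "1 \<le> \<alpha>" "alpha E V \<le> \<alpha>" and c: "c = 1 / (64 * 300000000 ^ 3)"
  shows "\<exists>s. topological_clique V E s \<and>
    (\<alpha> \<le> exp 1 * ln n \<longrightarrow> c * n powr (\<alpha> / (2 * \<alpha> - 1)) \<le> s) \<and>
    (\<alpha> = a * ln n \<longrightarrow> exp 1 < a \<longrightarrow> c * sqrt (n / (a * ln a)) \<le> s)"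
proof -
  have L: "0 < ln n" using n(2) by simp
  define x where "x = c * n powr (\<alpha> / (2 * \<alpha> - 1))"
  have c0: "0 < c" "c \<le> 1 / 100000000" by (simp_all add: c)
  have Vne: "V \<noteq> {}" using edge by auto
  have one: "topological_clique V E 1" using Vne topological_clique_single by blast
  have e1: "1 < exp (1::real)" by simp
  have sqrt_le: "c * sqrt (n / (a * ln a)) \<le> x" if "exp 1 < a" for a
  proof -
    have a0: "0 < a" using that e1 by linarith
    then have "1 \<le> ln a" using that by (simp add: ln_ge_iff)
    moreover have "1 \<le> a" using that e1 by linarith
    ultimately have "1 * 1 \<le> a * ln a" by (intro mult_mono) auto
    then have "n / (a * ln a) \<le> n / 1" using n(2) by (intro divide_left_mono) auto
    then have "sqrt (n / (a * ln a)) \<le> sqrt n" by simp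
    also have "sqrt n = n powr (1 / 2)" using n(2) by (simp add: powr_half_sqrt)
    also have "\<dots> \<le> n powr (\<alpha> / (2 * \<alpha> - 1))" using n(2) \<alpha>(1) by (intro powr_mono) (auto simp: field_simps)
    finally show ?thesis using c0 by (simp add: x_def)
  qed
  define a' where "a' = max (\<alpha> / ln n) (exp 1)"
  have "\<alpha> / ln n \<le> a'" "exp 1 \<le> a'" by (simp_all add: a'_def)
  moreover from this have "0 < a'" using e1 by linarith
  ultimately have a': "exp 1 \<le> a'" "\<alpha> \<le> a' * ln n" "0 < a'"
    using L by (simp_all add: pos_divide_le_eq)
  have lna: "1 \<le> ln a'" using a' by (simp add: ln_ge_iff)
  define \<tau> where "\<tau> = 1 / ln a'"
  have tau: "0 < \<tau>" "\<tau> \<le> 1" using lna by (auto simp: \<tau>_def)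
  obtain U where U: "U \<subseteq> V" "extremal_subset U E \<tau>"
    and Umax: "\<And>A. A \<subseteq> V \<Longrightarrow> A \<noteq> {} \<Longrightarrow>
      card A / alpha E A powr (1 + \<tau>) \<le> card U / alpha E U powr (1 + \<tau>)"
    by (rule extremal_subset_exists[OF fin symE irE Vne tau]) (rule that)
  interpret extremal_subset U E \<tau> by (rule U(2))
  have b1: "1 \<le> b" using b_pos by simp
  have bV: "b \<le> \<alpha>" using alpha_mono[OF fin U(1), of E] \<alpha>(2) by linarith
  define t where "t = b / \<alpha>"
  have t: "0 < t" "t \<le> 1" using bV b1 \<alpha>(1) by (auto simp: t_def)
  have Nt: "n * t powr (1 + \<tau>) \<le> N"
  proof -
    have aV: "0 < real (alpha E V)" using alpha_pos[OF fin irE Vne] by simp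
    have "n / \<alpha> powr (1 + \<tau>) \<le> n / alpha E V powr (1 + \<tau>)"
      using aV \<alpha> n(2) tau by (intro divide_left_mono powr_mono2) auto
    also have "\<dots> \<le> N / b powr (1 + \<tau>)" using Umax[of V] Vne n(1) by simp
    finally have "n / \<alpha> powr (1 + \<tau>) * b powr (1 + \<tau>) \<le> N" using b1 by (simp add: pos_le_divide_eq)
    then show ?thesis using b1 \<alpha>(1) by (simp add: t_def powr_divide)
  qed
  have Nt2: "n * t\<^sup>2 \<le> N"
  proof -
    have "t powr 2 \<le> t powr (1 + \<tau>)" using t tau by (intro powr_mono') auto
    then have "n * t\<^sup>2 \<le> n * t powr (1 + \<tau>)" using n(2) t by (intro mult_left_mono) auto
    then show ?thesis using Nt by linarith
  qed
  (* The ratio of an edge is 2, so the maximal ratio is at least 2. *)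
  have edges: "2 * b \<le> N"
  proof -
    obtain u v where uv: "(u, v) \<in> E" "u \<in> V" "v \<in> V" using edge by auto
    then have uv': "u \<noteq> v" using irE by (auto simp: irrefl_def)
    have "alpha E {u, v} \<le> 1"
    proof (rule alpha_leI)
      fix S assume S: "S \<subseteq> {u, v}" "indep E S"
      then have "S \<noteq> {u, v}" using uv by (auto simp: indep_def)
      then have "card S < card {u, v}" using S by (intro psubset_card_mono) auto
      then show "card S \<le> 1" using uv' by simp
    qed simp
    moreover have "0 < alpha E {u, v}" using alpha_pos[of "{u, v}"] irE by simp
    ultimately have "alpha E {u, v} = 1" by simp
    then have "2 \<le> N / b powr (1 + \<tau>)" using Umax[of "{u, v}"] uv uv' by simp
    also have "\<dots> \<le> N / b powr 1"
      using b1 tau N_pos by (intro divide_left_mono powr_mono) auto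
    finally show ?thesis using b1 by (simp add: pos_le_divide_eq)
  qed
  define \<theta> where "\<theta> = 100000000 * (a' * ln a') * t"
  have "0 < ln a'" using lna by linarith
  then have th0: "0 < \<theta>" using t(1) a'(3) by (simp add: \<theta>_def)
  show ?thesis
  proof (cases "N \<le> 2 * card {v \<in> U. card (E `` {v} \<inter> U) < N / \<theta>}")
    case True
    have "\<exists>s. topological_clique V E s \<and> x \<le> s"
    proof (cases "1 \<le> x")
      case x1: True
      have "topological_clique U E (nat \<lceil>x\<rceil>)"
        by (rule clique_in_low_degrees[OF n(2) a'(1) \<tau>_def \<alpha>(1) a'(2) bV _ edges _ c0 x_def x1])
          (use Nt2 True in \<open>simp_all add: t_def \<theta>_def\<close>)
      then have "topological_clique V E (nat \<lceil>x\<rceil>)" using topological_clique_mono U(1) by blast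
      moreover have "x \<le> nat \<lceil>x\<rceil>" by (rule real_nat_ceiling_ge)
      ultimately show ?thesis by blast
    next
      case False
      then show ?thesis using one by (intro exI[of _ 1]) simp
    qed
    then obtain s where "topological_clique V E s" "x \<le> s" by blast
    then show ?thesis using sqrt_le[of a] by (intro exI[of _ s]) (auto simp: x_def)
  next
    case False
    have "card {v \<in> U. card (E `` {v} \<inter> U) < N / \<theta>} + card {v \<in> U. N / \<theta> \<le> card (E `` {v} \<inter> U)} = card U"
      using finU by (subst card_Un_disjoint[symmetric]) (auto intro: arg_cong[where f = card])
    then have high: "N \<le> 2 * card {v \<in> U. N / \<theta> \<le> card (E `` {v} \<inter> U)}" using False by linarith
    have "{v \<in> U. N / \<theta> \<le> card (E `` {v} \<inter> U)} \<noteq> {}"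
    proof
      assume e: "{v \<in> U. N / \<theta> \<le> card (E `` {v} \<inter> U)} = {}"
      show False using high N_pos unfolding e by simp
    qed
    then obtain v where v: "v \<in> U" "N / \<theta> \<le> card (E `` {v} \<inter> U)" by blast
    have "card (E `` {v} \<inter> U) \<le> card U" using finU by (intro card_mono) auto
    then have "N / \<theta> \<le> N" using v by linarith
    then have th1: "1 \<le> \<theta>" using N_pos th0 by (simp add: field_simps)
    show ?thesis
    proof (cases "\<alpha> \<le> exp 1 * ln n")
      case small: True
      then have "\<alpha> / ln n \<le> exp 1" using L by (simp add: field_simps)
      then have ae: "a' = exp 1" by (simp add: a'_def)
      have "exp (1::real) \<le> 3" by (rule exp_le)
      then have th: "\<theta> \<le> 300000000 * t" using t by (simp add: \<theta>_def ae)
      have thK: "\<theta> \<le> 300000000" using th t by linarith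
      have tK: "1 / 300000000 \<le> t" using th th1 by linarith
      have x: "x \<le> s" if "s = nat \<lceil>x\<rceil>" for s using that real_nat_ceiling_ge by simp
      have "\<exists>s. topological_clique V E s \<and> x \<le> s"
      proof (cases "1 \<le> x")
        case x1: True
        have "n / 300000000\<^sup>2 \<le> N"
        proof -
          have "n * (1 / 300000000)\<^sup>2 \<le> n * t\<^sup>2" using tK n(2) by (intro mult_left_mono power_mono) auto
          then show ?thesis using Nt2 by (simp add: power_divide)
        qed
        then have "topological_clique U E (nat \<lceil>x\<rceil>)"
          by (intro clique_in_high_degrees[OF n(2) _ \<alpha>(1) bV _ _ th1 thK high c x_def x1])
            (simp_all add: \<tau>_def ae)
        then have "topological_clique V E (nat \<lceil>x\<rceil>)" using topological_clique_mono U(1) by blast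
        then show ?thesis using real_nat_ceiling_ge by blast
      next
        case False
        then show ?thesis using one by (intro exI[of _ 1]) simp
      qed
      then obtain s where "topological_clique V E s" "x \<le> s" by blast
      then show ?thesis using sqrt_le[of a] by (intro exI[of _ s]) (auto simp: x_def)
    next
      case large: False
      show ?thesis
      proof (cases "\<alpha> = a * ln n \<and> exp 1 < a")
        case False
        then show ?thesis using large one by blast
      next
        case True
        then have aa: "a' = a" using L by (simp add: a'_def)
        (* t is at least of order 1 / a^2 because the degrees are at most N; so t powr tau, a power
           with exponent 1 / ln a, is bounded below and the passage to U costs only a constant
           factor. *)
        define y where "y = c * sqrt (n / (a * ln a))"
        have y: "6400 * y\<^sup>2 \<le> N / \<theta>"
        proof -
          define A where "A = a * ln a"
          have lna': "1 \<le> ln a" "0 < a" "exp 1 < a" using lna a' aa True by auto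
          have a1: "a \<noteq> 1" using lna'(3) e1 by linarith
          have A1: "1 \<le> A" using mult_mono[of 1 a 1 "ln a"] lna' e1 by (simp add: A_def)
          have "ln a \<le> a" using lna' ln_le_minus_one[of a] by simp
          then have "A \<le> a * a" using lna' by (simp add: A_def)
          have tA: "1 / (100000000 * (a * a)) \<le> t"
          proof -
            have "1 \<le> 100000000 * A * t" using th1 by (simp add: \<theta>_def aa A_def)
            also have "\<dots> \<le> 100000000 * (a * a) * t" using \<open>A \<le> a * a\<close> t by (intro mult_right_mono mult_left_mono) auto
            finally show ?thesis using lna' by (simp add: pos_divide_le_eq algebra_simps)
          qed
          have "1 / 900000000 \<le> (1 / (100000000 * (a * a))) powr \<tau>"
          proof -
            have "(100000000 * (a * a)) powr \<tau> = 100000000 powr \<tau> * (a powr \<tau> * a powr \<tau>)"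
              using lna' by (simp add: powr_mult)
            also have "a powr \<tau> = exp 1" using lna' a1 by (simp add: powr_def \<tau>_def aa)
            also have "100000000 powr \<tau> * (exp 1 * exp 1) \<le> 100000000 powr 1 * (3 * 3)"
              using tau exp_le by (intro mult_mono powr_mono) auto
            finally have "(100000000 * (a * a)) powr \<tau> \<le> 900000000" by simp
            then have "1 / 900000000 \<le> 1 / (100000000 * (a * a)) powr \<tau>"
              using lna' by (intro divide_left_mono) auto
            then show ?thesis using lna' by (simp add: powr_divide)
          qed
          also have "\<dots> \<le> t powr \<tau>" using tA tau lna' by (intro powr_mono2) auto
          finally have tt: "1 / 900000000 \<le> t powr \<tau>" .
          have "y\<^sup>2 = c\<^sup>2 * (n / A)" using n(2) A1 by (simp add: y_def A_def[symmetric] power_mult_distrib)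
          also have "\<dots> \<le> (1 / 6400 * (1 / 90000000000000000)) * (n / A)"
            using A1 n(2) by (intro mult_right_mono) (auto simp: c power_divide)
          finally have "6400 * y\<^sup>2 \<le> (n / A) * (1 / 100000000) * (1 / 900000000)" by simp
          also have "\<dots> \<le> (n / A) * (1 / 100000000) * t powr \<tau>"
            using tt A1 n(2) by (intro mult_left_mono) auto
          also have "\<dots> = n * t powr (1 + \<tau>) / \<theta>"
            using t A1 by (simp add: \<theta>_def aa A_def[symmetric] powr_add)
          also have "\<dots> \<le> N / \<theta>" using Nt th0 by (intro divide_right_mono) auto
          finally show ?thesis .
        qed
        have "\<exists>s. topological_clique V E s \<and> y \<le> s"
        proof (cases "1 \<le> y")
          case y1: True
          have "topological_clique U E (nat \<lceil>y\<rceil>)" by (rule clique_by_average_degree[OF th0 high y1 y])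
          then have "topological_clique V E (nat \<lceil>y\<rceil>)" using topological_clique_mono U(1) by blast
          then show ?thesis using real_nat_ceiling_ge by blast
        next
          case False
          then show ?thesis using one by (intro exI[of _ 1]) simp
        qed
        then show ?thesis using large by (auto simp: y_def)
      qed
    qed
  qed
qed

text \<open>
  Without edges we have \<open>n \<le> \<alpha>\<close>. This contradicts \<open>\<alpha> < 2
  ln n\<close> and makes the second bound constant.
\<close>

lemma edgeless_bounds:
  fixes n a :: real
  assumes n: "2 \<le> n"
  shows "2 * ln n \<le> n"
    and "2 \<le> a \<Longrightarrow> n \<le> a * ln n \<Longrightarrow> sqrt (n / (a * ln a)) \<le> 3"
proof -
  have "ln n = 2 * ln (sqrt n)" using n by (simp add: ln_sqrt)
  also have "\<dots> \<le> 2 * (sqrt n - 1)" using n ln_le_minus_one[of "sqrt n"] by simp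
  also have "\<dots> \<le> n / 2"
  proof -
    have "0 \<le> (sqrt n - 2)\<^sup>2" by simp
    also have "\<dots> = n - 4 * sqrt n + 4" using n by (simp add: power2_diff)
    finally show ?thesis by (simp add: field_simps)
  qed
  finally show "2 * ln n \<le> n" by simp
  assume a: "2 \<le> a" "n \<le> a * ln n"
  have L: "0 < ln n" using n by simp
  have "ln (n powr (3 / 4)) \<le> n powr (3 / 4) - 1" using n by (intro ln_le_minus_one) simp
  then have ub: "ln n \<le> 4 / 3 * n powr (3 / 4)" using n by (simp add: ln_powr)
  have "n powr (1 / 4) * n powr (3 / 4) = n" using n by (simp add: powr_add[symmetric])
  also have "\<dots> \<le> a * (4 / 3 * n powr (3 / 4))" using a ub by (meson mult_left_mono order_trans zero_le_numeral)
  finally have "n powr (1 / 4) * n powr (3 / 4) \<le> (4 / 3 * a) * n powr (3 / 4)" by simp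
  then have "n powr (1 / 4) \<le> 4 / 3 * a" using n by (simp add: mult_le_cancel_right_pos)
  also have "\<dots> \<le> a * a" using a by (intro mult_right_mono) auto
  finally have "ln (n powr (1 / 4)) \<le> ln (a * a)" using n a by (subst ln_le_cancel_iff) auto
  then have "ln n \<le> 8 * ln a" using n a by (simp add: ln_powr ln_mult)
  have la: "0 < ln a" using a by simp
  have "n / (a * ln a) \<le> (a * ln n) / (a * ln a)" using a la by (intro divide_right_mono) auto
  also have "\<dots> = ln n / ln a" using a by simp
  also have "\<dots> \<le> 8" using \<open>ln n \<le> 8 * ln a\<close> la by (simp add: pos_divide_le_eq)
  finally have "sqrt (n / (a * ln a)) \<le> sqrt (3\<^sup>2)" by (intro real_sqrt_le_mono) simp
  then show "sqrt (n / (a * ln a)) \<le> 3" by simp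
qed

lemma topological_clique_le_subdivision_number:
  fixes G :: "'a::linorder pair_pre_digraph"
  assumes "pair_graph G" "topological_clique (pverts G) (parcs G) s"
  shows "s \<le> clique_subdivision_number G"
  unfolding clique_subdivision_number_def
  using topological_clique_subdivision[OF assms] finite_clique_subdivision_orders(1)[OF assms(1)]
  by (intro Max_ge) auto

lemma independence_number_eq_alpha:
  "independence_number G = alpha (parcs G) (pverts G)"
  unfolding independence_number_def alpha_def
  by (rule arg_cong[where f = Max]) (auto simp: independent_set_def indep_def)

lemma clique_subdivision_number_lower_bounds:
  fixes G :: "nat pair_pre_digraph" and a c :: real
  assumes G: "G \<in> admissible_graphs n \<alpha>" and n: "0 < n" and \<alpha>: "0 < \<alpha>" and c: "c = 1 / (64 * 300000000 ^ 3)"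
  shows "real \<alpha> < 2 * ln (real n) \<Longrightarrow> c * real n powr (real \<alpha> / (2 * real \<alpha> - 1)) \<le> clique_subdivision_number G"
    and "2 \<le> a \<Longrightarrow> real \<alpha> = a * ln (real n) \<Longrightarrow> c * sqrt (real n / (a * ln a)) \<le> clique_subdivision_number G"
proof -
  have pg: "pair_graph G" and cG: "card (pverts G) = n" and iG: "alpha (parcs G) (pverts G) \<le> \<alpha>"
    using G by (auto simp: admissible_graphs_def independence_number_eq_alpha)
  interpret G: pair_graph G by (rule pg)
  let ?V = "pverts G" and ?E = "parcs G"
  have fin: "finite ?V" by (rule G.pair_finite_verts)
  have symE: "sym ?E" using G.arcs_symmetric by (auto intro: symI)
  have irE: "irrefl ?E" 
  proof (rule irreflI)
    show "(v, v) \<notin> ?E" for v using G.adj_not_same by blast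
  qed
  have \<alpha>1: "1 \<le> real \<alpha>" using \<alpha> by simp
  have Vne: "?V \<noteq> {}" using cG n by auto
  then have one: "1 \<le> clique_subdivision_number G"
    using topological_clique_le_subdivision_number[OF pg] topological_clique_single by blast
  have c0: "0 < c" "c \<le> 1 / 3" by (simp_all add: c)
  have n2: "2 \<le> real n" if "0 < ln (real n)"
  proof -
    have "n \<noteq> 1" using that by auto
    then show ?thesis using n by linarith
  qed
  have edgeless: "real n \<le> real \<alpha>" if "?E \<inter> ?V \<times> ?V = {}"
  proof -
    have "card ?V \<le> alpha ?E ?V" using that by (intro indep_le_alpha[OF fin]) (auto simp: indep_def)
    then show ?thesis using iG cG by simp
  qed
  have main: "\<exists>s. s \<le> clique_subdivision_number G \<and>
      (real \<alpha> \<le> exp 1 * ln (real n) \<longrightarrow> c * real n powr (real \<alpha> / (2 * real \<alpha> - 1)) \<le> s) \<and>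
      (real \<alpha> = a * ln (real n) \<longrightarrow> exp 1 < a \<longrightarrow> c * sqrt (real n / (a * ln a)) \<le> s)"
    if "?E \<inter> ?V \<times> ?V \<noteq> {}" "0 < ln (real n)" for a
  proof -
    have "real n = real (card ?V)" "real (alpha ?E ?V) \<le> real \<alpha>" using cG iG by simp_all
    from clique_subdivision_with_edges[OF fin symE irE that(1) this(1) n2[OF that(2)] \<alpha>1 this(2) c, of a]
    show ?thesis using topological_clique_le_subdivision_number[OF pg] by blast
  qed
  have e2: "2 \<le> exp (1::real)" using exp_ge_add_one_self[of 1] by simp
  {
    assume lt: "real \<alpha> < 2 * ln (real n)"
    then have L: "0 < ln (real n)" using \<alpha>1 by linarith
    have "?E \<inter> ?V \<times> ?V \<noteq> {}"
    proof
      assume "?E \<inter> ?V \<times> ?V = {}"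
      then have "real n < 2 * ln (real n)" using edgeless lt by linarith
      then show False using edgeless_bounds(1)[OF n2[OF L]] by linarith
    qed
    moreover have "2 * ln (real n) \<le> exp 1 * ln (real n)" using e2 L by (intro mult_right_mono) auto
    ultimately obtain s where "s \<le> clique_subdivision_number G"
      "c * real n powr (real \<alpha> / (2 * real \<alpha> - 1)) \<le> s"
      using main[of 0] L lt by (meson less_imp_le order_trans)
    then show "c * real n powr (real \<alpha> / (2 * real \<alpha> - 1)) \<le> clique_subdivision_number G" by linarith
  }
  {
    assume a: "2 \<le> a" "real \<alpha> = a * ln (real n)"
    have L: "0 < ln (real n)"
    proof (rule ccontr)
      assume "\<not> ?thesis"
      then have "a * ln (real n) \<le> 0" using a(1) by (simp add: mult_le_0_iff)
      then show False using a(2) \<alpha>1 by linarith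
    qed
    note n2 = n2[OF L]
    show "c * sqrt (real n / (a * ln a)) \<le> clique_subdivision_number G"
    proof (cases "?E \<inter> ?V \<times> ?V = {}")
      case True
      then have "sqrt (real n / (a * ln a)) \<le> 3" using edgeless_bounds(2)[OF n2 a(1)] edgeless a(2) by simp
      then have "c * sqrt (real n / (a * ln a)) \<le> c * 3" using c0 by (intro mult_left_mono) auto
      then show ?thesis using c0 one by linarith
    next
      case False
      then obtain s where s: "s \<le> clique_subdivision_number G"
        "real \<alpha> \<le> exp 1 * ln (real n) \<longrightarrow> c * real n powr (real \<alpha> / (2 * real \<alpha> - 1)) \<le> s"
        "real \<alpha> = a * ln (real n) \<longrightarrow> exp 1 < a \<longrightarrow> c * sqrt (real n / (a * ln a)) \<le> s"
        using main[of a] L by blast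
      show ?thesis
      proof (cases "exp 1 < a")
        case True
        then show ?thesis using s a by linarith
      next
        case False
        then have "real \<alpha> \<le> exp 1 * ln (real n)" using a(2) L by (simp add: mult_right_mono)
        then have x: "c * real n powr (real \<alpha> / (2 * real \<alpha> - 1)) \<le> s" using s by blast
        have "ln 2 \<le> ln a" using a(1) by simp
        moreover have "1 / 2 \<le> ln (2::real)"
        proof -
          have "exp (1 / 2) * exp (1 / 2) = exp (1::real)" by (simp flip: exp_add)
          also have "\<dots> \<le> 2 * 2" using exp_le by simp
          finally have "exp (1 / 2) \<le> (2::real)" by (metis abs_le_square_iff abs_of_pos exp_gt_zero power2_eq_square zero_less_numeral)
          then show ?thesis by (subst ln_ge_iff) auto
        qed
        ultimately have "1 / 2 \<le> ln a" by linarith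
        then have "2 * (1 / 2) \<le> a * ln a" using a(1) by (intro mult_mono) simp_all
        then have "real n / (a * ln a) \<le> real n / 1" by (intro divide_left_mono) auto
        then have "sqrt (real n / (a * ln a)) \<le> sqrt (real n)" by simp
        also have "sqrt (real n) = real n powr (1 / 2)" by (simp add: powr_half_sqrt)
        also have "\<dots> \<le> real n powr (real \<alpha> / (2 * real \<alpha> - 1))"
          using n2 \<alpha>1 by (intro powr_mono) (auto simp: field_simps)
        finally have "c * sqrt (real n / (a * ln a)) \<le> c * real n powr (real \<alpha> / (2 * real \<alpha> - 1))"
          using c0 by (intro mult_left_mono) auto
        then show ?thesis using x s(1) by linarith
      qed
    qed
  }
qed

theorem theorem1p2:
  shows "\<exists>c\<^sub>1 c\<^sub>2 :: real. c\<^sub>1 > 0 \<and> c\<^sub>2 > 0 \<and>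
    (\<forall>n \<alpha> :: nat. n > 0 \<longrightarrow> \<alpha> > 0 \<longrightarrow>
      (real \<alpha> < 2 * ln (real n) \<longrightarrow>
        real (min_clique_subdivision_number n \<alpha>) \<ge> c\<^sub>1 * real n powr (real \<alpha> / (2 * real \<alpha> - 1)))
      \<and> (\<forall>a :: real. a \<ge> 2 \<longrightarrow> real \<alpha> = a * ln (real n) \<longrightarrow>
        real (min_clique_subdivision_number n \<alpha>) \<ge> c\<^sub>2 * sqrt (real n / (a * ln a))))"
proof -
  define c :: real where "c = 1 / (64 * 300000000 ^ 3)"
  have "0 < c" by (simp add: c_def)
  have attained: "\<exists>G\<in>admissible_graphs n \<alpha>. min_clique_subdivision_number n \<alpha> = clique_subdivision_number G"
    if "\<alpha> > 0" for n \<alpha>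
  proof -
    have "min_clique_subdivision_number n \<alpha> \<in> clique_subdivision_number ` admissible_graphs n \<alpha>"
      unfolding min_clique_subdivision_number_def
      using admissible_graphs_nonempty[of \<alpha> n] that by (intro Min_in finite_sigma_admissible) auto
    then show ?thesis by blast
  qed
  show ?thesis
  proof (rule exI[of _ c], rule exI[of _ c], intro conjI allI impI)
    fix n \<alpha> :: nat
    assume n: "n > 0" and \<alpha>: "\<alpha> > 0"
    obtain G where G: "G \<in> admissible_graphs n \<alpha>"
      and min: "min_clique_subdivision_number n \<alpha> = clique_subdivision_number G"
      using attained[OF \<alpha>] by blast
    show "real (min_clique_subdivision_number n \<alpha>) \<ge> c * real n powr (real \<alpha> / (2 * real \<alpha> - 1))"
      if "real \<alpha> < 2 * ln (real n)"
      using clique_subdivision_number_lower_bounds(1)[OF G n \<alpha> c_def that] min by simp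
    show "real (min_clique_subdivision_number n \<alpha>) \<ge> c * sqrt (real n / (a * ln a))"
      if "a \<ge> 2" "real \<alpha> = a * ln (real n)" for a
      using clique_subdivision_number_lower_bounds(2)[OF G n \<alpha> c_def that] min by simp
  qed (use \<open>0 < c\<close> in auto)
qed

end
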